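(* Each nearly Sasakian (non-Sasakian) $5$-dimensional manifold carries a Sasaki-Einstein structure. Conversely, each Sasaki-Einstein $5$-manifold carries a $1$-parameter family of nearly Sasakian (non-Sasakian) structures.
   Context: All manifolds are smooth and connected; $\nabla$ is the Levi-Civita connection of $g$; $d\eta(X,Y)=X(\eta(Y))-Y(\eta(X))-\eta([X,Y])$ and $u\wedge v=u\otimes v-v\otimes u$ for $1$-forms. An almost contact metric structure $(\phi,\xi,\eta,g)$ on $M^{2n+1}$ consists of a $(1,1)$-tensor field $\phi$, a vector field $\xi$, a $1$-form $\eta$ and a Riemannian metric $g$ with $\phi^2=-I+\eta\otimes\xi$, $\eta(\xi)=1$, $g(\phi X,\phi Y)=g(X,Y)-\eta(X)\eta(Y)$. It is Sasakian if $(\nabla_X\phi)Y=g(X,Y)\xi-\eta(Y)X$, and nearly Sasakian if $(\nabla_X\phi)Y+(\nabla_Y\phi)X=2g(X,Y)\xi-\eta(X)Y-\eta(Y)X$ for all vector fields $X,Y$. An $SU(2)$-structure on a $5$-manifold is given equivalently by (i) three almost contact metric structures $(\phi_i,\xi,\eta,g)$, $i\in\{1,2,3\}$, with the same $\xi,\eta,g$ and $\phi_i\phi_j=\phi_k=-\phi_j\phi_i$ for every even permutation $(i,j,k)$ of $(1,2,3)$; or (ii) a quadruplet $(\eta,\omega_1,\omega_2,\omega_3)$ of a $1$-form and three $2$-forms with $\omega_i\wedge\omega_j=\delta_{ij}v$ for some $4$-form $v$ with $v\wedge\eta\neq0$, and such that $X\lrcorner\,\omega_1=Y\lrcorner\,\omega_2$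 implies $\omega_3(X,Y)\ge0$. The two descriptions are related by $\omega_i(X,Y)=g(\phi_iX,Y)$. A Sasaki-Einstein structure on a $5$-manifold is an $SU(2)$-structure with $d\eta=-2\omega_3$, $d\omega_1=3\eta\wedge\omega_2$, $d\omega_2=-3\eta\wedge\omega_1$. *)

theory Defs
  imports "HOL-Analysis.Analysis" "HOL-Library.Function_Algebras"
begin

section \<open>Smooth manifolds\<close>

fun times_differentiable_on ::
  "nat \<Rightarrow> ('e::real_normed_vector \<Rightarrow> 'b::real_normed_vector) \<Rightarrow> 'e set \<Rightarrow> bool" where
  "times_differentiable_on 0 f S \<longleftrightarrow> continuous_on S f"
| "times_differentiable_on (Suc k) f S \<longleftrightarrow>
     (\<forall>x\<in>S. f differentiable (at x)) \<and>
     (\<forall>v. times_differentiable_on k (\<lambda>x. frechet_derivative f (at x) v) S)"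

text \<open>Only meaningful (and only used) for open sets.\<close>

definition smooth_on :: "('e::real_normed_vector \<Rightarrow> 'b::real_normed_vector) \<Rightarrow> 'e set \<Rightarrow> bool" where
  "smooth_on f S \<longleftrightarrow> (\<forall>k. times_differentiable_on k f S)"

text \<open>A chart is a pair \<open>(U, c)\<close> of a domain and a coordinate map; the values of \<open>c\<close> outside \<open>U\<close>
  are irrelevant. The manifold is the whole type \<open>'a\<close>, and its dimension is that of the
  Euclidean model space \<open>'e\<close>. The atlas need not be maximal.\<close>

type_synonym ('a, 'e) atlas = "('a set \<times> ('a \<Rightarrow> 'e)) set"

definition smooth_atlas ::
  "('a::topological_space, 'e::euclidean_space) atlas \<Rightarrow> bool" where
  "smooth_atlas A \<longleftrightarrow>
     (\<forall>(U, c)\<in>A. open U \<and> open (c ` U) \<and> homeomorphism U (c ` U) c (inv_into U c)) \<and>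
     (\<Union>(U, c)\<in>A. U) = UNIV \<and>
     (\<forall>(U, c)\<in>A. \<forall>(V, d)\<in>A. smooth_on (d \<circ> inv_into U c) (c ` (U \<inter> V)))"

definition connected_manifold ::
  "('a::{t2_space, second_countable_topology}, 'e::euclidean_space) atlas \<Rightarrow> bool" where
  "connected_manifold A \<longleftrightarrow> smooth_atlas A \<and> connected (UNIV :: 'a set)"

definition smooth_fun ::
  "('a::topological_space, 'e::euclidean_space) atlas \<Rightarrow> ('a \<Rightarrow> real) \<Rightarrow> bool" where
  "smooth_fun A f \<longleftrightarrow> (\<forall>(U, c)\<in>A. smooth_on (f \<circ> inv_into U c) (c ` U))"

text \<open>Joint smoothness of a map on \<open>I \<times> M\<close> for an open set \<open>I\<close> of parameters.\<close>

definition smooth_family_fun ::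
  "('a::topological_space, 'e::euclidean_space) atlas \<Rightarrow> real set \<Rightarrow> (real \<Rightarrow> 'a \<Rightarrow> real) \<Rightarrow> bool" where
  "smooth_family_fun A I F \<longleftrightarrow>
     (\<forall>(U, c)\<in>A. smooth_on (\<lambda>(t, x). F t (inv_into U c x)) (I \<times> c ` U))"


section \<open>Tangent vectors and tensor fields\<close>

text \<open>A tangent vector at \<open>p\<close> is a derivation at \<open>p\<close> of the algebra of smooth functions,
  set to \<open>0\<close> on the other functions so that equality of tangent vectors is equality in HOL.
  Sums, differences and \<open>0\<close> of tangent vectors and of vector fields are those of
  \<^theory>\<open>HOL-Library.Function_Algebras\<close>.\<close>

type_synonym 'a tvec = "('a \<Rightarrow> real) \<Rightarrow> real"

definition tscale :: "real \<Rightarrow> 'a tvec \<Rightarrow> 'a tvec" (infixr "*\<^sub>T" 75) where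
  "a *\<^sub>T v = (\<lambda>f. a * v f)"

definition tangent_space ::
  "('a::topological_space, 'e::euclidean_space) atlas \<Rightarrow> 'a \<Rightarrow> 'a tvec set" where
  "tangent_space A p = {v.
     (\<forall>f h. smooth_fun A f \<longrightarrow> smooth_fun A h \<longrightarrow> v (\<lambda>x. f x + h x) = v f + v h) \<and>
     (\<forall>a f. smooth_fun A f \<longrightarrow> v (\<lambda>x. a * f x) = a * v f) \<and>
     (\<forall>f h. smooth_fun A f \<longrightarrow> smooth_fun A h \<longrightarrow> v (\<lambda>x. f x * h x) = f p * v h + h p * v f) \<and>
     (\<forall>f. \<not> smooth_fun A f \<longrightarrow> v f = 0)}"

definition deriv_along :: "('a \<Rightarrow> 'a tvec) \<Rightarrow> ('a \<Rightarrow> real) \<Rightarrow> 'a \<Rightarrow> real" where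
  "deriv_along X f = (\<lambda>p. X p f)"

definition vector_field ::
  "('a::topological_space, 'e::euclidean_space) atlas \<Rightarrow> ('a \<Rightarrow> 'a tvec) \<Rightarrow> bool" where
  "vector_field A X \<longleftrightarrow>
     (\<forall>p. X p \<in> tangent_space A p) \<and> (\<forall>f. smooth_fun A f \<longrightarrow> smooth_fun A (deriv_along X f))"

definition lie_bracket :: "('a \<Rightarrow> 'a tvec) \<Rightarrow> ('a \<Rightarrow> 'a tvec) \<Rightarrow> 'a \<Rightarrow> 'a tvec" where
  "lie_bracket X Y = (\<lambda>p f. X p (deriv_along Y f) - Y p (deriv_along X f))"

text \<open>Tensor fields are families of (multi)linear maps on the tangent spaces; their values on
  arguments that are not tangent vectors at the given point are irrelevant. Smoothness is tested on
  smooth vector fields.\<close>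

definition linear_form_at ::
  "('a::topological_space, 'e::euclidean_space) atlas \<Rightarrow> 'a \<Rightarrow> ('a tvec \<Rightarrow> real) \<Rightarrow> bool" where
  "linear_form_at A p \<alpha> \<longleftrightarrow>
     (\<forall>v\<in>tangent_space A p. \<forall>w\<in>tangent_space A p. \<alpha> (v + w) = \<alpha> v + \<alpha> w) \<and>
     (\<forall>v\<in>tangent_space A p. \<forall>a. \<alpha> (a *\<^sub>T v) = a * \<alpha> v)"

definition one_form ::
  "('a::topological_space, 'e::euclidean_space) atlas \<Rightarrow> ('a \<Rightarrow> 'a tvec \<Rightarrow> real) \<Rightarrow> bool" where
  "one_form A \<eta> \<longleftrightarrow>
     (\<forall>p. linear_form_at A p (\<eta> p)) \<and>
     (\<forall>X. vector_field A X \<longrightarrow> smooth_fun A (\<lambda>p. \<eta> p (X p)))"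

definition endo_field ::
  "('a::topological_space, 'e::euclidean_space) atlas \<Rightarrow> ('a \<Rightarrow> 'a tvec \<Rightarrow> 'a tvec) \<Rightarrow> bool" where
  "endo_field A \<phi> \<longleftrightarrow>
     (\<forall>p. \<forall>v\<in>tangent_space A p. \<phi> p v \<in> tangent_space A p) \<and>
     (\<forall>p. \<forall>v\<in>tangent_space A p. \<forall>w\<in>tangent_space A p. \<phi> p (v + w) = \<phi> p v + \<phi> p w) \<and>
     (\<forall>p. \<forall>v\<in>tangent_space A p. \<forall>a. \<phi> p (a *\<^sub>T v) = a *\<^sub>T \<phi> p v) \<and>
     (\<forall>X. vector_field A X \<longrightarrow> vector_field A (\<lambda>p. \<phi> p (X p)))"

definition riemannian_metric ::
  "('a::topological_space, 'e::euclidean_space) atlas \<Rightarrow> ('a \<Rightarrow> 'a tvec \<Rightarrow> 'a tvec \<Rightarrow> real) \<Rightarrow> bool" where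
  "riemannian_metric A g \<longleftrightarrow>
     (\<forall>p. \<forall>v\<in>tangent_space A p. linear_form_at A p (g p v)) \<and>
     (\<forall>p. \<forall>v\<in>tangent_space A p. \<forall>w\<in>tangent_space A p. g p v w = g p w v) \<and>
     (\<forall>p. \<forall>v\<in>tangent_space A p. v \<noteq> 0 \<longrightarrow> g p v v > 0) \<and>
     (\<forall>X Y. vector_field A X \<longrightarrow> vector_field A Y \<longrightarrow> smooth_fun A (\<lambda>p. g p (X p) (Y p)))"

text \<open>Exterior derivatives, in the convention without numerical factors:
  \<open>d\<eta>(X,Y) = X(\<eta>(Y)) - Y(\<eta>(X)) - \<eta>([X,Y])\<close>, and the analogous formula for 2-forms. The wedge product
  of a 1-form with a 2-form is the one compatible with \<open>u \<and> v = u \<otimes> v - v \<otimes> u\<close>.\<close>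

definition ext_deriv1 ::
  "('a \<Rightarrow> 'a tvec \<Rightarrow> real) \<Rightarrow> ('a \<Rightarrow> 'a tvec) \<Rightarrow> ('a \<Rightarrow> 'a tvec) \<Rightarrow> 'a \<Rightarrow> real" where
  "ext_deriv1 \<eta> X Y = (\<lambda>p.
     X p (\<lambda>q. \<eta> q (Y q)) - Y p (\<lambda>q. \<eta> q (X q)) - \<eta> p (lie_bracket X Y p))"

definition ext_deriv2 ::
  "('a \<Rightarrow> 'a tvec \<Rightarrow> 'a tvec \<Rightarrow> real) \<Rightarrow> ('a \<Rightarrow> 'a tvec) \<Rightarrow> ('a \<Rightarrow> 'a tvec) \<Rightarrow> ('a \<Rightarrow> 'a tvec)
    \<Rightarrow> 'a \<Rightarrow> real" where
  "ext_deriv2 \<omega> X Y Z = (\<lambda>p.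
     X p (\<lambda>q. \<omega> q (Y q) (Z q)) - Y p (\<lambda>q. \<omega> q (X q) (Z q)) + Z p (\<lambda>q. \<omega> q (X q) (Y q))
     - \<omega> p (lie_bracket X Y p) (Z p) + \<omega> p (lie_bracket X Z p) (Y p)
     - \<omega> p (lie_bracket Y Z p) (X p))"

definition wedge12 ::
  "('a \<Rightarrow> 'a tvec \<Rightarrow> real) \<Rightarrow> ('a \<Rightarrow> 'a tvec \<Rightarrow> 'a tvec \<Rightarrow> real)
    \<Rightarrow> 'a \<Rightarrow> 'a tvec \<Rightarrow> 'a tvec \<Rightarrow> 'a tvec \<Rightarrow> real" where
  "wedge12 \<eta> \<omega> p u v w = \<eta> p u * \<omega> p v w + \<eta> p v * \<omega> p w u + \<eta> p w * \<omega> p u v"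


section \<open>The Levi-Civita connection\<close>

definition affine_connection ::
  "('a::topological_space, 'e::euclidean_space) atlas
    \<Rightarrow> (('a \<Rightarrow> 'a tvec) \<Rightarrow> ('a \<Rightarrow> 'a tvec) \<Rightarrow> 'a \<Rightarrow> 'a tvec) \<Rightarrow> bool" where
  "affine_connection A D \<longleftrightarrow>
     (\<forall>X Y. vector_field A X \<longrightarrow> vector_field A Y \<longrightarrow> vector_field A (D X Y)) \<and>
     (\<forall>X Y Z. vector_field A X \<longrightarrow> vector_field A Y \<longrightarrow> vector_field A Z \<longrightarrow>
        D (X + Y) Z = D X Z + D Y Z \<and> D X (Y + Z) = D X Y + D X Z) \<and>
     (\<forall>X Y f. vector_field A X \<longrightarrow> vector_field A Y \<longrightarrow> smooth_fun A f \<longrightarrow>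
        D (\<lambda>p. f p *\<^sub>T X p) Y = (\<lambda>p. f p *\<^sub>T D X Y p) \<and>
        D X (\<lambda>p. f p *\<^sub>T Y p) = (\<lambda>p. deriv_along X f p *\<^sub>T Y p + f p *\<^sub>T D X Y p))"

definition levi_civita ::
  "('a::topological_space, 'e::euclidean_space) atlas \<Rightarrow> ('a \<Rightarrow> 'a tvec \<Rightarrow> 'a tvec \<Rightarrow> real)
    \<Rightarrow> (('a \<Rightarrow> 'a tvec) \<Rightarrow> ('a \<Rightarrow> 'a tvec) \<Rightarrow> 'a \<Rightarrow> 'a tvec) \<Rightarrow> bool" where
  "levi_civita A g D \<longleftrightarrow>
     affine_connection A D \<and>
     (\<forall>X Y. vector_field A X \<longrightarrow> vector_field A Y \<longrightarrow> D X Y - D Y X = lie_bracket X Y) \<and>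
     (\<forall>X Y Z p. vector_field A X \<longrightarrow> vector_field A Y \<longrightarrow> vector_field A Z \<longrightarrow>
        X p (\<lambda>q. g q (Y q) (Z q)) = g p (D X Y p) (Z p) + g p (Y p) (D X Z p))"

text \<open>\<open>(\<nabla>\<^sub>X \<phi>) Y = \<nabla>\<^sub>X (\<phi> Y) - \<phi> (\<nabla>\<^sub>X Y)\<close>\<close>

definition cov_deriv_endo ::
  "(('a \<Rightarrow> 'a tvec) \<Rightarrow> ('a \<Rightarrow> 'a tvec) \<Rightarrow> 'a \<Rightarrow> 'a tvec) \<Rightarrow> ('a \<Rightarrow> 'a tvec \<Rightarrow> 'a tvec)
    \<Rightarrow> ('a \<Rightarrow> 'a tvec) \<Rightarrow> ('a \<Rightarrow> 'a tvec) \<Rightarrow> 'a \<Rightarrow> 'a tvec" where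
  "cov_deriv_endo D \<phi> X Y = D X (\<lambda>p. \<phi> p (Y p)) - (\<lambda>p. \<phi> p (D X Y p))"


section \<open>Almost contact metric structures\<close>

definition almost_contact_metric ::
  "('a::topological_space, 'e::euclidean_space) atlas \<Rightarrow> ('a \<Rightarrow> 'a tvec \<Rightarrow> 'a tvec) \<Rightarrow> ('a \<Rightarrow> 'a tvec)
    \<Rightarrow> ('a \<Rightarrow> 'a tvec \<Rightarrow> real) \<Rightarrow> ('a \<Rightarrow> 'a tvec \<Rightarrow> 'a tvec \<Rightarrow> real) \<Rightarrow> bool" where
  "almost_contact_metric A \<phi> \<xi> \<eta> g \<longleftrightarrow>
     endo_field A \<phi> \<and> vector_field A \<xi> \<and> one_form A \<eta> \<and> riemannian_metric A g \<and>
     (\<forall>p. \<forall>v\<in>tangent_space A p. \<phi> p (\<phi> p v) = - v + \<eta> p v *\<^sub>T \<xi> p) \<and>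
     (\<forall>p. \<eta> p (\<xi> p) = 1) \<and>
     (\<forall>p. \<forall>v\<in>tangent_space A p. \<forall>w\<in>tangent_space A p.
        g p (\<phi> p v) (\<phi> p w) = g p v w - \<eta> p v * \<eta> p w)"

text \<open>The Levi-Civita connection is determined by \<open>g\<close> on smooth vector fields, the only
  arguments that occur below.\<close>

definition sasakian ::
  "('a::topological_space, 'e::euclidean_space) atlas \<Rightarrow> ('a \<Rightarrow> 'a tvec \<Rightarrow> 'a tvec) \<Rightarrow> ('a \<Rightarrow> 'a tvec)
    \<Rightarrow> ('a \<Rightarrow> 'a tvec \<Rightarrow> real) \<Rightarrow> ('a \<Rightarrow> 'a tvec \<Rightarrow> 'a tvec \<Rightarrow> real) \<Rightarrow> bool" where
  "sasakian A \<phi> \<xi> \<eta> g \<longleftrightarrow>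
     almost_contact_metric A \<phi> \<xi> \<eta> g \<and>
     (\<exists>D. levi_civita A g D \<and>
       (\<forall>X Y p. vector_field A X \<longrightarrow> vector_field A Y \<longrightarrow>
          cov_deriv_endo D \<phi> X Y p = g p (X p) (Y p) *\<^sub>T \<xi> p - \<eta> p (Y p) *\<^sub>T X p))"

definition nearly_sasakian ::
  "('a::topological_space, 'e::euclidean_space) atlas \<Rightarrow> ('a \<Rightarrow> 'a tvec \<Rightarrow> 'a tvec) \<Rightarrow> ('a \<Rightarrow> 'a tvec)
    \<Rightarrow> ('a \<Rightarrow> 'a tvec \<Rightarrow> real) \<Rightarrow> ('a \<Rightarrow> 'a tvec \<Rightarrow> 'a tvec \<Rightarrow> real) \<Rightarrow> bool" where
  "nearly_sasakian A \<phi> \<xi> \<eta> g \<longleftrightarrow>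
     almost_contact_metric A \<phi> \<xi> \<eta> g \<and>
     (\<exists>D. levi_civita A g D \<and>
       (\<forall>X Y p. vector_field A X \<longrightarrow> vector_field A Y \<longrightarrow>
          cov_deriv_endo D \<phi> X Y p + cov_deriv_endo D \<phi> Y X p =
            (2 * g p (X p) (Y p)) *\<^sub>T \<xi> p - \<eta> p (X p) *\<^sub>T Y p - \<eta> p (Y p) *\<^sub>T X p))"

text \<open>Equality of two structures as tensor fields, that is, on tangent vectors.\<close>

definition same_structure ::
  "('a::topological_space, 'e::euclidean_space) atlas \<Rightarrow>
    ('a \<Rightarrow> 'a tvec \<Rightarrow> 'a tvec) \<Rightarrow> ('a \<Rightarrow> 'a tvec) \<Rightarrow>
    ('a \<Rightarrow> 'a tvec \<Rightarrow> real) \<Rightarrow> ('a \<Rightarrow> 'a tvec \<Rightarrow> 'a tvec \<Rightarrow> real) \<Rightarrow>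
    ('a \<Rightarrow> 'a tvec \<Rightarrow> 'a tvec) \<Rightarrow> ('a \<Rightarrow> 'a tvec) \<Rightarrow>
    ('a \<Rightarrow> 'a tvec \<Rightarrow> real) \<Rightarrow> ('a \<Rightarrow> 'a tvec \<Rightarrow> 'a tvec \<Rightarrow> real) \<Rightarrow> bool" where
  "same_structure A \<phi> \<xi> \<eta> g \<phi>' \<xi>' \<eta>' g' \<longleftrightarrow>
     (\<forall>p. \<xi> p = \<xi>' p) \<and>
     (\<forall>p. \<forall>v\<in>tangent_space A p. \<phi> p v = \<phi>' p v \<and> \<eta> p v = \<eta>' p v) \<and>
     (\<forall>p. \<forall>v\<in>tangent_space A p. \<forall>w\<in>tangent_space A p. g p v w = g' p v w)"

text \<open>A 1-parameter family of structures of kind \<open>P\<close>: indexed by an open interval of the real line,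
  depending smoothly on the parameter, with pairwise distinct members.\<close>

definition one_parameter_family ::
  "('a::topological_space, 'e::euclidean_space) atlas \<Rightarrow>
    (('a \<Rightarrow> 'a tvec \<Rightarrow> 'a tvec) \<Rightarrow> ('a \<Rightarrow> 'a tvec) \<Rightarrow>
     ('a \<Rightarrow> 'a tvec \<Rightarrow> real) \<Rightarrow> ('a \<Rightarrow> 'a tvec \<Rightarrow> 'a tvec \<Rightarrow> real) \<Rightarrow> bool) \<Rightarrow>
    real set \<Rightarrow>
    (real \<Rightarrow> 'a \<Rightarrow> 'a tvec \<Rightarrow> 'a tvec) \<Rightarrow> (real \<Rightarrow> 'a \<Rightarrow> 'a tvec) \<Rightarrow>
    (real \<Rightarrow> 'a \<Rightarrow> 'a tvec \<Rightarrow> real) \<Rightarrow> (real \<Rightarrow> 'a \<Rightarrow> 'a tvec \<Rightarrow> 'a tvec \<Rightarrow> real) \<Rightarrow> bool" where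
  "one_parameter_family A P I \<phi> \<xi> \<eta> g \<longleftrightarrow>
     open I \<and> is_interval I \<and> I \<noteq> {} \<and>
     (\<forall>t\<in>I. P (\<phi> t) (\<xi> t) (\<eta> t) (g t)) \<and>
     (\<forall>s\<in>I. \<forall>t\<in>I. s \<noteq> t \<longrightarrow>
        \<not> same_structure A (\<phi> s) (\<xi> s) (\<eta> s) (g s) (\<phi> t) (\<xi> t) (\<eta> t) (g t)) \<and>
     (\<forall>f. smooth_fun A f \<longrightarrow> smooth_family_fun A I (\<lambda>t p. \<xi> t p f)) \<and>
     (\<forall>X f. vector_field A X \<longrightarrow> smooth_fun A f \<longrightarrow>
        smooth_family_fun A I (\<lambda>t p. \<phi> t p (X p) f)) \<and>
     (\<forall>X. vector_field A X \<longrightarrow> smooth_family_fun A I (\<lambda>t p. \<eta> t p (X p))) \<and>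
     (\<forall>X Y. vector_field A X \<longrightarrow> vector_field A Y \<longrightarrow>
        smooth_family_fun A I (\<lambda>t p. g t p (X p) (Y p)))"


section \<open>SU(2)-structures\<close>

definition fundamental_form ::
  "('a \<Rightarrow> 'a tvec \<Rightarrow> 'a tvec) \<Rightarrow> ('a \<Rightarrow> 'a tvec \<Rightarrow> 'a tvec \<Rightarrow> real)
    \<Rightarrow> 'a \<Rightarrow> 'a tvec \<Rightarrow> 'a tvec \<Rightarrow> real" where
  "fundamental_form \<phi> g p v w = g p (\<phi> p v) w"

definition SU2_structure ::
  "('a::topological_space, real ^ 5) atlas \<Rightarrow>
    ('a \<Rightarrow> 'a tvec \<Rightarrow> 'a tvec) \<Rightarrow> ('a \<Rightarrow> 'a tvec \<Rightarrow> 'a tvec) \<Rightarrow> ('a \<Rightarrow> 'a tvec \<Rightarrow> 'a tvec) \<Rightarrow>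
    ('a \<Rightarrow> 'a tvec) \<Rightarrow> ('a \<Rightarrow> 'a tvec \<Rightarrow> real) \<Rightarrow> ('a \<Rightarrow> 'a tvec \<Rightarrow> 'a tvec \<Rightarrow> real) \<Rightarrow> bool" where
  "SU2_structure A \<phi>1 \<phi>2 \<phi>3 \<xi> \<eta> g \<longleftrightarrow>
     almost_contact_metric A \<phi>1 \<xi> \<eta> g \<and>
     almost_contact_metric A \<phi>2 \<xi> \<eta> g \<and>
     almost_contact_metric A \<phi>3 \<xi> \<eta> g \<and>
     (\<forall>p. \<forall>v\<in>tangent_space A p.
        \<phi>1 p (\<phi>2 p v) = \<phi>3 p v \<and> \<phi>2 p (\<phi>1 p v) = - \<phi>3 p v \<and>
        \<phi>2 p (\<phi>3 p v) = \<phi>1 p v \<and> \<phi>3 p (\<phi>2 p v) = - \<phi>1 p v \<and>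
        \<phi>3 p (\<phi>1 p v) = \<phi>2 p v \<and> \<phi>1 p (\<phi>3 p v) = - \<phi>2 p v)"

definition sasaki_einstein ::
  "('a::topological_space, real ^ 5) atlas \<Rightarrow>
    ('a \<Rightarrow> 'a tvec \<Rightarrow> 'a tvec) \<Rightarrow> ('a \<Rightarrow> 'a tvec \<Rightarrow> 'a tvec) \<Rightarrow> ('a \<Rightarrow> 'a tvec \<Rightarrow> 'a tvec) \<Rightarrow>
    ('a \<Rightarrow> 'a tvec) \<Rightarrow> ('a \<Rightarrow> 'a tvec \<Rightarrow> real) \<Rightarrow> ('a \<Rightarrow> 'a tvec \<Rightarrow> 'a tvec \<Rightarrow> real) \<Rightarrow> bool" where
  "sasaki_einstein A \<phi>1 \<phi>2 \<phi>3 \<xi> \<eta> g \<longleftrightarrow>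
     SU2_structure A \<phi>1 \<phi>2 \<phi>3 \<xi> \<eta> g \<and>
     (\<forall>X Y p. vector_field A X \<longrightarrow> vector_field A Y \<longrightarrow>
        ext_deriv1 \<eta> X Y p = - 2 * fundamental_form \<phi>3 g p (X p) (Y p)) \<and>
     (\<forall>X Y Z p. vector_field A X \<longrightarrow> vector_field A Y \<longrightarrow> vector_field A Z \<longrightarrow>
        ext_deriv2 (fundamental_form \<phi>1 g) X Y Z p =
          3 * wedge12 \<eta> (fundamental_form \<phi>2 g) p (X p) (Y p) (Z p)) \<and>
     (\<forall>X Y Z p. vector_field A X \<longrightarrow> vector_field A Y \<longrightarrow> vector_field A Z \<longrightarrow>
        ext_deriv2 (fundamental_form \<phi>2 g) X Y Z p =
          - 3 * wedge12 \<eta> (fundamental_form \<phi>1 g) p (X p) (Y p) (Z p))"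

end

theory Submission
  imports Defs
begin

text \<open>Let \<open>h = \<nabla>\<xi> + \<phi>\<close> on a nearly Sasakian manifold. In dimension five \<open>\<nabla>\<phi>\<close> is determined by \<open>h\<close>
  and \<open>h\<^sup>2 = - \<lambda>\<^sup>2 (I - \<eta> \<otimes> \<xi>)\<close> at each point. The forms \<open>\<Phi>\<close>, \<open>F\<close>, \<open>\<Psi>\<close> of \<open>\<phi>\<close>, \<open>h\<close>, \<open>\<phi>h\<close> satisfy
  \<open>d\<eta> = 2 (F - \<Phi>)\<close> and \<open>d\<Phi> = dF = 3 \<eta> \<and> \<Psi>\<close>; since \<open>\<xi>\<close> is a Killing field, the Lie derivative
  along \<open>\<xi>\<close> of these equations gives \<open>d\<Psi> = - 3 \<eta> \<and> (\<lambda>\<^sup>2 \<Phi> + F)\<close> and that \<open>\<lambda>\<close> is constant. If \<open>\<lambda> = 0\<close>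
  the structure is Sasakian. Otherwise a rotation of \<open>\<phi>\<close> and \<open>h / \<lambda>\<close> by the angle of tangent \<open>\<lambda>\<close> and a homothety
  by \<open>1 + \<lambda>\<^sup>2\<close> yield a Sasaki-Einstein structure.

  Conversely, Hitchin's lemma shows that \<open>\<phi>\<^sub>1\<close> and \<open>\<phi>\<^sub>3\<close> of a Sasaki-Einstein structure are parallel
  in horizontal directions, hence \<open>\<phi>\<^sub>3\<close> is Sasakian and the symmetric part of \<open>\<nabla>\<phi>\<^sub>1\<close> vanishes. Undoing rotation
  and homothety by an angle \<open>t\<close> in \<open>(0, \<pi>/2)\<close> gives the family.\<close>

subsection \<open>Calculus of smooth functions\<close>

text \<open>The rotation and the homothety are forced by d\<eta>. As \<nabla>\<xi> = h - \<phi>, the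
  form d\<eta> is -2 times the form of \<phi> - h, and \<phi> - h squares to -(1 + \<lambda>^2) on
  horizontal vectors because h anticommutes with \<phi>. Divided by the square root of 1 +
  \<lambda>^2 it becomes an almost contact tensor, a rotation of \<phi> by the angle of tangent
  \<lambda>; rescaling \<eta> by that root makes d\<eta> equal to -2 times its form.

  The encoding shapes the rest. Tangent vectors are derivations of global functions, so frames,
  extensions and tensoriality are built from cut-off functions and Hadamard's lemma. A nearly
  Sasakian structure asserts that a Levi-Civita connection exists, whereas a Sasaki-Einstein
  structure is given by exterior derivatives; the converse therefore constructs the connection by
  Koszul's formula. Dimension five is used in one form: for nonzero horizontal u, v with v
  orthogonal to u and \<phi> u, the vectors \<xi>, u, \<phi> u, v, \<phi> v span the tangent
  space.\<close>

lemma times_differentiable_onI: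
  assumes "open S" "\<And>x. x \<in> S \<Longrightarrow> (f has_derivative f' x) (at x)"
    "\<And>v. times_differentiable_on k (\<lambda>x. f' x v) S"
  shows "times_differentiable_on (Suc k) f S"
proof -
  have eq: "f' x = frechet_derivative f (at x)" if "x \<in> S" for x
    using assms(2)[OF that] by (rule frechet_derivative_at)
  \<comment> \<open>The recursion speaks of \<open>frechet_derivative\<close>, the rule of a
    supplied derivative. Exchanging them needs congruence on S at every order, which holds because S
    is open.\<close>
  have cong: "times_differentiable_on k h S" if "times_differentiable_on k g S" "\<And>x. x \<in> S \<Longrightarrow> g x = h x"
    for k and g h :: "'a \<Rightarrow> 'b"
    using that
  proof (induction k arbitrary: g h)
    case 0
    then show ?case
      using continuous_on_cong[of S S g h] by simp
  next
    case (Suc k)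
    have *: "(h has_derivative frechet_derivative g (at x)) (at x)" if "x \<in> S" for x
      using Suc.prems that assms(1)
      by (intro has_derivative_transform_within_open[of g _ x UNIV S h]) (auto simp: frechet_derivative_works)
    then have **: "frechet_derivative g (at x) = frechet_derivative h (at x)" if "x \<in> S" for x
      using that frechet_derivative_at by blast
    show ?case
      unfolding times_differentiable_on.simps
    proof (intro conjI ballI allI)
      show "h differentiable (at x)" if "x \<in> S" for x
        using *[OF that] by (auto simp: differentiable_def)
      show "times_differentiable_on k (\<lambda>x. frechet_derivative h (at x) v) S" for v
        by (rule Suc.IH[of "\<lambda>x. frechet_derivative g (at x) v"]) (use Suc.prems(1) ** in auto)
    qed
  qed
  have "times_differentiable_on k (\<lambda>x. frechet_derivative f (at x) v) S" for v
    by (rule cong[OF assms(3)[of v]]) (simp add: eq)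
  then show ?thesis
    using assms(2) by (auto simp: differentiable_def)
qed

lemma times_differentiable_on_cong:
  assumes "open S" "times_differentiable_on k f S" "\<And>x. x \<in> S \<Longrightarrow> f x = g x"
  shows "times_differentiable_on k g S"
proof (cases k)
  case 0
  then show ?thesis using assms continuous_on_cong[of S S f g] by simp
next
  case (Suc l)
  show ?thesis unfolding Suc
  proof (rule times_differentiable_onI[OF assms(1)])
    show "(g has_derivative frechet_derivative f (at x)) (at x)" if "x \<in> S" for x
      using assms that Suc
      by (intro has_derivative_transform_within_open[of f _ x UNIV S g]) (auto simp: frechet_derivative_works)
    show "times_differentiable_on l (\<lambda>x. frechet_derivative f (at x) v) S" for v
      using assms Suc by simp
  qed
qed

lemma times_differentiable_on_SucD:
  "times_differentiable_on (Suc k) f S \<Longrightarrow> times_differentiable_on k f S"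
proof (induction k arbitrary: f)
  case 0
  then show ?case
    by (auto intro!: continuous_at_imp_continuous_on differentiable_imp_continuous_within)
next
  case (Suc k)
  show ?case
    unfolding times_differentiable_on.simps(2)[of k f]
    using Suc.prems Suc.IH unfolding times_differentiable_on.simps(2)[of "Suc k" f] by blast
qed

lemma times_differentiable_on_local:
  assumes "\<And>x. x \<in> S \<Longrightarrow> \<exists>N. open N \<and> x \<in> N \<and> times_differentiable_on k f N"
  shows "times_differentiable_on k f S"
  using assms
proof (induction k arbitrary: f)
  case 0
  then show ?case
    by (auto intro!: continuous_at_imp_continuous_on) (metis continuous_on_eq_continuous_at)
next
  case (Suc k)
  show ?case
    unfolding times_differentiable_on.simps
  proof (intro conjI ballI allI)
    show "f differentiable (at x)" if "x \<in> S" for x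
      using Suc.prems[OF that] by auto
    show "times_differentiable_on k (\<lambda>x. frechet_derivative f (at x) v) S" for v
      by (rule Suc.IH) (use Suc.prems in fastforce)
  qed
qed

lemma times_differentiable_on_subset:
  "times_differentiable_on k f S \<Longrightarrow> T \<subseteq> S \<Longrightarrow> times_differentiable_on k f T"
  by (induction k arbitrary: f) (auto intro: continuous_on_subset)

lemma times_differentiable_on_const: "open S \<Longrightarrow> times_differentiable_on k (\<lambda>x. c) S"
proof (induction k arbitrary: c)
  case (Suc k)
  then show ?case
    by (intro times_differentiable_onI[where f' = "\<lambda>x v. 0"]) auto
qed auto

lemma times_differentiable_on_linear:
  assumes "bounded_linear L" "open S"
  shows "times_differentiable_on k L S"
proof (cases k)
  case 0
  then show ?thesis using assms by (simp add: linear_continuous_on)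
next
  case (Suc l)
  then show ?thesis
    using times_differentiable_onI[where f' = "\<lambda>x. L" and f = L and k = l and S = S] assms
    by (auto intro: times_differentiable_on_const bounded_linear_imp_has_derivative)
qed

lemma times_differentiable_on_add:
  "open S \<Longrightarrow> times_differentiable_on k f S \<Longrightarrow> times_differentiable_on k g S \<Longrightarrow>
    times_differentiable_on k (\<lambda>x. f x + g x) S"
proof (induction k arbitrary: f g)
  case (Suc k)
  then show ?case
    by (intro times_differentiable_onI[where
          f' = "\<lambda>x v. frechet_derivative f (at x) v + frechet_derivative g (at x) v"])
      (auto simp: frechet_derivative_works intro!: has_derivative_add)
qed (auto intro: continuous_on_add)

lemma times_differentiable_on_sum:
  "finite B \<Longrightarrow> open S \<Longrightarrow> (\<And>b. b \<in> B \<Longrightarrow> times_differentiable_on k (f b) S) \<Longrightarrow>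
    times_differentiable_on k (\<lambda>x. \<Sum>b\<in>B. f b x) S"
  by (induction B rule: finite_induct)
    (auto intro: times_differentiable_on_const times_differentiable_on_add)

lemma times_differentiable_on_mult:
  fixes f g :: "'e::real_normed_vector \<Rightarrow> real"
  shows "open S \<Longrightarrow> times_differentiable_on k f S \<Longrightarrow> times_differentiable_on k g S \<Longrightarrow>
    times_differentiable_on k (\<lambda>x. f x * g x) S"
proof (induction k arbitrary: f g)
  case (Suc k)
  show ?case
  proof (rule times_differentiable_onI[where
          f' = "\<lambda>x v. f x * frechet_derivative g (at x) v + frechet_derivative f (at x) v * g x"])
    show "((\<lambda>x. f x * g x) has_derivative
            (\<lambda>v. f x * frechet_derivative g (at x) v + frechet_derivative f (at x) v * g x)) (at x)"
      if "x \<in> S" for x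
      using Suc.prems that by (intro has_derivative_mult) (auto simp: frechet_derivative_works)
    show "times_differentiable_on k
        (\<lambda>x. f x * frechet_derivative g (at x) v + frechet_derivative f (at x) v * g x) S" for v
      using Suc.prems times_differentiable_on_SucD[OF Suc.prems(2)] times_differentiable_on_SucD[OF Suc.prems(3)]
      by (intro times_differentiable_on_add Suc.IH) auto
  qed (use Suc.prems in auto)
qed (auto intro: continuous_on_mult)

lemma times_differentiable_on_linear_compose:
  assumes "bounded_linear L"
  shows "open S \<Longrightarrow> times_differentiable_on k f S \<Longrightarrow> times_differentiable_on k (\<lambda>x. L (f x)) S"
proof (induction k arbitrary: f)
  case 0
  then show ?case
    using assms by (auto intro: bounded_linear.continuous_on)
next
  case (Suc k)
  then show ?case
    by (intro times_differentiable_onI[where f' = "\<lambda>x v. L (frechet_derivative f (at x) v)"])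
      (auto simp: frechet_derivative_works intro!: bounded_linear.has_derivative[OF assms])
qed

text \<open>Higher differentiability only sees derivatives in a fixed direction, while the chain
  rule differentiates F in the direction \<open>frechet_derivative G (at x) v\<close>, which moves
  with x. Expanding this direction in the basis leaves finitely many fixed directions with scalar
  coefficients, and the induction hypothesis applies to each partial derivative of F.\<close>

lemma times_differentiable_on_compose:
  fixes F :: "'b::euclidean_space \<Rightarrow> real"
  shows "open S \<Longrightarrow> open T \<Longrightarrow> G ` S \<subseteq> T \<Longrightarrow> times_differentiable_on k G S \<Longrightarrow> times_differentiable_on k F T \<Longrightarrow>
    times_differentiable_on k (\<lambda>x. F (G x)) S"
proof (induction k arbitrary: F)
  case 0
  then show ?case by (auto intro: continuous_on_compose2)
next
  case (Suc k)
  have dF: "(F has_derivative frechet_derivative F (at y)) (at y)" if "y \<in> T" for y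
    using Suc.prems that by (auto simp: frechet_derivative_works)
  show ?case
  proof (rule times_differentiable_onI[where
          f' = "\<lambda>x v. \<Sum>b\<in>Basis. (frechet_derivative G (at x) v \<bullet> b) * frechet_derivative F (at (G x)) b"])
    fix x assume x: "x \<in> S"
    then have Gx: "G x \<in> T" using Suc.prems by auto
    have "((\<lambda>x. F (G x)) has_derivative (\<lambda>v. frechet_derivative F (at (G x)) (frechet_derivative G (at x) v))) (at x)"
      by (rule has_derivative_compose[where f = G and g = F, OF _ dF[OF Gx]])
        (use Suc.prems x in \<open>auto simp: frechet_derivative_works\<close>)
    moreover have rep: "frechet_derivative F (at (G x)) w =
        (\<Sum>b\<in>Basis. (w \<bullet> b) * frechet_derivative F (at (G x)) b)" for w
    proof -
      have lin: "linear (frechet_derivative F (at (G x)))"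
        using dF[OF Gx] by (rule has_derivative_linear)
      have "frechet_derivative F (at (G x)) w = frechet_derivative F (at (G x)) (\<Sum>b\<in>Basis. (w \<bullet> b) *\<^sub>R b)"
        by (simp add: euclidean_representation)
      also have "\<dots> = (\<Sum>b\<in>Basis. (w \<bullet> b) * frechet_derivative F (at (G x)) b)"
        by (simp add: linear_sum[OF lin] linear_scale[OF lin])
      finally show ?thesis .
    qed
    ultimately show "((\<lambda>x. F (G x)) has_derivative
        (\<lambda>v. \<Sum>b\<in>Basis. (frechet_derivative G (at x) v \<bullet> b) * frechet_derivative F (at (G x)) b)) (at x)"
      by (intro has_derivative_eq_rhs[OF _ ext[OF rep]])
  next
    fix v
    have "times_differentiable_on k (\<lambda>x. frechet_derivative F (at (G x)) b) S" for b
      by (rule Suc.IH[OF Suc.prems(1-3) times_differentiable_on_SucD[OF Suc.prems(4)]])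
        (use Suc.prems(5) in simp)
    moreover have "times_differentiable_on k (\<lambda>x. frechet_derivative G (at x) v \<bullet> b) S" for b
      by (rule times_differentiable_on_linear_compose[OF bounded_linear_inner_left Suc.prems(1)])
        (use Suc.prems(4) in simp)
    ultimately show "times_differentiable_on k
        (\<lambda>x. \<Sum>b\<in>Basis. (frechet_derivative G (at x) v \<bullet> b) * frechet_derivative F (at (G x)) b) S"
      by (intro times_differentiable_on_sum times_differentiable_on_mult finite_Basis Suc.prems(1))
  qed (rule Suc.prems(1))
qed

lemma smooth_on_cong: "open S \<Longrightarrow> smooth_on f S \<Longrightarrow> (\<And>x. x \<in> S \<Longrightarrow> f x = g x) \<Longrightarrow> smooth_on g S"
  unfolding smooth_on_def using times_differentiable_on_cong by blast

lemma smooth_on_subset: "smooth_on f S \<Longrightarrow> T \<subseteq> S \<Longrightarrow> smooth_on f T"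
  unfolding smooth_on_def using times_differentiable_on_subset by blast

lemma smooth_on_local:
  assumes "\<And>x. x \<in> S \<Longrightarrow> \<exists>N. open N \<and> x \<in> N \<and> smooth_on f N"
  shows "smooth_on f S"
  unfolding smooth_on_def
proof
  show "times_differentiable_on k f S" for k
    by (rule times_differentiable_on_local) (use assms in \<open>auto simp: smooth_on_def\<close>)
qed

lemma smooth_on_const: "open S \<Longrightarrow> smooth_on (\<lambda>x. c) S"
  by (simp add: smooth_on_def times_differentiable_on_const)

lemma smooth_on_linear: "bounded_linear L \<Longrightarrow> open S \<Longrightarrow> smooth_on L S"
  by (simp add: smooth_on_def times_differentiable_on_linear)

lemma smooth_on_add: "open S \<Longrightarrow> smooth_on f S \<Longrightarrow> smooth_on g S \<Longrightarrow> smooth_on (\<lambda>x. f x + g x) S"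
  by (simp add: smooth_on_def times_differentiable_on_add)

lemma smooth_on_sum:
  "finite B \<Longrightarrow> open S \<Longrightarrow> (\<And>b. b \<in> B \<Longrightarrow> smooth_on (f b) S) \<Longrightarrow> smooth_on (\<lambda>x. \<Sum>b\<in>B. f b x) S"
  by (simp add: smooth_on_def times_differentiable_on_sum)

lemma smooth_on_mult:
  fixes f g :: "'e::real_normed_vector \<Rightarrow> real"
  shows "open S \<Longrightarrow> smooth_on f S \<Longrightarrow> smooth_on g S \<Longrightarrow> smooth_on (\<lambda>x. f x * g x) S"
  by (simp add: smooth_on_def times_differentiable_on_mult)

lemma smooth_on_compose:
  fixes F :: "'b::euclidean_space \<Rightarrow> real"
  shows "open S \<Longrightarrow> open T \<Longrightarrow> G ` S \<subseteq> T \<Longrightarrow> smooth_on G S \<Longrightarrow> smooth_on F T \<Longrightarrow>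
    smooth_on (\<lambda>x. F (G x)) S"
  by (simp add: smooth_on_def times_differentiable_on_compose)

lemma smooth_on_frechet:
  "smooth_on f S \<Longrightarrow> smooth_on (\<lambda>x. frechet_derivative f (at x) v) S"
  unfolding smooth_on_def using times_differentiable_on.simps(2) by blast

lemma smooth_on_imp_has_derivative:
  "smooth_on f S \<Longrightarrow> x \<in> S \<Longrightarrow> (f has_derivative frechet_derivative f (at x)) (at x)"
  unfolding smooth_on_def using times_differentiable_on.simps(2) frechet_derivative_works by blast

lemma smooth_on_imp_continuous_on: "smooth_on f S \<Longrightarrow> continuous_on S f"
  unfolding smooth_on_def using times_differentiable_on.simps(1) by blast

text \<open>Induction on the order for all members at once: if derivatives are built from members,
  the whole family gains one order together. It serves inverse powers, shifted sines and the
  functions x^-n e^(-1/x), whose derivatives leave the single function but not the family.\<close>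

lemma smooth_on_family:
  fixes f :: "'i \<Rightarrow> 'e::real_normed_vector \<Rightarrow> 'b::real_normed_vector"
  assumes "open S"
    "\<And>i x. x \<in> S \<Longrightarrow> (f i has_derivative f' i x) (at x)"
    "\<And>i v k. (\<And>j. times_differentiable_on k (f j) S) \<Longrightarrow> times_differentiable_on k (\<lambda>x. f' i x v) S"
  shows "smooth_on (f i) S"
proof -
  have "times_differentiable_on k (f j) S" for k j
  proof (induction k arbitrary: j)
    case 0
    show ?case
      using assms(1,2) by (auto intro!: continuous_at_imp_continuous_on has_derivative_continuous)
  next
    case (Suc k)
    then show ?case
      by (intro times_differentiable_onI[where f' = "f' j"]) (use assms in auto)
  qed
  then show ?thesis by (simp add: smooth_on_def)
qed

lemma smooth_on_inverse: "smooth_on (\<lambda>x::real. inverse x) {x. x \<noteq> 0}"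
proof -
  have op: "open {x::real. x \<noteq> 0}"
    using open_Compl[of "{0::real}"] by (simp add: Compl_eq)
  have "smooth_on (\<lambda>x::real. inverse x ^ Suc n) {x. x \<noteq> 0}" for n
  proof (rule smooth_on_family[where f = "\<lambda>n x. inverse x ^ Suc n" and
        f' = "\<lambda>n x v. (- real (Suc n) * v) * inverse x ^ Suc (Suc n)"])
    show "((\<lambda>x. inverse x ^ Suc i) has_derivative (\<lambda>v. (- real (Suc i) * v) * inverse x ^ Suc (Suc i))) (at x)"
      if "x \<in> {x. x \<noteq> 0}" for i and x :: real
    proof -
      have "((\<lambda>x. inverse x ^ Suc i) has_real_derivative (- real (Suc i) * inverse x ^ Suc (Suc i))) (at x)"
        by (rule derivative_eq_intros refl | use that in \<open>simp add: power2_eq_square field_simps\<close>)+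
      then show ?thesis
        unfolding has_field_derivative_def by (rule has_derivative_eq_rhs) (simp add: fun_eq_iff)
    qed
  qed (use op in \<open>auto intro!: times_differentiable_on_mult times_differentiable_on_const
        simp del: power_Suc\<close>)
  from this[of 0] show ?thesis by simp
qed

lemma smooth_on_divide:
  fixes f g :: "'e::real_normed_vector \<Rightarrow> real"
  assumes "open S" "smooth_on f S" "smooth_on g S" "\<And>x. x \<in> S \<Longrightarrow> g x \<noteq> 0"
  shows "smooth_on (\<lambda>x. f x / g x) S"
proof -
  have "open {x::real. x \<noteq> 0}"
    using open_Compl[of "{0::real}"] by (simp add: Compl_eq)
  then have "smooth_on (\<lambda>x. inverse (g x)) S"
    by (rule smooth_on_compose[OF assms(1) _ _ assms(3) smooth_on_inverse]) (use assms(4) in auto)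
  then show ?thesis
    unfolding divide_inverse by (rule smooth_on_mult[OF assms(1,2)])
qed

lemma smooth_on_cos: "smooth_on (cos :: real \<Rightarrow> real) UNIV"
  and smooth_on_sin: "smooth_on (sin :: real \<Rightarrow> real) UNIV"
proof -
  have *: "smooth_on (\<lambda>x. sin (x + c) :: real) UNIV" for c
  \<comment> \<open>Differentiating a sine shifts its phase by \<pi>/2, so the shifted sines are
    closed under differentiation and contain the cosine.\<close>
  proof (rule smooth_on_family[where f = "\<lambda>c x. sin (x + c)" and f' = "\<lambda>c x v. v * sin (x + (c + pi / 2))"])
    show "((\<lambda>x. sin (x + c)) has_derivative (\<lambda>v. v * sin (x + (c + pi / 2)))) (at x)" for c x :: real
    proof -
      have "sin (x + (c + pi / 2)) = cos (x + c)"
        by (simp add: cos_sin_eq sin_add add.assoc[symmetric])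
      then show ?thesis
        by (auto intro!: derivative_eq_intros)
    qed
  qed (auto intro!: times_differentiable_on_mult times_differentiable_on_const)
  show "smooth_on (sin :: real \<Rightarrow> real) UNIV" using *[of 0] by simp
  have "sin (x + pi / 2) = cos x" for x :: real
    by (simp add: sin_add)
  then show "smooth_on (cos :: real \<Rightarrow> real) UNIV"
    using *[of "pi / 2"] by simp
qed

section \<open>A flat function and bump functions on Euclidean space\<close>

definition flat_step :: "real \<Rightarrow> real" where
  "flat_step x = (if 0 < x then exp (- inverse x) else 0)"

text \<open>The functions \<open>x\<^sup>-\<^sup>n e\<^sup>-\<^sup>1\<^sup>/\<^sup>x\<close>, extended by 0, are closed under differentiation up to linear
  combinations.\<close>

lemma smooth_on_flat_step: "smooth_on flat_step UNIV"
proof -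
  define b where "b n x = (if 0 < x then inverse x ^ n * exp (- inverse x) else 0)" for n :: nat and x :: real
  have pos: "(b n has_real_derivative b (n + 2) x - real n * b (n + 1) x) (at x)" if "0 < x" for n x
  proof -
    have "((\<lambda>x. inverse x ^ n * exp (- inverse x)) has_real_derivative b (n + 2) x - real n * b (n + 1) x) (at x)"
      by (rule derivative_eq_intros refl | use that in \<open>cases n; simp add: b_def power2_eq_square field_simps\<close>)+
    then show ?thesis
      by (rule has_field_derivative_transform_within_open[of _ _ _ "{0<..}"]) (use that in \<open>auto simp: b_def\<close>)
  qed
  have neg: "(b n has_real_derivative 0) (at x)" if "x < 0" for n x
    by (rule has_field_derivative_transform_within_open[of "\<lambda>x. 0" _ _ "{..<0}"])
      (use that in \<open>auto simp: b_def\<close>)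
  \<comment> \<open>The difference quotient at 0 from the right is x^-(n+1) e^(-1/x); with y = 1/x
    this is the limit of y^(n+1) e^-y at infinity.\<close>
  have zero: "(b n has_real_derivative 0) (at 0)" for n
  proof -
    have "((\<lambda>y. y ^ (n + 1) * exp (- y)) \<longlongrightarrow> 0) (at_top :: real filter)"
      using tendsto_power_div_exp_0[of "n + 1"] by (simp add: exp_minus field_simps)
    from filterlim_compose[OF this filterlim_inverse_at_top_right]
    have "((\<lambda>x. inverse x ^ (n + 1) * exp (- inverse x)) \<longlongrightarrow> 0) (at_right (0::real))" .
    then have "((\<lambda>x. b n x / x) \<longlongrightarrow> 0) (at_right 0)"
      by (rule Lim_transform_eventually)
        (auto simp: b_def field_simps eventually_at_right_less intro!: eventually_mono[OF eventually_at_right_less])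
    moreover have "((\<lambda>x. b n x / x) \<longlongrightarrow> 0) (at_left 0)"
      by (rule Lim_transform_eventually[OF tendsto_const])
        (auto simp: b_def eventually_at_filter)
    ultimately have "((\<lambda>x. b n x / x) \<longlongrightarrow> 0) (at 0)"
      by (simp add: filterlim_split_at)
    then show ?thesis
      by (simp add: DERIV_def b_def)
  qed
  have der: "(b n has_real_derivative b (n + 2) x - real n * b (n + 1) x) (at x)" for n x
    using pos[of x n] neg[of x n] zero[of n] by (cases x "0::real" rule: linorder_cases) (auto simp: b_def)
  have "smooth_on (b 0) UNIV"
  proof (rule smooth_on_family[where f = b and f' = "\<lambda>n x v. v * (b (n + 2) x + (- real n) * b (n + 1) x)"])
    show "(b n has_derivative (\<lambda>v. v * (b (n + 2) x + (- real n) * b (n + 1) x))) (at x)" for n x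
      using der[of n x] unfolding has_field_derivative_def
      by (rule has_derivative_eq_rhs) (simp add: fun_eq_iff)
    show "times_differentiable_on k (\<lambda>x. v * (b (n + 2) x + (- real n) * b (n + 1) x)) UNIV"
      if "\<And>j. times_differentiable_on k (b j) UNIV" for n v k
      by (intro times_differentiable_on_mult times_differentiable_on_add times_differentiable_on_const open_UNIV that)
  qed (rule open_UNIV)
  moreover have "b 0 = flat_step"
    by (simp add: fun_eq_iff b_def flat_step_def)
  ultimately show ?thesis by simp
qed

lemma smooth_on_norm_sq: "smooth_on (\<lambda>x::'e::euclidean_space. (x - a) \<bullet> (x - a)) UNIV"
proof -
  have "smooth_on (\<lambda>x. \<Sum>b\<in>Basis. (x \<bullet> b + - (a \<bullet> b)) * (x \<bullet> b + - (a \<bullet> b))) UNIV"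
    by (intro smooth_on_sum smooth_on_mult smooth_on_add smooth_on_const smooth_on_linear bounded_linear_inner_left)
      auto
  moreover have "(x - a) \<bullet> (x - a) = (\<Sum>b\<in>Basis. (x \<bullet> b + - (a \<bullet> b)) * (x \<bullet> b + - (a \<bullet> b)))" for x
    by (subst euclidean_inner) (simp add: inner_diff_left)
  ultimately show ?thesis by simp
qed

text \<open>The quotient u / (u + w) of two flat functions, u positive exactly at distance below r
  from a, w exactly at distance above r / 2. The two regions cover the space, so the denominator
  never vanishes.\<close>

lemma smooth_bump_exists:
  fixes a :: "'e::euclidean_space"
  assumes "0 < r"
  obtains \<rho> where "smooth_on \<rho> UNIV" "\<And>x. x \<in> ball a (r / 2) \<Longrightarrow> \<rho> x = (1::real)" "\<And>x. x \<notin> ball a r \<Longrightarrow> \<rho> x = 0"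
proof
  define s where "s x = (x - a) \<bullet> (x - a)" for x
  have s: "s x = (dist a x)\<^sup>2" for x
    by (metis dist_commute dist_norm power2_norm_eq_inner s_def)
  have r4: "(r / 2)\<^sup>2 = r\<^sup>2 / 4" by (simp add: power_divide)
  let ?u = "\<lambda>x. flat_step (r\<^sup>2 + - 1 * s x)"
  let ?w = "\<lambda>x. flat_step (s x + - (r\<^sup>2 / 4))"
  have nonneg: "0 \<le> flat_step x" and zero: "flat_step x = 0 \<longleftrightarrow> x \<le> 0" for x
    by (auto simp: flat_step_def)
  have sm: "smooth_on s UNIV"
    using smooth_on_norm_sq[of a] by (simp add: s_def[abs_def])
  have u: "smooth_on ?u UNIV"
    by (rule smooth_on_compose[OF open_UNIV open_UNIV _ _ smooth_on_flat_step])
      (intro subset_UNIV smooth_on_add smooth_on_mult smooth_on_const open_UNIV sm)+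
  have w: "smooth_on ?w UNIV"
    by (rule smooth_on_compose[OF open_UNIV open_UNIV _ _ smooth_on_flat_step])
      (intro subset_UNIV smooth_on_add smooth_on_mult smooth_on_const open_UNIV sm)+
  have "?u x + ?w x \<noteq> 0" for x
  proof
    assume "?u x + ?w x = 0"
    then have "?u x = 0" "?w x = 0"
      using nonneg[of "r\<^sup>2 + - 1 * s x"] nonneg[of "s x + - (r\<^sup>2 / 4)"] by linarith+
    then have "r\<^sup>2 \<le> s x" "s x \<le> r\<^sup>2 / 4" by (simp_all add: zero)
    then show False using assms zero_less_power[of r 2] by linarith
  qed
  then show "smooth_on (\<lambda>x. ?u x / (?u x + ?w x)) UNIV"
    by (intro smooth_on_divide smooth_on_add u w open_UNIV)
  show "?u x / (?u x + ?w x) = 1" if "x \<in> ball a (r / 2)" for x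
  proof -
    have "s x \<le> r\<^sup>2 / 4"
      using that assms unfolding s r4[symmetric] by (intro power_mono) auto
    moreover from this have "s x < r\<^sup>2"
      using assms zero_less_power[of r 2] by linarith
    ultimately have "?w x = 0" "?u x \<noteq> 0" by (simp_all add: zero)
    then show ?thesis by simp
  qed
  show "?u x / (?u x + ?w x) = 0" if "x \<notin> ball a r" for x
  proof -
    have "r\<^sup>2 \<le> s x" using that assms unfolding s by (intro power_mono) auto
    then have "?u x = 0" by (simp add: zero)
    then show ?thesis by simp
  qed
qed

text \<open>Differentiation under the integral sign. The weight t^m is carried along because each
  derivative in x brings out one factor t; with it the integrals form a family closed under
  differentiation.\<close>

lemma hadamard_weight_derivative:
  fixes F :: "'e::euclidean_space \<Rightarrow> real"
  assumes sm: "smooth_on F (ball a r)" and x: "x \<in> ball a r"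
  shows "((\<lambda>x. integral (cbox 0 1) (\<lambda>t. t ^ m * F (a + t *\<^sub>R (x - a)))) has_derivative
    (\<lambda>v. integral (cbox 0 1) (\<lambda>t. t ^ Suc m * frechet_derivative F (at (a + t *\<^sub>R (x - a))) v))) (at x)"
proof -
  define p where "p x t = a + t *\<^sub>R (x - a)" for x and t :: real
  have p: "p x t \<in> ball a r" if "x \<in> ball a r" "t \<in> cbox 0 1" for x t
  proof -
    have "dist a (p x t) = t * dist a x"
      using that(2) by (simp add: p_def dist_norm norm_minus_commute)
    also have "\<dots> \<le> 1 * dist a x"
      using that(2) by (intro mult_right_mono) auto
    finally show ?thesis using that(1) by simp
  qed
  have cont_p: "continuous_on (ball a r \<times> cbox 0 1) (\<lambda>(x, t). p x t)"
    unfolding p_def split_beta by (intro continuous_intros)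
  have cont: "continuous_on (ball a r \<times> cbox 0 1) (\<lambda>(x, t). G (p x t))"
    if "smooth_on G (ball a r)" for G :: "'e \<Rightarrow> real"
  proof -
    have "(\<lambda>(x, t). p x t) ` (ball a r \<times> cbox 0 1) \<subseteq> ball a r"
      using p by fast
    from continuous_on_compose2[OF smooth_on_imp_continuous_on[OF that] cont_p this]
    show ?thesis by (simp add: split_beta)
  qed
  have cont1: "continuous_on (cbox 0 1) (\<lambda>t. G (p x t))"
    if "smooth_on G (ball a r)" "x \<in> ball a r" for x and G :: "'e \<Rightarrow> real"
  proof (rule continuous_on_compose2[OF smooth_on_imp_continuous_on[OF that(1)]])
    show "continuous_on (cbox 0 1) (p x)"
      unfolding p_def by (intro continuous_intros)
    show "p x ` cbox 0 1 \<subseteq> ball a r"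
      using p[OF that(2)] by fast
  qed
  \<comment> \<open>The derivative as a bounded linear map, in the form that
    \<open>leibniz_rule\<close> expects; the expansion over the basis makes its joint continuity
    evident.\<close>
  define D where "D x t = (\<Sum>b\<in>Basis. (t ^ Suc m * frechet_derivative F (at (p x t)) b) *\<^sub>R blinfun_inner_left b)"
    for x t
  have D: "blinfun_apply (D x t) v = t ^ Suc m * frechet_derivative F (at (p x t)) v"
    if "x \<in> ball a r" "t \<in> cbox 0 1" for x t v
  proof -
    have lin: "linear (frechet_derivative F (at (p x t)))"
      using smooth_on_imp_has_derivative[OF sm p[OF that]] by (rule has_derivative_linear)
    have "frechet_derivative F (at (p x t)) v = frechet_derivative F (at (p x t)) (\<Sum>b\<in>Basis. (v \<bullet> b) *\<^sub>R b)"
      by (simp add: euclidean_representation)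
    also have "\<dots> = (\<Sum>b\<in>Basis. (v \<bullet> b) * frechet_derivative F (at (p x t)) b)"
      by (simp add: linear_sum[OF lin] linear_scale[OF lin])
    finally show ?thesis
      by (simp add: D_def blinfun.sum_left blinfun.scaleR_left sum_distrib_left mult_ac)
  qed
  have "((\<lambda>x. integral (cbox 0 1) (\<lambda>t. t ^ m * F (p x t))) has_derivative integral (cbox 0 1) (D x)) (at x within ball a r)"
  proof (rule leibniz_rule[OF _ _ _ x convex_ball])
    fix x t assume xt: "x \<in> ball a r" "t \<in> cbox (0::real) 1"
    have "((\<lambda>x. p x t) has_derivative (\<lambda>v. t *\<^sub>R v)) (at x)"
      unfolding p_def by (auto intro!: derivative_eq_intros)
    then have "((\<lambda>x. F (p x t)) has_derivative (\<lambda>v. frechet_derivative F (at (p x t)) (t *\<^sub>R v))) (at x)"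
      by (rule has_derivative_compose[where g = F and f = "\<lambda>x. p x t", OF _ smooth_on_imp_has_derivative[OF sm p[OF xt]]])
    then have "((\<lambda>x. t ^ m * F (p x t)) has_derivative
        (\<lambda>v. t ^ m * frechet_derivative F (at (p x t)) (t *\<^sub>R v))) (at x)"
      by (rule has_derivative_mult_right)
    moreover have "t ^ m * frechet_derivative F (at (p x t)) (t *\<^sub>R v) = blinfun_apply (D x t) v" for v
      using linear_scale[OF has_derivative_linear[OF smooth_on_imp_has_derivative[OF sm p[OF xt]]], of t v]
      by (simp add: D[OF xt])
    ultimately have "((\<lambda>x. t ^ m * F (p x t)) has_derivative blinfun_apply (D x t)) (at x)"
      by (rule has_derivative_eq_rhs[OF _ ext])
    then show "((\<lambda>x. t ^ m * F (p x t)) has_derivative blinfun_apply (D x t)) (at x within ball a r)"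
      by (rule has_derivative_at_withinI)
  next
    fix x assume x: "x \<in> ball a r"
    show "(\<lambda>t. t ^ m * F (p x t)) integrable_on cbox 0 1"
      by (intro integrable_continuous continuous_intros cont1[OF sm x])
  next
    have c: "continuous_on (ball a r \<times> cbox 0 1) (\<lambda>z. frechet_derivative F (at (p (fst z) (snd z))) b)" for b
      using cont[OF smooth_on_frechet[OF sm, of b]] by (simp add: split_beta)
    show "continuous_on (ball a r \<times> cbox 0 1) (\<lambda>(x, t). D x t)"
      unfolding D_def split_beta by (intro continuous_intros c)
  qed
  then have "((\<lambda>x. integral (cbox 0 1) (\<lambda>t. t ^ m * F (p x t))) has_derivative integral (cbox 0 1) (D x)) (at x)"
    using x by (simp add: at_within_open[OF x open_ball])
  moreover have "blinfun_apply (integral (cbox 0 1) (D x)) v =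
      integral (cbox 0 1) (\<lambda>t. t ^ Suc m * frechet_derivative F (at (p x t)) v)" for v
  proof -
    have "D x integrable_on cbox 0 1"
      unfolding D_def by (intro integrable_continuous continuous_intros cont1[OF smooth_on_frechet[OF sm] x])
    then have "integral (cbox 0 1) (D x) v = integral (cbox 0 1) (\<lambda>t. D x t v)"
      by (rule blinfun_apply_integral)
    also have "\<dots> = integral (cbox 0 1) (\<lambda>t. t ^ Suc m * frechet_derivative F (at (p x t)) v)"
      by (rule integral_cong) (rule D[OF x])
    finally show ?thesis .
  qed
  ultimately show ?thesis
    unfolding p_def by (rule has_derivative_eq_rhs[OF _ ext])
qed

text \<open>Integrate the derivative of F along the segment from a to x: by the fundamental theorem
  the coefficients are the integrals of the partial derivatives over the segment. They are smooth
  because their derivatives are again weighted integrals of this kind.\<close>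

lemma hadamard:
  fixes F :: "'e::euclidean_space \<Rightarrow> real"
  assumes sm: "smooth_on F (ball a r)"
  obtains G where "\<And>b. smooth_on (G b) (ball a r)"
    "\<And>x. x \<in> ball a r \<Longrightarrow> F x = F a + (\<Sum>b\<in>Basis. ((x - a) \<bullet> b) * G b x)"
proof
  let ?I = "\<lambda>m H x. integral (cbox 0 1) (\<lambda>t::real. t ^ m * H (a + t *\<^sub>R (x - a)))"
  have I: "times_differentiable_on k (?I m H) (ball a r)" if "smooth_on H (ball a r)" for k m and H :: "'e \<Rightarrow> real"
    using that
  proof (induction k arbitrary: m H)
    case 0
    then have "isCont (?I m H) x" if "x \<in> ball a r" for x
      using has_derivative_continuous[OF hadamard_weight_derivative] that by blast
    then show ?case
      by (simp only: times_differentiable_on.simps) (rule continuous_at_imp_continuous_on, blast)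
  next
    case (Suc k)
    show ?case
      by (rule times_differentiable_onI[OF open_ball hadamard_weight_derivative[OF Suc.prems]])
        (assumption, rule Suc.IH[OF smooth_on_frechet[OF Suc.prems]])
  qed
  show "smooth_on (\<lambda>x. ?I 0 (\<lambda>y. frechet_derivative F (at y) b) x) (ball a r)" for b
    unfolding smooth_on_def[of "\<lambda>x. ?I 0 (\<lambda>y. frechet_derivative F (at y) b) x"]
    by (intro allI I smooth_on_frechet[OF sm])
  show "F x = F a + (\<Sum>b\<in>Basis. ((x - a) \<bullet> b) * ?I 0 (\<lambda>y. frechet_derivative F (at y) b) x)"
    if x: "x \<in> ball a r" for x
  proof -
    define p where "p t = a + t *\<^sub>R (x - a)" for t :: real
    have p: "p t \<in> ball a r" if "t \<in> {0..1}" for t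
    proof -
      have "dist a (p t) = t * dist a x"
        using that by (simp add: p_def dist_norm norm_minus_commute)
      also have "\<dots> \<le> 1 * dist a x"
        using that by (intro mult_right_mono) auto
      finally show ?thesis using x by simp
    qed
    have "((\<lambda>t. \<Sum>b\<in>Basis. ((x - a) \<bullet> b) * frechet_derivative F (at (p t)) b) has_integral F (p 1) - F (p 0)) {0..1}"
    proof (rule fundamental_theorem_of_calculus)
      fix t :: real assume t: "t \<in> {0..1}"
      have dF: "(F has_derivative frechet_derivative F (at (p t))) (at (p t))"
        by (rule smooth_on_imp_has_derivative[OF sm p[OF t]])
      have lin: "linear (frechet_derivative F (at (p t)))"
        using dF by (rule has_derivative_linear)
      have "(p has_derivative (\<lambda>s. s *\<^sub>R (x - a))) (at t within {0..1})"
        unfolding p_def by (auto intro!: derivative_eq_intros)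
      then have "((\<lambda>t. F (p t)) has_derivative (\<lambda>s. frechet_derivative F (at (p t)) (s *\<^sub>R (x - a)))) (at t within {0..1})"
        by (rule has_derivative_compose[where g = F and f = p, OF _ dF])
      moreover have "frechet_derivative F (at (p t)) (s *\<^sub>R (x - a)) =
          s *\<^sub>R (\<Sum>b\<in>Basis. ((x - a) \<bullet> b) * frechet_derivative F (at (p t)) b)" for s
      proof -
        have "frechet_derivative F (at (p t)) (s *\<^sub>R (x - a)) =
            s *\<^sub>R frechet_derivative F (at (p t)) (\<Sum>b\<in>Basis. ((x - a) \<bullet> b) *\<^sub>R b)"
          by (simp add: euclidean_representation linear_scale[OF lin])
        also have "\<dots> = s *\<^sub>R (\<Sum>b\<in>Basis. ((x - a) \<bullet> b) * frechet_derivative F (at (p t)) b)"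
          by (simp add: linear_sum[OF lin] linear_scale[OF lin])
        finally show ?thesis .
      qed
      ultimately show "((\<lambda>t. F (p t)) has_vector_derivative
          (\<Sum>b\<in>Basis. ((x - a) \<bullet> b) * frechet_derivative F (at (p t)) b)) (at t within {0..1})"
        unfolding has_vector_derivative_def by (rule has_derivative_eq_rhs[OF _ ext])
    qed simp
    then have "F (p 1) - F (p 0) =
        integral {0..1} (\<lambda>t. \<Sum>b\<in>Basis. ((x - a) \<bullet> b) * frechet_derivative F (at (p t)) b)"
      by (simp add: integral_unique)
    also have "\<dots> = (\<Sum>b\<in>Basis. ((x - a) \<bullet> b) * integral {0..1} (\<lambda>t. frechet_derivative F (at (p t)) b))"
    proof (subst integral_sum)
      have "continuous_on {0..1} (\<lambda>t. frechet_derivative F (at (p t)) b)" for b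
        using p by (intro continuous_on_compose2[OF smooth_on_imp_continuous_on[OF smooth_on_frechet[OF sm, of b]]])
          (auto simp: p_def intro!: continuous_intros)
      then show "(\<lambda>t. ((x - a) \<bullet> b) * frechet_derivative F (at (p t)) b) integrable_on {0..1}" for b
        by (intro integrable_continuous_interval continuous_intros)
    qed auto
    finally show ?thesis
      by (simp add: p_def cbox_interval)
  qed
qed

subsection \<open>Smooth functions and tangent vectors\<close>

locale smooth_manifold =
  fixes A :: "('a::t2_space, 'e::euclidean_space) atlas"
  assumes smooth_atlas: "smooth_atlas A"
begin

lemma chart:
  assumes "(U, c) \<in> A"
  shows "open U" "open (c ` U)" "homeomorphism U (c ` U) c (inv_into U c)" "inj_on c U"
    and "\<And>x. x \<in> c ` U \<Longrightarrow> c (inv_into U c x) = x"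
    and "\<And>q. q \<in> U \<Longrightarrow> inv_into U c (c q) = q"
proof -
  show "open U" "open (c ` U)" and h: "homeomorphism U (c ` U) c (inv_into U c)"
    using smooth_atlas assms unfolding smooth_atlas_def by blast+
  show "\<And>q. q \<in> U \<Longrightarrow> inv_into U c (c q) = q"
    using h by (simp add: homeomorphism_def)
  then show "inj_on c U" by (metis inj_onI)
  show "\<And>x. x \<in> c ` U \<Longrightarrow> c (inv_into U c x) = x"
    by (simp add: f_inv_into_f)
qed

lemma chart_exists: obtains U c where "(U, c) \<in> A" "p \<in> U"
proof -
  have "p \<in> (\<Union>(U, c)\<in>A. U)" using smooth_atlas by (simp add: smooth_atlas_def)
  then show ?thesis using that by auto
qed

lemma open_chart_image: "(U, c) \<in> A \<Longrightarrow> open N \<Longrightarrow> open (c ` (U \<inter> N))"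
  using chart(1-3)[of U c] homeomorphism_imp_open_map[of U "c ` U" c "inv_into U c" "U \<inter> N"]
  by (metis inf.absorb_iff2 inf_le1 open_Int openin_open_eq openin_open_trans)

lemma open_chart_vimage: "(U, c) \<in> A \<Longrightarrow> open W \<Longrightarrow> open {q \<in> U. c q \<in> W}"
  using chart(1,3)[of U c] continuous_open_preimage[of U c W]
  by (simp add: homeomorphism_def vimage_def Int_def conj_commute)

lemma transition_smooth: "(U, c) \<in> A \<Longrightarrow> (V, d) \<in> A \<Longrightarrow> smooth_on (d \<circ> inv_into U c) (c ` (U \<inter> V))"
  using smooth_atlas unfolding smooth_atlas_def by blast

definition smooth_fun_on :: "'a set \<Rightarrow> ('a \<Rightarrow> real) \<Rightarrow> bool" where
  "smooth_fun_on N f \<longleftrightarrow> (\<forall>(U, c)\<in>A. smooth_on (f \<circ> inv_into U c) (c ` (U \<inter> N)))"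

lemma smooth_fun_on_UNIV: "smooth_fun_on UNIV f \<longleftrightarrow> smooth_fun A f"
  by (simp add: smooth_fun_on_def smooth_fun_def)

lemma smooth_fun_on_subset: "smooth_fun_on N f \<Longrightarrow> M \<subseteq> N \<Longrightarrow> smooth_fun_on M f"
  unfolding smooth_fun_on_def by (fast intro: smooth_on_subset)

lemma smooth_fun_imp_on: "smooth_fun A f \<Longrightarrow> smooth_fun_on N f"
  using smooth_fun_on_subset[of UNIV f N] by (simp add: smooth_fun_on_UNIV)

lemma smooth_fun_on_cong:
  assumes "open N" "smooth_fun_on N f" "\<And>q. q \<in> N \<Longrightarrow> f q = g q"
  shows "smooth_fun_on N g"
  unfolding smooth_fun_on_def
proof clarify
  fix U c assume c: "(U, c) \<in> A"
  show "smooth_on (g \<circ> inv_into U c) (c ` (U \<inter> N))"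
    by (rule smooth_on_cong[of _ "f \<circ> inv_into U c"])
      (use assms c chart(6)[OF c] open_chart_image[OF c assms(1)] in \<open>auto simp: smooth_fun_on_def\<close>)
qed

lemma smooth_funI:
  assumes "\<And>p. \<exists>N. open N \<and> p \<in> N \<and> smooth_fun_on N f"
  shows "smooth_fun A f"
  unfolding smooth_fun_def
proof clarify
  fix U c assume c: "(U, c) \<in> A"
  show "smooth_on (f \<circ> inv_into U c) (c ` U)"
  proof (rule smooth_on_local)
    fix x assume "x \<in> c ` U"
    then obtain q where q: "q \<in> U" "x = c q" by auto
    obtain N where N: "open N" "q \<in> N" "smooth_fun_on N f" using assms by blast
    show "\<exists>M. open M \<and> x \<in> M \<and> smooth_on (f \<circ> inv_into U c) M"
      by (rule exI[of _ "c ` (U \<inter> N)"])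
        (use q N c open_chart_image[OF c N(1)] in \<open>auto simp: smooth_fun_on_def\<close>)
  qed
qed

lemma smooth_fun_on_const: "open N \<Longrightarrow> smooth_fun_on N (\<lambda>q. k)"
  unfolding smooth_fun_on_def by (auto simp: o_def intro: smooth_on_const open_chart_image)

lemma smooth_fun_on_add:
  "open N \<Longrightarrow> smooth_fun_on N f \<Longrightarrow> smooth_fun_on N g \<Longrightarrow> smooth_fun_on N (\<lambda>q. f q + g q)"
  unfolding smooth_fun_on_def o_def by (fast intro: smooth_on_add open_chart_image)

lemma smooth_fun_on_mult:
  "open N \<Longrightarrow> smooth_fun_on N f \<Longrightarrow> smooth_fun_on N g \<Longrightarrow> smooth_fun_on N (\<lambda>q. f q * g q)"
  unfolding smooth_fun_on_def o_def by (fast intro: smooth_on_mult open_chart_image)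

lemma smooth_fun_on_divide:
  assumes "open N" "smooth_fun_on N f" "smooth_fun_on N g" "\<And>q. q \<in> N \<Longrightarrow> g q \<noteq> 0"
  shows "smooth_fun_on N (\<lambda>q. f q / g q)"
  unfolding smooth_fun_on_def o_def
proof clarify
  fix U c assume c: "(U, c) \<in> A"
  show "smooth_on (\<lambda>x. f (inv_into U c x) / g (inv_into U c x)) (c ` (U \<inter> N))"
    by (rule smooth_on_divide)
      (use assms c chart(6)[OF c] open_chart_image[OF c assms(1)] in \<open>auto simp: smooth_fun_on_def o_def\<close>)
qed

lemma smooth_fun_const [simp, intro]: "smooth_fun A (\<lambda>q. k)"
  using smooth_fun_on_const[OF open_UNIV] by (simp add: smooth_fun_on_UNIV)

lemma smooth_fun_add [intro]: "smooth_fun A f \<Longrightarrow> smooth_fun A g \<Longrightarrow> smooth_fun A (\<lambda>q. f q + g q)"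
  using smooth_fun_on_add[OF open_UNIV] by (simp add: smooth_fun_on_UNIV)

lemma smooth_fun_mult [intro]: "smooth_fun A f \<Longrightarrow> smooth_fun A g \<Longrightarrow> smooth_fun A (\<lambda>q. f q * g q)"
  using smooth_fun_on_mult[OF open_UNIV] by (simp add: smooth_fun_on_UNIV)

lemma smooth_fun_uminus [intro]: "smooth_fun A f \<Longrightarrow> smooth_fun A (\<lambda>q. - f q)"
  using smooth_fun_mult[of "\<lambda>q. - 1" f] by simp

lemma smooth_fun_diff [intro]: "smooth_fun A f \<Longrightarrow> smooth_fun A g \<Longrightarrow> smooth_fun A (\<lambda>q. f q - g q)"
  using smooth_fun_add[of f "\<lambda>q. - g q"] by auto

lemma smooth_fun_sum: "finite B \<Longrightarrow> (\<And>b. b \<in> B \<Longrightarrow> smooth_fun A (f b)) \<Longrightarrow> smooth_fun A (\<lambda>q. \<Sum>b\<in>B. f b q)"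
  by (induction B rule: finite_induct) auto

lemma smooth_fun_on_chart:
  assumes c: "(U, c) \<in> A" and W: "open W" "W \<subseteq> c ` U" "smooth_on u W"
  shows "smooth_fun_on {q \<in> U. c q \<in> W} (\<lambda>q. u (c q))"
  unfolding smooth_fun_on_def o_def
proof clarify
  fix V d assume d: "(V, d) \<in> A"
  let ?S = "d ` (V \<inter> {q \<in> U. c q \<in> W})"
  have "smooth_on (\<lambda>x. u ((c \<circ> inv_into V d) x)) ?S"
  proof (rule smooth_on_compose[OF _ W(1) _ _ W(3)])
    show "open ?S" by (intro open_chart_image[OF d] open_chart_vimage[OF c] W)
    show "smooth_on (c \<circ> inv_into V d) ?S"
      by (rule smooth_on_subset[OF transition_smooth[OF d c]]) auto
    show "(c \<circ> inv_into V d) ` ?S \<subseteq> W"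
      using chart(6)[OF d] by auto
  qed
  then show "smooth_on (\<lambda>x. u (c (inv_into V d x))) ?S" by (simp add: o_def)
qed

text \<open>A function given in a chart becomes global after multiplication by a bump and extension
  by 0. Off the compact set K over the closed ball the product vanishes, and K is closed because the
  space is Hausdorff. One \<kappa> serves all u, so coordinates and coordinate fields can be cut off
  by the same factor.\<close>

lemma chart_bump:
  assumes c: "(U, c) \<in> A" and p: "p \<in> U" and r: "0 < r" and W: "open W" "cball (c p) r \<subseteq> W" "W \<subseteq> c ` U"
  obtains \<kappa> where "\<And>q. c q \<in> ball (c p) (r / 2) \<Longrightarrow> \<kappa> q = (1::real)"
    "\<And>q. c q \<notin> ball (c p) r \<Longrightarrow> \<kappa> q = 0"
    "\<And>u. smooth_on u W \<Longrightarrow> smooth_fun A (\<lambda>q. if q \<in> U then \<kappa> q * u (c q) else 0)"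
proof -
  obtain \<rho> where \<rho>: "smooth_on \<rho> UNIV" "\<And>x. x \<in> ball (c p) (r / 2) \<Longrightarrow> \<rho> x = (1::real)"
    "\<And>x. x \<notin> ball (c p) r \<Longrightarrow> \<rho> x = 0"
    using smooth_bump_exists[OF r] by blast
  show ?thesis
  proof
    show "\<rho> (c q) = 1" if "c q \<in> ball (c p) (r / 2)" for q using \<rho> that by blast
    show "\<rho> (c q) = 0" if "c q \<notin> ball (c p) r" for q using \<rho> that by blast
    show "smooth_fun A (\<lambda>q. if q \<in> U then \<rho> (c q) * u (c q) else 0)" (is "smooth_fun A ?f") if u: "smooth_on u W" for u
    proof (rule smooth_funI)
      fix q
      define K where "K = inv_into U c ` cball (c p) r"
      have "continuous_on (cball (c p) r) (inv_into U c)"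
        using chart(3)[OF c] W(2,3) by (auto simp: homeomorphism_def intro: continuous_on_subset)
      then have "compact K"
        unfolding K_def by (rule compact_continuous_image) simp
      then have K: "open (- K)"
        by (simp add: compact_imp_closed open_Compl)
      show "\<exists>N. open N \<and> q \<in> N \<and> smooth_fun_on N ?f"
      proof (cases "q \<in> K")
        case True
        let ?N = "{q \<in> U. c q \<in> W}"
        have "q \<in> ?N"
        proof -
          obtain y where y: "y \<in> cball (c p) r" "q = inv_into U c y" using True unfolding K_def by blast
          then have "y \<in> W" "y \<in> c ` U" using W(2,3) by blast+
          then show ?thesis using y chart(5)[OF c] by (simp add: inv_into_into)
        qed
        moreover have "smooth_fun_on ?N (\<lambda>q. \<rho> (c q) * u (c q))"
          by (rule smooth_fun_on_chart[OF c W(1,3)])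
            (rule smooth_on_mult[OF W(1) smooth_on_subset[OF \<rho>(1) subset_UNIV] u])
        then have "smooth_fun_on ?N ?f"
          by (rule smooth_fun_on_cong[OF open_chart_vimage[OF c W(1)]]) simp
        ultimately show ?thesis using open_chart_vimage[OF c W(1)] by blast
      next
        case False
        have "?f q' = 0" if "q' \<notin> K" for q'
        proof (cases "q' \<in> U")
          case True
          then have "c q' \<notin> cball (c p) r"
            using that chart(6)[OF c] unfolding K_def by (metis image_eqI)
          then show ?thesis using \<rho>(3)[of "c q'"] by auto
        qed simp
        then have "smooth_fun_on (- K) ?f"
          by (intro smooth_fun_on_cong[OF K smooth_fun_on_const[OF K, of 0]]) auto
        then show ?thesis using False K by blast
      qed
    qed
  qed
qed

lemma chart_ball:
  assumes "(U, c) \<in> A" "p \<in> U" "open N" "p \<in> N"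
  obtains r where "0 < r" "cball (c p) r \<subseteq> c ` (U \<inter> N)"
  using open_contains_cball[of "c ` (U \<inter> N)"] open_chart_image[OF assms(1,3)] assms by blast

lemma bump:
  assumes "open N" "p \<in> N"
  obtains \<kappa> where "smooth_fun A \<kappa>" "\<kappa> p = 1" "\<And>q. q \<notin> N \<Longrightarrow> \<kappa> q = 0"
proof -
  obtain U c where c: "(U, c) \<in> A" "p \<in> U" using chart_exists .
  obtain r where r: "0 < r" "cball (c p) r \<subseteq> c ` (U \<inter> N)" using chart_ball[OF c assms] .
  obtain \<kappa> where \<kappa>: "\<And>q. c q \<in> ball (c p) (r / 2) \<Longrightarrow> \<kappa> q = (1::real)"
    "\<And>q. c q \<notin> ball (c p) r \<Longrightarrow> \<kappa> q = 0"
    "\<And>u. smooth_on u (c ` U) \<Longrightarrow> smooth_fun A (\<lambda>q. if q \<in> U then \<kappa> q * u (c q) else 0)"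
    by (rule chart_bump[OF c r(1) chart(2)[OF c(1)]]) (use r in auto)
  show ?thesis
  proof
    show "smooth_fun A (\<lambda>q. if q \<in> U then \<kappa> q * 1 else 0)"
      by (rule \<kappa>(3)[of "\<lambda>x. 1"]) (rule smooth_on_const[OF chart(2)[OF c(1)]])
    show "(if p \<in> U then \<kappa> p * 1 else 0) = 1" using c \<kappa>(1)[of p] r by simp
    show "(if q \<in> U then \<kappa> q * 1 else 0) = 0" if "q \<notin> N" for q
    proof (cases "q \<in> U")
      case True
      then have "c q \<notin> cball (c p) r"
        using that r(2) chart(4)[OF c(1)] by (metis Int_iff image_iff inj_onD subsetD)
      then show ?thesis using \<kappa>(2)[of q] by auto
    qed simp
  qed
qed

section \<open>Derivations at a point and their local nature\<close>

lemma tangentD: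
  assumes "v \<in> tangent_space A p"
  shows "\<And>f h. smooth_fun A f \<Longrightarrow> smooth_fun A h \<Longrightarrow> v (\<lambda>x. f x + h x) = v f + v h"
    and "\<And>a f. smooth_fun A f \<Longrightarrow> v (\<lambda>x. a * f x) = a * v f"
    and "\<And>f h. smooth_fun A f \<Longrightarrow> smooth_fun A h \<Longrightarrow> v (\<lambda>x. f x * h x) = f p * v h + h p * v f"
    and "\<And>f. \<not> smooth_fun A f \<Longrightarrow> v f = 0"
proof -
  note * = assms[unfolded tangent_space_def mem_Collect_eq]
  show "\<And>f h. smooth_fun A f \<Longrightarrow> smooth_fun A h \<Longrightarrow> v (\<lambda>x. f x + h x) = v f + v h"
    using *[THEN conjunct1] by iprover
  show "\<And>a f. smooth_fun A f \<Longrightarrow> v (\<lambda>x. a * f x) = a * v f"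
    using *[THEN conjunct2, THEN conjunct1] by iprover
  show "\<And>f h. smooth_fun A f \<Longrightarrow> smooth_fun A h \<Longrightarrow> v (\<lambda>x. f x * h x) = f p * v h + h p * v f"
    using *[THEN conjunct2, THEN conjunct2, THEN conjunct1] by iprover
  show "\<And>f. \<not> smooth_fun A f \<Longrightarrow> v f = 0"
    using *[THEN conjunct2, THEN conjunct2, THEN conjunct2] by iprover
qed

lemma tangentI:
  assumes "\<And>f h. smooth_fun A f \<Longrightarrow> smooth_fun A h \<Longrightarrow> v (\<lambda>x. f x + h x) = v f + v h"
    and "\<And>a f. smooth_fun A f \<Longrightarrow> v (\<lambda>x. a * f x) = a * v f"
    and "\<And>f h. smooth_fun A f \<Longrightarrow> smooth_fun A h \<Longrightarrow> v (\<lambda>x. f x * h x) = f p * v h + h p * v f"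
    and "\<And>f. \<not> smooth_fun A f \<Longrightarrow> v f = 0"
  shows "v \<in> tangent_space A p"
  unfolding tangent_space_def mem_Collect_eq using assms by iprover

lemma tangent_const: "v \<in> tangent_space A p \<Longrightarrow> v (\<lambda>x. k) = 0"
  using tangentD(3)[of v p "\<lambda>x. 1" "\<lambda>x. 1"] tangentD(2)[of v p "\<lambda>x. 1" k] by simp

lemma tangent_uminus: "v \<in> tangent_space A p \<Longrightarrow> smooth_fun A f \<Longrightarrow> v (\<lambda>x. - f x) = - v f"
  using tangentD(2)[of v p f "-1"] by simp

lemma tangent_diff:
  "v \<in> tangent_space A p \<Longrightarrow> smooth_fun A f \<Longrightarrow> smooth_fun A h \<Longrightarrow> v (\<lambda>x. f x - h x) = v f - v h"
  using tangentD(1)[of v p f "\<lambda>x. - h x"] tangent_uminus[of v p h] by (auto simp: smooth_fun_uminus)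

lemma tangent_sum:
  assumes "v \<in> tangent_space A p"
  shows "finite B \<Longrightarrow> (\<And>b. b \<in> B \<Longrightarrow> smooth_fun A (f b)) \<Longrightarrow> v (\<lambda>x. \<Sum>b\<in>B. f b x) = (\<Sum>b\<in>B. v (f b))"
  by (induction B rule: finite_induct)
    (auto simp: tangent_const[OF assms] tangentD(1)[OF assms] smooth_fun_sum)

text \<open>For \<kappa> vanishing outside N and equal to 1 at p, the product \<kappa> (f - h) is
  identically 0. Since f - h vanishes at p, the Leibniz rule leaves v f - v h.\<close>

lemma tangent_local:
  assumes v: "v \<in> tangent_space A p" and f: "smooth_fun A f" "smooth_fun A h"
    and N: "open N" "p \<in> N" "\<And>q. q \<in> N \<Longrightarrow> f q = h q"
  shows "v f = v h"
proof -
  obtain \<kappa> where \<kappa>: "smooth_fun A \<kappa>" "\<kappa> p = 1" "\<And>q. q \<notin> N \<Longrightarrow> \<kappa> q = 0"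
    using bump[OF N(1,2)] by blast
  have "(\<lambda>q. \<kappa> q * (f q - h q)) = (\<lambda>q. 0)"
    using \<kappa>(3) N(3) by fastforce
  then have "v (\<lambda>q. \<kappa> q * (f q - h q)) = 0"
    using tangent_const[OF v, of 0] by simp
  then show ?thesis
    using tangentD(3)[OF v \<kappa>(1), of "\<lambda>q. f q - h q"] tangent_diff[OF v f] f N \<kappa>(2)
    by (simp add: smooth_fun_diff)
qed

lemma tangent_eqI:
  assumes "v \<in> tangent_space A p" "w \<in> tangent_space A p" "\<And>f. smooth_fun A f \<Longrightarrow> v f = w f"
  shows "v = w"
  using assms tangentD(4) by (metis ext)

lemma tangent_zero [simp]: "0 \<in> tangent_space A p"
  by (simp add: tangent_space_def)

lemma tangent_add [intro]:
  assumes "v \<in> tangent_space A p" "w \<in> tangent_space A p"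
  shows "v + w \<in> tangent_space A p"
  by (rule tangentI) (simp_all add: tangentD[OF assms(1)] tangentD[OF assms(2)] algebra_simps)

lemma tangent_scale [intro]:
  assumes "v \<in> tangent_space A p"
  shows "a *\<^sub>T v \<in> tangent_space A p"
  by (rule tangentI) (simp_all add: tscale_def tangentD[OF assms] algebra_simps)

lemma tangent_minus [intro]:
  assumes "v \<in> tangent_space A p"
  shows "- v \<in> tangent_space A p"
  by (rule tangentI) (simp_all add: tangentD[OF assms] algebra_simps)

lemma tangent_sub [intro]:
  "v \<in> tangent_space A p \<Longrightarrow> w \<in> tangent_space A p \<Longrightarrow> v - w \<in> tangent_space A p"
  using tangent_add[of v p "- w"] tangent_minus[of w p] by simp

text \<open>Coordinates and coordinate fields near p, cut off so that they are global objects, since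
  derivations act on global functions. The last clause reflects that N can be taken as a coordinate
  ball, convex in the chart; it later yields local constancy.\<close>

definition local_frame :: "'a \<Rightarrow> 'a set \<Rightarrow> ('e \<Rightarrow> 'a \<Rightarrow> real) \<Rightarrow> ('e \<Rightarrow> 'a \<Rightarrow> 'a tvec) \<Rightarrow> bool" where
  "local_frame p N x E \<longleftrightarrow> open N \<and> p \<in> N \<and>
    (\<forall>b. smooth_fun A (x b)) \<and> (\<forall>b. vector_field A (E b)) \<and>
    (\<forall>q\<in>N. \<forall>b\<in>Basis. \<forall>b'\<in>Basis. E b q (x b') = (if b = b' then 1 else 0)) \<and>
    (\<forall>q\<in>N. \<forall>v\<in>tangent_space A q. \<forall>f. smooth_fun A f \<longrightarrow> v f = (\<Sum>b\<in>Basis. v (x b) * E b q f)) \<and>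
    (\<forall>q\<in>N. \<forall>f. smooth_fun A f \<longrightarrow> (\<forall>q\<in>N. \<forall>b\<in>Basis. E b q f = 0) \<longrightarrow> f q = f p)"

text \<open>Everything is multiplied by a bump that is 1 on N. That derivations are combinations of
  partial derivatives is Hadamard's lemma: near q, f is a constant plus a sum of products of
  functions vanishing at q with smooth coefficients, and the Leibniz rule keeps only the
  coefficients at q.\<close>

lemma local_frame_exists: obtains N x E where "local_frame p N x E"
proof -
  obtain U c where c: "(U, c) \<in> A" "p \<in> U" using chart_exists .
  obtain r where r: "0 < r" "cball (c p) r \<subseteq> c ` (U \<inter> UNIV)" using chart_ball[OF c open_UNIV UNIV_I] .
  obtain \<kappa> where \<kappa>: "\<And>q. c q \<in> ball (c p) (r / 2) \<Longrightarrow> \<kappa> q = (1::real)"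
    "\<And>u. smooth_on u (c ` U) \<Longrightarrow> smooth_fun A (\<lambda>q. if q \<in> U then \<kappa> q * u (c q) else 0)"
    by (rule chart_bump[OF c r(1) chart(2)[OF c(1)]]) (use r in auto)
  note opU = chart(2)[OF c(1)]
  define N where "N = {q \<in> U. c q \<in> ball (c p) (r / 2)}"
  have N: "open N" "p \<in> N" and NU: "\<And>q. q \<in> N \<Longrightarrow> q \<in> U"
    unfolding N_def using open_chart_vimage[OF c(1) open_ball[of "c p" "r / 2"]] c(2) r(1) by auto
  have \<kappa>1: "\<kappa> q = 1" if "q \<in> N" for q using \<kappa>(1) that by (simp add: N_def)
  define x where "x b = (\<lambda>q. if q \<in> U then \<kappa> q * (c q \<bullet> b) else 0)" for b
  have x: "smooth_fun A (x b)" for b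
    unfolding x_def by (rule \<kappa>(2)) (rule smooth_on_linear[OF bounded_linear_inner_left opU])
  have xN: "x b q = c q \<bullet> b" if "q \<in> N" for b q using that \<kappa>1 NU by (simp add: x_def)
  define \<delta> where "\<delta> f y b = frechet_derivative (\<lambda>y. f (inv_into U c y)) (at y) b" for f :: "'a \<Rightarrow> real" and y b
  have sm: "smooth_on (\<lambda>y. f (inv_into U c y)) (c ` U)" if "smooth_fun A f" for f
    using that c by (auto simp: smooth_fun_def o_def)
  have dr: "((\<lambda>y. f (inv_into U c y)) has_derivative \<delta> f y) (at y)" if "smooth_fun A f" "y \<in> c ` U" for f y
    using smooth_on_imp_has_derivative[OF sm[OF that(1)] that(2)] by (simp add: \<delta>_def[abs_def])
  have dr_eq: "\<delta> f y b = D b" if "((\<lambda>y. f (inv_into U c y)) has_derivative D) (at y)" for f y b D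
    using frechet_derivative_at[OF that] by (simp add: \<delta>_def)
  \<comment> \<open>The value 0 on non-smooth functions belongs to the definition of a tangent
    vector; outside U, where the chart gives no derivative, the field is extended by 0.\<close>
  define E where "E b q f = (if smooth_fun A f \<and> q \<in> U then \<kappa> q * \<delta> f (c q) b else 0)" for b q f
  have Et: "E b q \<in> tangent_space A q" for b q
  proof (cases "q \<in> U")
    case True
    then have y: "c q \<in> c ` U" and q: "inv_into U c (c q) = q" using chart(6)[OF c(1)] by auto
    have "\<delta> (\<lambda>x. a) (c q) b = 0" for a
      using dr_eq[of "\<lambda>x. a", OF has_derivative_const] by simp
    moreover have "\<delta> (\<lambda>x. f x + h x) (c q) b = \<delta> f (c q) b + \<delta> h (c q) b"
      "\<delta> (\<lambda>x. a * f x) (c q) b = a * \<delta> f (c q) b"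
      "\<delta> (\<lambda>x. f x * h x) (c q) b = f q * \<delta> h (c q) b + h q * \<delta> f (c q) b"
      if "smooth_fun A f" "smooth_fun A h" for f h a
      using dr_eq[of "\<lambda>x. f x + h x", OF has_derivative_add[OF dr[OF that(1) y] dr[OF that(2) y]], of b]
        dr_eq[of "\<lambda>x. a * f x", OF has_derivative_mult_right[OF dr[OF that(1) y], of a], of b]
        dr_eq[of "\<lambda>x. f x * h x", OF has_derivative_mult[OF dr[OF that(1) y] dr[OF that(2) y]], of b] q
      by auto
    ultimately show ?thesis
      using True by (intro tangentI) (simp_all add: E_def smooth_fun_add smooth_fun_mult algebra_simps)
  next
    case False
    then have "E b q = 0" by (simp add: E_def fun_eq_iff)
    then show ?thesis by simp
  qed
  have Evf: "vector_field A (E b)" for b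
  proof -
    have "smooth_fun A (deriv_along (E b) f)" if f: "smooth_fun A f" for f
    proof -
      have "smooth_fun A (\<lambda>q. if q \<in> U then \<kappa> q * \<delta> f (c q) b else 0)"
        unfolding \<delta>_def by (rule \<kappa>(2)) (rule smooth_on_frechet[OF sm[OF f]])
      moreover have "deriv_along (E b) f = (\<lambda>q. if q \<in> U then \<kappa> q * \<delta> f (c q) b else 0)"
        using f by (auto simp: deriv_along_def E_def)
      ultimately show ?thesis by simp
    qed
    then show ?thesis using Et by (simp add: vector_field_def)
  qed
  have Ex: "E b q (x b') = (if b = b' then 1 else 0)" if q: "q \<in> N" and b: "b \<in> Basis" "b' \<in> Basis" for q b b'
  proof -
    have "((\<lambda>y. x b' (inv_into U c y)) has_derivative (\<lambda>v. v \<bullet> b')) (at (c q))"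
    proof (rule has_derivative_transform_within_open[OF _ open_ball])
      show "((\<lambda>y. y \<bullet> b') has_derivative (\<lambda>v. v \<bullet> b')) (at (c q))"
        by (auto intro!: derivative_eq_intros)
      show "c q \<in> ball (c p) (r / 2)" using q by (simp add: N_def)
      fix y assume y: "y \<in> ball (c p) (r / 2)"
      moreover from this r have "y \<in> c ` U" by auto
      ultimately have "inv_into U c y \<in> N" "c (inv_into U c y) = y"
        using chart(5)[OF c(1)] by (auto simp: N_def inv_into_into)
      then show "y \<bullet> b' = x b' (inv_into U c y)" using xN by simp
    qed
    then show ?thesis
      using dr_eq[of "x b'" _ "c q" b] x q NU \<kappa>1 b by (simp add: E_def inner_Basis)
  qed
  have span: "v f = (\<Sum>b\<in>Basis. v (x b) * E b q f)"
    if q: "q \<in> N" and v: "v \<in> tangent_space A q" and f: "smooth_fun A f" for q v f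
  proof -
    define F where "F = (\<lambda>y. f (inv_into U c y))"
    obtain s where s: "0 < s" "ball (c q) s \<subseteq> ball (c p) (r / 2)"
      using q openE[OF open_ball, of "c q" "c p" "r / 2"] unfolding N_def by blast
    have sU: "ball (c q) s \<subseteq> c ` U" using s r by fastforce
    obtain G where G: "\<And>b. smooth_on (G b) (ball (c q) s)"
      "\<And>y. y \<in> ball (c q) s \<Longrightarrow> F y = F (c q) + (\<Sum>b\<in>Basis. ((y - c q) \<bullet> b) * G b y)"
      using hadamard[OF smooth_on_subset[OF sm[OF f] sU]] unfolding F_def by blast
    obtain \<beta> where \<beta>: "\<And>q'. c q' \<in> ball (c q) (s / 2 / 2) \<Longrightarrow> \<beta> q' = (1::real)"
      "\<And>u. smooth_on u (ball (c q) s) \<Longrightarrow> smooth_fun A (\<lambda>q. if q \<in> U then \<beta> q * u (c q) else 0)"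
      by (rule chart_bump[OF c(1) NU[OF q] _ open_ball _ sU, of "s / 2"]) (use s in auto)
    define g where "g b = (\<lambda>q. if q \<in> U then \<beta> q * G b (c q) else 0)" for b
    have g: "smooth_fun A (g b)" for b unfolding g_def by (rule \<beta>(2)[OF G(1)])
    let ?M = "{q' \<in> U. c q' \<in> ball (c q) (s / 2 / 2)}"
    have M: "open ?M" "q \<in> ?M"
      by (rule open_chart_vimage[OF c(1) open_ball]) (use NU[OF q] s in simp)
    have fM: "f q' = f q + (\<Sum>b\<in>Basis. (x b q' - c q \<bullet> b) * g b q')" if q': "q' \<in> ?M" for q'
    proof -
      have y: "c q' \<in> ball (c q) s" using q' s by auto
      then have "q' \<in> N" using q' s(2) unfolding N_def by blast
      moreover have "F (c q') = f q'" "F (c q) = f q"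
        using chart(6)[OF c(1)] q' NU[OF q] by (auto simp: F_def)
      ultimately show ?thesis
        using G(2)[OF y] q' xN \<beta>(1)[of q'] by (simp add: g_def inner_diff_left)
    qed
    have smg: "smooth_fun A (\<lambda>q'. (x b q' - c q \<bullet> b) * g b q')" for b
      by (intro smooth_fun_mult smooth_fun_diff x g smooth_fun_const)
    have sms: "smooth_fun A (\<lambda>q'. \<Sum>b\<in>Basis. (x b q' - c q \<bullet> b) * g b q')"
      by (intro smooth_fun_sum smg finite_Basis)
    have key: "w f = (\<Sum>b\<in>Basis. w (x b) * g b q)" if w: "w \<in> tangent_space A q" for w
    proof -
      have "w f = w (\<lambda>q'. f q + (\<Sum>b\<in>Basis. (x b q' - c q \<bullet> b) * g b q'))"
        by (rule tangent_local[OF w f _ M fM]) (intro smooth_fun_add smooth_fun_const sms)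
      also have "\<dots> = w (\<lambda>q'. f q) + (\<Sum>b\<in>Basis. w (\<lambda>q'. (x b q' - c q \<bullet> b) * g b q'))"
        by (subst tangentD(1)[OF w smooth_fun_const sms]) (simp add: tangent_sum[OF w finite_Basis smg])
      also have "\<dots> = (\<Sum>b\<in>Basis. w (x b) * g b q)"
      proof -
        have "w (\<lambda>q'. (x b q' - c q \<bullet> b) * g b q') = w (x b) * g b q" for b
          using tangentD(3)[OF w, of "\<lambda>q'. x b q' - c q \<bullet> b" "g b"] x[of b] g[of b] xN[OF q]
            tangent_diff[OF w x[of b], of "\<lambda>q'. c q \<bullet> b"] tangent_const[OF w, of "c q \<bullet> b"]
          by (simp add: smooth_fun_diff)
        then show ?thesis by (simp add: tangent_const[OF w])
      qed
      finally show ?thesis .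
    qed
    \<comment> \<open>Applied to the coordinate fields themselves, the formula identifies the
      Hadamard coefficients with the partial derivatives.\<close>
    have "E b q f = g b q" if "b \<in> Basis" for b
      using key[OF Et, of b] Ex[OF q that] that by (simp add: if_distrib[of "\<lambda>a. a * _"] cong: if_cong)
    then show ?thesis using key[OF v] by simp
  qed
  have const: "f q = f p" if q: "q \<in> N" and f: "smooth_fun A f"
    and z: "\<forall>q\<in>N. \<forall>b\<in>Basis. E b q f = 0" for q f
  proof -
    let ?B = "ball (c p) (r / 2)"
    have "((\<lambda>y. f (inv_into U c y)) has_derivative (\<lambda>v. 0)) (at y within ?B)" if y: "y \<in> ?B" for y
    proof -
      have yU: "y \<in> c ` U" using y r by auto
      have "inv_into U c y \<in> N" and cy: "c (inv_into U c y) = y"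
        using y yU chart(5)[OF c(1)] by (auto simp: N_def inv_into_into)
      from z[rule_format, OF this(1)] have zb: "\<delta> f y b = 0" if "b \<in> Basis" for b
        using that f \<kappa>1[OF \<open>inv_into U c y \<in> N\<close>] NU[OF \<open>inv_into U c y \<in> N\<close>] cy by (simp add: E_def)
      have lin: "linear (\<delta> f y)" using dr[OF f yU] by (rule has_derivative_linear)
      have "\<delta> f y v = 0" for v
      proof -
        have "\<delta> f y v = \<delta> f y (\<Sum>b\<in>Basis. (v \<bullet> b) *\<^sub>R b)" by (simp add: euclidean_representation)
        also have "\<dots> = 0" using zb by (simp add: linear_sum[OF lin] linear_scale[OF lin])
        finally show ?thesis .
      qed
      then show ?thesis
        by (rule has_derivative_at_withinI[OF has_derivative_eq_rhs[OF dr[OF f yU] ext]])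
    qed
    then obtain k where "\<And>y. y \<in> ?B \<Longrightarrow> f (inv_into U c y) = k"
      using has_derivative_zero_constant[OF convex_ball, of "c p" "r / 2" "(\<lambda>y. f (inv_into U c y))"] by blast
    from this[of "c q"] this[of "c p"] show ?thesis
      using q NU[OF q] c r chart(6)[OF c(1)] by (simp add: N_def)
  qed
  have "local_frame p N x E"
    unfolding local_frame_def using N x Evf Ex span const by simp
  then show ?thesis by (rule that)
qed

lemma local_frameD:
  assumes "local_frame p N x E"
  shows "open N" "p \<in> N" "\<And>b. smooth_fun A (x b)" "\<And>b. vector_field A (E b)"
    and "\<And>q b b'. q \<in> N \<Longrightarrow> b \<in> Basis \<Longrightarrow> b' \<in> Basis \<Longrightarrow> E b q (x b') = (if b = b' then 1 else 0)"
    and "\<And>q v f. q \<in> N \<Longrightarrow> v \<in> tangent_space A q \<Longrightarrow> smooth_fun A f \<Longrightarrow> v f = (\<Sum>b\<in>Basis. v (x b) * E b q f)"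
    and "\<And>q f. q \<in> N \<Longrightarrow> smooth_fun A f \<Longrightarrow> \<forall>q\<in>N. \<forall>b\<in>Basis. E b q f = 0 \<Longrightarrow> f q = f p"
  using assms unfolding local_frame_def by blast+

end

subsection \<open>Vector fields and tensoriality\<close>

definition fmul :: "('a \<Rightarrow> real) \<Rightarrow> ('a \<Rightarrow> 'a tvec) \<Rightarrow> 'a \<Rightarrow> 'a tvec" where
  "fmul f X = (\<lambda>p. f p *\<^sub>T X p)"

definition app :: "('a \<Rightarrow> 'a tvec \<Rightarrow> 'a tvec) \<Rightarrow> ('a \<Rightarrow> 'a tvec) \<Rightarrow> 'a \<Rightarrow> 'a tvec" where
  "app \<phi> X = (\<lambda>p. \<phi> p (X p))"

lemma fmul_apply: "fmul f X p = f p *\<^sub>T X p"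
  by (simp add: fmul_def)

lemma app_apply: "app \<phi> X p = \<phi> p (X p)"
  by (simp add: app_def)

lemma tscale_simps [simp]: "1 *\<^sub>T v = v" "0 *\<^sub>T v = 0" "a *\<^sub>T 0 = 0"
  by (simp_all add: tscale_def fun_eq_iff)

lemma tscale_add: "a *\<^sub>T (v + w) = a *\<^sub>T v + a *\<^sub>T w"
  and tscale_diff: "a *\<^sub>T (v - w) = a *\<^sub>T v - a *\<^sub>T w"
  and tscale_add_left: "(a + b) *\<^sub>T v = a *\<^sub>T v + b *\<^sub>T v"
  and tscale_tscale: "a *\<^sub>T b *\<^sub>T v = (a * b) *\<^sub>T v"
  and tscale_minus: "a *\<^sub>T (- v) = - (a *\<^sub>T v)"
  and tscale_minus_left: "(- a) *\<^sub>T v = - (a *\<^sub>T v)"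
  and tscale_apply: "(a *\<^sub>T v) f = a * v f"
  by (simp_all add: tscale_def fun_eq_iff algebra_simps)

context smooth_manifold
begin

abbreviation VF :: "('a \<Rightarrow> 'a tvec) \<Rightarrow> bool" where "VF \<equiv> vector_field A"
abbreviation T :: "'a \<Rightarrow> 'a tvec set" where "T \<equiv> tangent_space A"
abbreviation sm :: "('a \<Rightarrow> real) \<Rightarrow> bool" where "sm \<equiv> smooth_fun A"

lemma vfT [simp, intro]: "VF X \<Longrightarrow> X p \<in> T p"
  by (simp add: vector_field_def)

lemma vf_smooth: "VF X \<Longrightarrow> sm f \<Longrightarrow> sm (\<lambda>q. X q f)"
  by (auto simp: vector_field_def deriv_along_def)

lemma vector_fieldI:
  assumes "\<And>p. X p \<in> T p" "\<And>f. sm f \<Longrightarrow> sm (\<lambda>q. X q f)"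
  shows "VF X"
  using assms by (simp add: vector_field_def deriv_along_def)

lemma vf_zero [simp]: "VF 0"
  by (rule vector_fieldI) simp_all

lemma vf_add [intro]: "VF X \<Longrightarrow> VF Y \<Longrightarrow> VF (X + Y)"
  by (rule vector_fieldI) (auto intro!: tangent_add smooth_fun_add dest: vf_smooth)

lemma vf_diff [intro]: "VF X \<Longrightarrow> VF Y \<Longrightarrow> VF (X - Y)"
  by (rule vector_fieldI) (auto intro!: tangent_sub smooth_fun_diff dest: vf_smooth)

lemma vf_minus [intro]: "VF X \<Longrightarrow> VF (- X)"
  by (rule vector_fieldI) (auto intro!: tangent_minus smooth_fun_uminus dest: vf_smooth)

lemma vf_fmul [intro]: "sm f \<Longrightarrow> VF X \<Longrightarrow> VF (fmul f X)"
  by (rule vector_fieldI)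
    (auto simp: fmul_def intro!: tangent_scale, auto simp: tscale_def intro!: smooth_fun_mult dest: vf_smooth)

lemma bracket_apply: "lie_bracket X Y p f = X p (\<lambda>q. Y q f) - Y p (\<lambda>q. X q f)"
  by (simp add: lie_bracket_def deriv_along_def)

lemma vf_bracket [intro]:
  assumes X: "VF X" and Y: "VF Y"
  shows "VF (lie_bracket X Y)"
proof (rule vector_fieldI)
  fix p
  note Xp = tangentD[OF vfT[OF X, of p]] and Yp = tangentD[OF vfT[OF Y, of p]]
  show "lie_bracket X Y p \<in> T p"
  proof (rule tangentI)
    fix f h assume f: "sm f" and h: "sm h"
    note s = vf_smooth[OF X f] vf_smooth[OF Y f] vf_smooth[OF X h] vf_smooth[OF Y h] f h
    have "(\<lambda>q. Z q (\<lambda>x. f x + h x)) = (\<lambda>q. Z q f + Z q h)" if "VF Z" for Z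
      using tangentD(1)[OF vfT[OF that]] f h by auto
    then show "lie_bracket X Y p (\<lambda>x. f x + h x) = lie_bracket X Y p f + lie_bracket X Y p h"
      using X Y s by (simp add: bracket_apply Xp(1) Yp(1))
    have "(\<lambda>q. Z q (\<lambda>x. f x * h x)) = (\<lambda>q. f q * Z q h + h q * Z q f)" if "VF Z" for Z
      using tangentD(3)[OF vfT[OF that]] f h by auto
    then show "lie_bracket X Y p (\<lambda>x. f x * h x) = f p * lie_bracket X Y p h + h p * lie_bracket X Y p f"
      using X Y s
      by (simp add: bracket_apply Xp(1,3) Yp(1,3) smooth_fun_mult algebra_simps)
  next
    fix a f assume f: "sm f"
    note s = vf_smooth[OF X f] vf_smooth[OF Y f]
    have "(\<lambda>q. Z q (\<lambda>x. a * f x)) = (\<lambda>q. a * Z q f)" if "VF Z" for Z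
      using tangentD(2)[OF vfT[OF that]] f by auto
    then show "lie_bracket X Y p (\<lambda>x. a * f x) = a * lie_bracket X Y p f"
      using X Y s by (simp add: bracket_apply Xp(2) Yp(2) algebra_simps)
  next
    fix f assume f: "\<not> sm f"
    have "(\<lambda>q. Z q f) = (\<lambda>q. 0)" if "VF Z" for Z
      using tangentD(4)[OF vfT[OF that]] f by auto
    then show "lie_bracket X Y p f = 0"
      using X Y by (simp add: bracket_apply tangent_const[OF vfT])
  qed
next
  show "sm (\<lambda>q. lie_bracket X Y q f)" if "sm f" for f
    unfolding bracket_apply
    by (intro smooth_fun_diff vf_smooth[OF X vf_smooth[OF Y that]] vf_smooth[OF Y vf_smooth[OF X that]])
qed

lemma vf_sum:
  assumes "finite B" "\<And>b. b \<in> B \<Longrightarrow> sm (k b)" "\<And>b. b \<in> B \<Longrightarrow> VF (E b)"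
  shows "VF (\<lambda>q f. \<Sum>b\<in>B. k b q * E b q f)"
  using assms
proof (induction B rule: finite_induct)
  case empty
  have "(\<lambda>q f. 0) = (0 :: 'a \<Rightarrow> 'a tvec)" by (simp add: fun_eq_iff)
  then show ?case by simp
next
  case (insert b B)
  have "(\<lambda>q f. \<Sum>b\<in>insert b B. k b q * E b q f) = fmul (k b) (E b) + (\<lambda>q f. \<Sum>b\<in>B. k b q * E b q f)"
    using insert by (simp add: fun_eq_iff fmul_def tscale_def)
  then show ?case using insert by auto
qed

text \<open>Constant coefficients along a local frame, whose fields are already global.\<close>

lemma vf_extend:
  assumes v: "v \<in> T p"
  obtains X where "VF X" "X p = v"
proof -
  obtain N x E where "local_frame p N x E" using local_frame_exists .
    note F = local_frameD[OF this]
  let ?X = "\<lambda>q f. \<Sum>b\<in>Basis. v (x b) * E b q f"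
  have X: "VF ?X" by (rule vf_sum) (use F in auto)
  moreover have "?X p = v"
    by (rule tangent_eqI[OF vfT[OF X, of p] v]) (use F v in auto)
  ultimately show ?thesis using that by blast
qed

text \<open>By additivity it suffices that L Z = 0 when Z p = 0. Near p the field Z equals the frame
  combination with coefficients Z (x b); these vanish at p, so L annihilates the combination.
  Multiplication by a bump equal to 1 at p makes both fields equal everywhere without changing
  L.\<close>

lemma tensorial:
  fixes L :: "('a \<Rightarrow> 'a tvec) \<Rightarrow> real"
  assumes add: "\<And>X Y. VF X \<Longrightarrow> VF Y \<Longrightarrow> L (X + Y) = L X + L Y"
    and mult: "\<And>f X. sm f \<Longrightarrow> VF X \<Longrightarrow> L (fmul f X) = f p * L X"
    and X: "VF X" and Y: "VF Y" and eq: "X p = Y p"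
  shows "L X = L Y"
proof -
  have zero: "L 0 = 0" using add[of 0 0] by simp
  define Z where "Z = X - Y"
  have Z: "VF Z" "Z p = 0" using X Y eq by (auto simp: Z_def)
  have "L X = L (Z + Y)" by (simp add: Z_def)
  then have "L X = L Z + L Y" using Z(1) Y add by simp
  moreover have "L Z = 0"
  proof -
    obtain N x E where "local_frame p N x E" using local_frame_exists .
    note F = local_frameD[OF this]
    have sm_z: "sm (\<lambda>q. Z q (x b))" for b by (rule vf_smooth[OF Z(1) F(3)])
    have "VF (\<lambda>q f. \<Sum>b\<in>B. Z q (x b) * E b q f) \<and> L (\<lambda>q f. \<Sum>b\<in>B. Z q (x b) * E b q f) = 0" if "finite B" for B
      using that
    proof (induction B rule: finite_induct)
      case empty
      have "(\<lambda>q f. 0) = (0 :: 'a \<Rightarrow> 'a tvec)" by (simp add: fun_eq_iff)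
      then show ?case using zero by simp
    next
      case (insert b B)
      let ?S = "\<lambda>q f. \<Sum>b\<in>B. Z q (x b) * E b q f" and ?F = "fmul (\<lambda>q. Z q (x b)) (E b)"
      have eq: "(\<lambda>q f. \<Sum>b\<in>insert b B. Z q (x b) * E b q f) = ?F + ?S"
        using insert(1,2) by (simp add: fun_eq_iff fmul_def tscale_def)
      have F1: "VF ?F" by (rule vf_fmul[OF sm_z F(4)])
      have "L (?F + ?S) = 0"
        using insert(3) add[OF F1] mult[OF sm_z F(4)[of b], of b] Z(2) by simp
      then show ?case
        unfolding eq using vf_add[OF F1] insert(3) by blast
    qed
    from this[OF finite_Basis] obtain Z' where Z': "VF Z'" "L Z' = 0"
      and Z'_def: "Z' = (\<lambda>q f. \<Sum>b\<in>Basis. Z q (x b) * E b q f)" by blast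
    have ZZ': "Z q = Z' q" if "q \<in> N" for q
      by (rule tangent_eqI[OF vfT[OF Z(1)] vfT[OF Z'(1)]])
        (simp add: Z'_def F(6)[OF that vfT[OF Z(1)]])
    obtain \<kappa> where \<kappa>: "sm \<kappa>" "\<kappa> p = 1" "\<And>q. q \<notin> N \<Longrightarrow> \<kappa> q = 0" using bump[OF F(1,2)] by blast
    have "fmul \<kappa> Z = fmul \<kappa> Z'"
    proof
      show "fmul \<kappa> Z q = fmul \<kappa> Z' q" for q
        using ZZ'[of q] \<kappa>(3)[of q] by (cases "q \<in> N") (auto simp: fmul_def)
    qed
    then show ?thesis
      using mult[OF \<kappa>(1) Z(1)] mult[OF \<kappa>(1) Z'(1)] \<kappa>(2) Z'(2) by simp
  qed
  ultimately show ?thesis by simp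
qed

text \<open>Evaluate the operator on any field extending the given vector; by tensoriality the
  choice does not matter. In this way \<nabla>\<xi> + \<phi>, known on vector fields only, becomes
  an endomorphism field.\<close>

lemma endo_of_operator:
  assumes vf: "\<And>X. VF X \<Longrightarrow> VF (L X)"
    and add: "\<And>X Y. VF X \<Longrightarrow> VF Y \<Longrightarrow> L (X + Y) = L X + L Y"
    and mult: "\<And>f X. sm f \<Longrightarrow> VF X \<Longrightarrow> L (fmul f X) = fmul f (L X)"
  shows "\<exists>\<phi>. endo_field A \<phi> \<and> (\<forall>X p. VF X \<longrightarrow> \<phi> p (X p) = L X p)"
proof -
  let ?X = "\<lambda>p v. SOME X. VF X \<and> X p = v"
  define \<phi> where "\<phi> p v = L (?X p v) p" for p v
  have eq: "\<phi> p (X p) = L X p" if X: "VF X" for X p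
  proof -
    have "VF (?X p (X p)) \<and> ?X p (X p) p = X p"
      by (rule someI[where P = "\<lambda>Y. VF Y \<and> Y p = X p" and x = X]) (simp add: X)
    then have "L (?X p (X p)) p f = L X p f" for f
      by (intro tensorial[where L = "\<lambda>X. L X p f" and p = p])
        (auto simp: add mult X fmul_apply tscale_def)
    then show ?thesis by (auto simp: \<phi>_def)
  qed
  have "endo_field A \<phi>"
    unfolding endo_field_def
  proof (intro conjI allI ballI impI)
    fix p v assume v: "v \<in> T p"
    obtain X where X: "VF X" "X p = v" using vf_extend[OF v] .
    show "\<phi> p v \<in> T p" using eq[OF X(1), of p] X vfT[OF vf[OF X(1)]] by simp
    show "\<phi> p (a *\<^sub>T v) = a *\<^sub>T \<phi> p v" for a
      using eq[OF X(1), of p] eq[OF vf_fmul[OF smooth_fun_const X(1)], of p a] X mult[of "\<lambda>q. a" X]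
      by (simp add: fmul_apply)
    fix w assume w: "w \<in> T p"
    obtain Y where Y: "VF Y" "Y p = w" using vf_extend[OF w] .
    show "\<phi> p (v + w) = \<phi> p v + \<phi> p w"
      using eq[OF X(1), of p] eq[OF Y(1), of p] eq[of "X + Y" p] X Y add by auto
  next
    show "VF (\<lambda>p. \<phi> p (X p))" if "VF X" for X
      using eq[OF that] vf[OF that] by simp
  qed
  then show ?thesis using eq by blast
qed

lemma endo_fieldD:
  assumes "endo_field A \<phi>"
  shows "\<And>p v. v \<in> T p \<Longrightarrow> \<phi> p v \<in> T p"
    and "\<And>p v w. v \<in> T p \<Longrightarrow> w \<in> T p \<Longrightarrow> \<phi> p (v + w) = \<phi> p v + \<phi> p w"
    and "\<And>p v a. v \<in> T p \<Longrightarrow> \<phi> p (a *\<^sub>T v) = a *\<^sub>T \<phi> p v"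
    and "\<And>X. VF X \<Longrightarrow> VF (app \<phi> X)"
  using assms unfolding endo_field_def app_def by blast+

lemma endo_field_minus:
  assumes "endo_field A \<phi>" "v \<in> T p"
  shows "\<phi> p (- v) = - \<phi> p v" "w \<in> T p \<Longrightarrow> \<phi> p (v - w) = \<phi> p v - \<phi> p w" "\<phi> p 0 = 0"
proof -
  note \<phi> = endo_fieldD[OF assms(1)]
  have m: "\<phi> p (- v) = - \<phi> p v" if "v \<in> T p" for v
    using \<phi>(3)[OF that, of "-1"] by (simp add: tscale_minus_left)
  show "\<phi> p (- v) = - \<phi> p v" by (rule m[OF assms(2)])
  show "w \<in> T p \<Longrightarrow> \<phi> p (v - w) = \<phi> p v - \<phi> p w"
    using \<phi>(2)[OF assms(2), of "- w"] m by auto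
  show "\<phi> p 0 = 0" using \<phi>(3)[of 0 p 0] by simp
qed

text \<open>Local frames give local constancy, connectedness the rest. It is meant for
  \<lambda>^2.\<close>

lemma constant_if_derivatives_vanish:
  assumes conn: "connected (UNIV :: 'a set)" and f: "sm f"
    and z: "\<And>X p. VF X \<Longrightarrow> X p f = 0"
  shows "f p = f q"
proof -
  have "\<exists>N. open N \<and> p \<in> N \<and> (\<forall>q\<in>N. f q = f p)" for p
  proof -
    obtain N x E where "local_frame p N x E" using local_frame_exists .
    note F = local_frameD[OF this]
    have "f q = f p" if "q \<in> N" for q by (rule F(7)[OF that f]) (simp add: z[OF F(4)])
    then show ?thesis using F(1,2) by blast
  qed
  then have "f constant_on UNIV"
    using conn by (intro locally_constant_imp_constant) (auto simp: openin_open)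
  then show ?thesis by (auto simp: constant_on_def)
qed

end

subsection \<open>Metrics and almost contact structures\<close>

lemma linear_form_atD:
  assumes "linear_form_at A p \<alpha>" "v \<in> tangent_space A p"
  shows "w \<in> tangent_space A p \<Longrightarrow> \<alpha> (v + w) = \<alpha> v + \<alpha> w" "\<alpha> (a *\<^sub>T v) = a * \<alpha> v"
  using assms unfolding linear_form_at_def by auto

lemma affine_connectionD:
  assumes "affine_connection A D" "vector_field A X" "vector_field A Y"
  shows "vector_field A (D X Y)"
    and "vector_field A Z \<Longrightarrow> D (X + Y) Z = D X Z + D Y Z"
    and "vector_field A Z \<Longrightarrow> D X (Y + Z) = D X Y + D X Z"
    and "smooth_fun A f \<Longrightarrow> D (fmul f X) Y = fmul f (D X Y)"
    and "smooth_fun A f \<Longrightarrow> D X (fmul f Y) p = X p f *\<^sub>T Y p + f p *\<^sub>T D X Y p"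
proof -
  note * = assms(1)[unfolded affine_connection_def]
  show "vector_field A (D X Y)"
    by (rule *[THEN conjunct1, rule_format, OF assms(2,3)])
  show "D (X + Y) Z = D X Z + D Y Z" if "vector_field A Z"
    by (rule *[THEN conjunct2, THEN conjunct1, rule_format, OF assms(2,3) that, THEN conjunct1])
  show "D X (Y + Z) = D X Y + D X Z" if "vector_field A Z"
    by (rule *[THEN conjunct2, THEN conjunct1, rule_format, OF assms(2,3) that, THEN conjunct2])
  note ** = *[THEN conjunct2, THEN conjunct2, rule_format, OF assms(2,3)]
  show "D (fmul f X) Y = fmul f (D X Y)" if "smooth_fun A f"
    using **[OF that, THEN conjunct1] by (simp only: fmul_def)
  show "D X (fmul f Y) p = X p f *\<^sub>T Y p + f p *\<^sub>T D X Y p" if "smooth_fun A f"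
    using **[OF that, THEN conjunct2] by (simp only: fmul_def deriv_along_def)
qed

lemma levi_civitaD:
  assumes "levi_civita A g D"
  shows "affine_connection A D"
    and "vector_field A X \<Longrightarrow> vector_field A Y \<Longrightarrow> D X Y - D Y X = lie_bracket X Y"
    and "vector_field A X \<Longrightarrow> vector_field A Y \<Longrightarrow> vector_field A Z \<Longrightarrow>
      X p (\<lambda>q. g q (Y q) (Z q)) = g p (D X Y p) (Z p) + g p (Y p) (D X Z p)"
proof -
  note * = assms[unfolded levi_civita_def]
  show "affine_connection A D" by (rule *[THEN conjunct1])
  show "D X Y - D Y X = lie_bracket X Y" if "vector_field A X" "vector_field A Y"
    by (rule *[THEN conjunct2, THEN conjunct1, rule_format, OF that])
  show "X p (\<lambda>q. g q (Y q) (Z q)) = g p (D X Y p) (Z p) + g p (Y p) (D X Z p)"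
    if "vector_field A X" "vector_field A Y" "vector_field A Z"
    by (rule *[THEN conjunct2, THEN conjunct2, rule_format, OF that])
qed

lemma riemannian_metricD:
  assumes "riemannian_metric A g" "v \<in> tangent_space A p"
  shows "linear_form_at A p (g p v)"
    and "w \<in> tangent_space A p \<Longrightarrow> g p v w = g p w v"
    and "v \<noteq> 0 \<Longrightarrow> 0 < g p v v"
  using assms unfolding riemannian_metric_def by auto

lemma almost_contact_metricD:
  assumes "almost_contact_metric A \<phi> \<xi> \<eta> g"
  shows "endo_field A \<phi>" "vector_field A \<xi>" "one_form A \<eta>" "riemannian_metric A g"
    and "\<eta> p (\<xi> p) = 1"
    and "v \<in> tangent_space A p \<Longrightarrow> \<phi> p (\<phi> p v) = - v + \<eta> p v *\<^sub>T \<xi> p"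
    and "v \<in> tangent_space A p \<Longrightarrow> w \<in> tangent_space A p \<Longrightarrow>
      g p (\<phi> p v) (\<phi> p w) = g p v w - \<eta> p v * \<eta> p w"
  using assms unfolding almost_contact_metric_def by auto

context smooth_manifold
begin

declare vf_add [simp] vf_diff [simp] vf_minus [simp] vf_fmul [simp] vf_bracket [simp]
  tangent_add [simp] tangent_sub [simp] tangent_minus [simp] tangent_scale [simp]

end

locale riemannian_manifold = smooth_manifold A
  for A :: "('a::t2_space, 'e::euclidean_space) atlas" +
  fixes g :: "'a \<Rightarrow> 'a tvec \<Rightarrow> 'a tvec \<Rightarrow> real"
  assumes metric: "riemannian_metric A g"
begin

lemma g_sym: "v \<in> T p \<Longrightarrow> w \<in> T p \<Longrightarrow> g p v w = g p w v"
  by (rule riemannian_metricD(2)[OF metric])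

lemma g_add_right [simp]: "u \<in> T p \<Longrightarrow> v \<in> T p \<Longrightarrow> w \<in> T p \<Longrightarrow> g p u (v + w) = g p u v + g p u w"
  and g_scale_right [simp]: "u \<in> T p \<Longrightarrow> v \<in> T p \<Longrightarrow> g p u (a *\<^sub>T v) = a * g p u v"
  using linear_form_atD[OF riemannian_metricD(1)[OF metric]] by auto

lemma g_add_left [simp]: "u \<in> T p \<Longrightarrow> v \<in> T p \<Longrightarrow> w \<in> T p \<Longrightarrow> g p (v + w) u = g p v u + g p w u"
  by (simp add: g_sym[of _ p u])

lemma g_scale_left [simp]: "u \<in> T p \<Longrightarrow> v \<in> T p \<Longrightarrow> g p (a *\<^sub>T v) u = a * g p v u"
  by (simp add: g_sym[of _ p u])

lemma g_minus_right [simp]: "u \<in> T p \<Longrightarrow> v \<in> T p \<Longrightarrow> g p u (- v) = - g p u v"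
  using g_scale_right[of u p v "-1"] by (simp add: tscale_minus_left)

lemma g_minus_left [simp]: "u \<in> T p \<Longrightarrow> v \<in> T p \<Longrightarrow> g p (- v) u = - g p v u"
  by (simp add: g_sym[of _ p u])

lemma g_diff_right [simp]: "u \<in> T p \<Longrightarrow> v \<in> T p \<Longrightarrow> w \<in> T p \<Longrightarrow> g p u (v - w) = g p u v - g p u w"
  using g_add_right[of u p v "- w"] by simp

lemma g_diff_left [simp]: "u \<in> T p \<Longrightarrow> v \<in> T p \<Longrightarrow> w \<in> T p \<Longrightarrow> g p (v - w) u = g p v u - g p w u"
  by (simp add: g_sym[of _ p u])

lemma g_zero [simp]: "u \<in> T p \<Longrightarrow> g p u 0 = 0" "u \<in> T p \<Longrightarrow> g p 0 u = 0"
  using g_scale_right[of u p 0 0] g_scale_left[of u p 0 0] by simp_all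

lemma g_pos: "v \<in> T p \<Longrightarrow> v \<noteq> 0 \<Longrightarrow> 0 < g p v v"
  by (rule riemannian_metricD(3)[OF metric])

lemma g_eq_zero: "v \<in> T p \<Longrightarrow> g p v v = 0 \<longleftrightarrow> v = 0"
  using g_pos[of v p] by fastforce

lemma g_smooth [simp]: "VF X \<Longrightarrow> VF Y \<Longrightarrow> sm (\<lambda>q. g q (X q) (Y q))"
  using metric unfolding riemannian_metric_def by blast

lemma nondegenerate:
  assumes "v \<in> T p" "w \<in> T p" "\<And>Z. VF Z \<Longrightarrow> g p v (Z p) = g p w (Z p)"
  shows "v = w"
proof -
  obtain Z where Z: "VF Z" "Z p = v - w"
    using vf_extend[OF tangent_sub[OF assms(1,2)]] .
  have "g p (v - w) (v - w) = g p v (Z p) - g p w (Z p)"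
    using assms(1,2) Z(2) by simp
  also have "\<dots> = 0" using assms(3)[OF Z(1)] by simp
  finally have "v - w = 0"
    by (simp only: g_eq_zero[OF tangent_sub[OF assms(1,2)]])
  then show ?thesis by simp
qed

text \<open>Takes the place of a dimension theory of the tangent space: coordinates in a local frame
  embed S into the Euclidean model, where a linear dependence, paired with some w in S whose
  coefficient is nonzero, would force g p w w = 0.\<close>

lemma orthogonal_card_le:
  assumes S: "finite S" "S \<subseteq> T p" "0 \<notin> S" "\<And>v w. v \<in> S \<Longrightarrow> w \<in> S \<Longrightarrow> v \<noteq> w \<Longrightarrow> g p v w = 0"
  shows "card S \<le> DIM('e)"
proof -
  obtain N x E where "local_frame p N x E" using local_frame_exists .
  note F = local_frameD[OF this]
  define c where "c v = (\<Sum>b\<in>Basis. v (x b) *\<^sub>R b)" for v :: "'a tvec"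
  have cb: "c v \<bullet> b = v (x b)" if "b \<in> Basis" for v b
    using that by (simp add: c_def inner_sum_left inner_Basis if_distrib[of "\<lambda>a. _ * a"] cong: if_cong)
  have inj: "inj_on c S"
  proof (rule inj_onI)
    fix v w assume vw: "v \<in> S" "w \<in> S" "c v = c w"
    then have coords: "v (x b) = w (x b)" if "b \<in> Basis" for b using cb[OF that] by metis
    show "v = w"
    proof (rule tangent_eqI)
      show T: "v \<in> T p" "w \<in> T p" using vw S(2) by blast+
      fix f assume f: "sm f"
      have "v f = (\<Sum>b\<in>Basis. v (x b) * E b p f)" by (rule F(6)[OF F(2) T(1) f])
      also have "\<dots> = (\<Sum>b\<in>Basis. w (x b) * E b p f)" by (rule sum.cong) (simp_all add: coords)
      also have "\<dots> = w f" by (rule F(6)[OF F(2) T(2) f, symmetric])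
      finally show "v f = w f" .
    qed
  qed
  have "independent (c ` S)"
  proof (rule ccontr)
    assume "\<not> independent (c ` S)"
    then obtain u where u: "\<exists>y\<in>c ` S. u y \<noteq> 0" "(\<Sum>y\<in>c ` S. u y *\<^sub>R y) = 0"
      using S(1) by (auto simp: dependent_finite)
    have 0: "(\<Sum>v\<in>S. u (c v) *\<^sub>R c v) = 0"
      using u(2) by (simp add: sum.reindex[OF inj])
    have "(\<Sum>v\<in>S. u (c v) * v f) = 0" if f: "sm f" for f
    proof -
      have "(\<Sum>v\<in>S. u (c v) * v (x b)) = 0" if "b \<in> Basis" for b
        using arg_cong[OF 0, of "\<lambda>y. y \<bullet> b"] cb[OF that] by (simp add: inner_sum_left)
      moreover have "(\<Sum>v\<in>S. u (c v) * v f) = (\<Sum>v\<in>S. \<Sum>b\<in>Basis. u (c v) * v (x b) * E b p f)"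
      proof (rule sum.cong)
        fix v assume "v \<in> S"
        then show "u (c v) * v f = (\<Sum>b\<in>Basis. u (c v) * v (x b) * E b p f)"
          by (subst F(6)[OF F(2) subsetD[OF S(2)] f]) (simp_all add: sum_distrib_left mult.assoc)
      qed simp
      moreover have "\<dots> = (\<Sum>b\<in>Basis. (\<Sum>v\<in>S. u (c v) * v (x b)) * E b p f)"
        by (subst sum.swap) (simp add: sum_distrib_right)
      ultimately show ?thesis by simp
    qed
    moreover have "(\<Sum>v\<in>S. u (c v) * v f) = 0" if "\<not> sm f" for f
      using S(2) tangentD(4) that by (intro sum.neutral) force
    ultimately have zero: "(\<lambda>f. \<Sum>v\<in>S. u (c v) * v f) = 0" by (auto simp: fun_eq_iff)
    have lin: "(\<lambda>f. \<Sum>v\<in>S'. k v * v f) \<in> T p \<and> g p (\<lambda>f. \<Sum>v\<in>S'. k v * v f) w = (\<Sum>v\<in>S'. k v * g p v w)"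
      if "finite S'" "S' \<subseteq> T p" "w \<in> T p" for S' k w
      using that(1,2)
    proof (induction S' rule: finite_induct)
      case empty
      have "(\<lambda>f. 0) = (0 :: 'a tvec)" by (simp add: fun_eq_iff)
      then show ?case using that(3) by simp
    next
      case (insert v S')
      have "(\<lambda>f. \<Sum>v\<in>insert v S'. k v * v f) = k v *\<^sub>T v + (\<lambda>f. \<Sum>v\<in>S'. k v * v f)"
        using insert(1,2) by (simp add: fun_eq_iff tscale_def)
      then show ?case using insert that(3) by auto
    qed
    obtain w where w: "w \<in> S" "u (c w) \<noteq> 0" using u(1) by blast
    have "0 = (\<Sum>v\<in>S. u (c v) * g p v w)"
      using lin[OF S(1,2), of w "\<lambda>v. u (c v)"] w S(2) zero by auto
    also have "\<dots> = (\<Sum>v\<in>S. if v = w then u (c w) * g p w w else 0)"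
      using S(4) w by (intro sum.cong) auto
    also have "\<dots> = u (c w) * g p w w" using S(1) w by simp
    finally show False using w S(2,3) g_eq_zero[of w p] by auto
  qed
  then show ?thesis
    using independent_bound[of "c ` S"] by (simp add: card_image[OF inj])
qed

end

locale levi_civita_manifold = riemannian_manifold A g
  for A :: "('a::t2_space, 'e::euclidean_space) atlas" and g +
  fixes D :: "('a \<Rightarrow> 'a tvec) \<Rightarrow> ('a \<Rightarrow> 'a tvec) \<Rightarrow> 'a \<Rightarrow> 'a tvec"
  assumes lc: "levi_civita A g D"
begin

lemma D_vf [simp]: "VF X \<Longrightarrow> VF Y \<Longrightarrow> VF (D X Y)"
  and D_add_left: "VF X \<Longrightarrow> VF Y \<Longrightarrow> VF Z \<Longrightarrow> D (X + Y) Z = D X Z + D Y Z"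
  and D_add_right: "VF X \<Longrightarrow> VF Y \<Longrightarrow> VF Z \<Longrightarrow> D X (Y + Z) = D X Y + D X Z"
  using affine_connectionD(1-3)[OF levi_civitaD(1)[OF lc]] by auto

lemma D_fmul_left: "VF X \<Longrightarrow> VF Y \<Longrightarrow> sm f \<Longrightarrow> D (fmul f X) Y = fmul f (D X Y)"
  and D_fmul_right: "VF X \<Longrightarrow> VF Y \<Longrightarrow> sm f \<Longrightarrow> D X (fmul f Y) p = X p f *\<^sub>T Y p + f p *\<^sub>T D X Y p"
  by (rule affine_connectionD(4,5)[OF levi_civitaD(1)[OF lc]]; assumption)+

lemma torsion: "VF X \<Longrightarrow> VF Y \<Longrightarrow> lie_bracket X Y p = D X Y p - D Y X p"
  using fun_cong[OF levi_civitaD(2)[OF lc, of X Y], of p] by simp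

lemmas metric_compatible = levi_civitaD(3)[OF lc]

definition cov :: "('a \<Rightarrow> 'a tvec \<Rightarrow> 'a tvec) \<Rightarrow> ('a \<Rightarrow> 'a tvec) \<Rightarrow> ('a \<Rightarrow> 'a tvec) \<Rightarrow> 'a \<Rightarrow> 'a tvec" where
  "cov \<phi> X Y p = D X (app \<phi> Y) p - \<phi> p (D X Y p)"

lemma cov_deriv_endo: "cov_deriv_endo D \<phi> X Y p = cov \<phi> X Y p"
  by (simp add: cov_deriv_endo_def cov_def app_def)

lemma cov_tangent [simp]:
  assumes "endo_field A \<phi>" "VF X" "VF Y"
  shows "cov \<phi> X Y p \<in> T p"
  using assms by (simp add: cov_def endo_fieldD)

text \<open>For a torsion-free connection the exterior derivative is the alternation of the
  covariant derivative, and for a metric one the covariant derivative of the form is the form of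
  \<nabla>\<phi>. Both directions of the theorem pass between forms and \<nabla>\<phi> through this
  formula.\<close>

lemma ext_deriv2_skew:
  assumes \<phi>: "endo_field A \<phi>" and skew: "\<And>p v w. v \<in> T p \<Longrightarrow> w \<in> T p \<Longrightarrow> g p (\<phi> p v) w = - g p v (\<phi> p w)"
    and X: "VF X" and Y: "VF Y" and Z: "VF Z"
  shows "ext_deriv2 (fundamental_form \<phi> g) X Y Z p =
    g p (cov \<phi> X Y p) (Z p) + g p (cov \<phi> Y Z p) (X p) + g p (cov \<phi> Z X p) (Y p)"
proof -
  note [simp] = endo_fieldD(1,4)[OF \<phi>] endo_field_minus(2)[OF \<phi>]
  have d: "U p (\<lambda>q. g q (\<phi> q (V q)) (W q)) = g p (D U (app \<phi> V) p) (W p) + g p (\<phi> p (V p)) (D U W p)"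
    if "VF U" "VF V" "VF W" for U V W
    using metric_compatible[of U "app \<phi> V" W p] that by (simp add: app_apply)
  have s: "g p (\<phi> p (D U V p)) (W p) = - g p (\<phi> p (W p)) (D U V p)" if "VF U" "VF V" "VF W" for U V W
    using that by (simp add: skew g_sym[of "D U V p" p])
  have s2: "g p (D U (app \<phi> V) p) (W p) = - g p (\<phi> p (V p)) (D U W p) + U p (\<lambda>q. g q (\<phi> q (V q)) (W q))"
    if "VF U" "VF V" "VF W" for U V W
    using d[OF that] by simp
  have s3: "U p (\<lambda>q. g q (\<phi> q (V q)) (W q)) = - U p (\<lambda>q. g q (\<phi> q (W q)) (V q))"
    if "VF U" "VF V" "VF W" for U V W
  proof -
    have "(\<lambda>q. g q (\<phi> q (V q)) (W q)) = (\<lambda>q. - g q (app \<phi> W q) (V q))"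
      using that by (simp add: fun_eq_iff app_apply skew g_sym[of "V _"])
    then show ?thesis
      using tangent_uminus[OF vfT[OF that(1), of p] g_smooth[of "app \<phi> W" V]] that by (simp add: app_apply)
  qed
  show ?thesis
    using X Y Z by (simp add: ext_deriv2_def fundamental_form_def cov_def torsion s s2 s3[of Y X Z])
qed

end

locale contact_manifold = smooth_manifold A
  for A :: "('a::t2_space, 'e::euclidean_space) atlas" +
  fixes \<phi> :: "'a \<Rightarrow> 'a tvec \<Rightarrow> 'a tvec" and \<xi> :: "'a \<Rightarrow> 'a tvec"
    and \<eta> :: "'a \<Rightarrow> 'a tvec \<Rightarrow> real" and g :: "'a \<Rightarrow> 'a tvec \<Rightarrow> 'a tvec \<Rightarrow> real"
  assumes acm: "almost_contact_metric A \<phi> \<xi> \<eta> g"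
begin

lemma endo: "endo_field A \<phi>" and xi_vf [simp]: "VF \<xi>"
  and phi_phi: "v \<in> T p \<Longrightarrow> \<phi> p (\<phi> p v) = - v + \<eta> p v *\<^sub>T \<xi> p"
  and eta_xi [simp]: "\<eta> p (\<xi> p) = 1"
  and g_phi_phi: "v \<in> T p \<Longrightarrow> w \<in> T p \<Longrightarrow> g p (\<phi> p v) (\<phi> p w) = g p v w - \<eta> p v * \<eta> p w"
  and eta_add [simp]: "v \<in> T p \<Longrightarrow> w \<in> T p \<Longrightarrow> \<eta> p (v + w) = \<eta> p v + \<eta> p w"
  and eta_scale [simp]: "v \<in> T p \<Longrightarrow> \<eta> p (a *\<^sub>T v) = a * \<eta> p v"
  and eta_smooth [simp]: "VF X \<Longrightarrow> sm (\<lambda>q. \<eta> q (X q))"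
proof -
  note * = almost_contact_metricD[OF acm]
  show "endo_field A \<phi>" "VF \<xi>" "\<eta> p (\<xi> p) = 1" by (rule *)+
  show "v \<in> T p \<Longrightarrow> \<phi> p (\<phi> p v) = - v + \<eta> p v *\<^sub>T \<xi> p" by (rule *)
  show "v \<in> T p \<Longrightarrow> w \<in> T p \<Longrightarrow> g p (\<phi> p v) (\<phi> p w) = g p v w - \<eta> p v * \<eta> p w" by (rule *)
  have l: "linear_form_at A p (\<eta> p)" and s: "VF X \<Longrightarrow> sm (\<lambda>q. \<eta> q (X q))"
    using *(3) unfolding one_form_def by blast+
  show "v \<in> T p \<Longrightarrow> w \<in> T p \<Longrightarrow> \<eta> p (v + w) = \<eta> p v + \<eta> p w"
    "v \<in> T p \<Longrightarrow> \<eta> p (a *\<^sub>T v) = a * \<eta> p v"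
    using linear_form_atD[OF l] by auto
  show "VF X \<Longrightarrow> sm (\<lambda>q. \<eta> q (X q))" by (rule s)
qed

lemma riemannian: "riemannian_metric A g"
  by (rule almost_contact_metricD[OF acm])

sublocale riemannian_manifold A g
  by unfold_locales (rule riemannian)

lemma phi_T [simp]: "v \<in> T p \<Longrightarrow> \<phi> p v \<in> T p"
  and phi_add [simp]: "v \<in> T p \<Longrightarrow> w \<in> T p \<Longrightarrow> \<phi> p (v + w) = \<phi> p v + \<phi> p w"
  and phi_scale [simp]: "v \<in> T p \<Longrightarrow> \<phi> p (a *\<^sub>T v) = a *\<^sub>T \<phi> p v"
  and phi_vf [simp]: "VF X \<Longrightarrow> VF (app \<phi> X)"
  using endo_fieldD[OF endo] by blast+

lemma phi_minus [simp]: "v \<in> T p \<Longrightarrow> \<phi> p (- v) = - \<phi> p v"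
  and phi_diff [simp]: "v \<in> T p \<Longrightarrow> w \<in> T p \<Longrightarrow> \<phi> p (v - w) = \<phi> p v - \<phi> p w"
  and phi_zero [simp]: "\<phi> p 0 = 0"
  using endo_field_minus[OF endo] tangent_zero by blast+

lemma eta_minus [simp]: "v \<in> T p \<Longrightarrow> \<eta> p (- v) = - \<eta> p v"
  using eta_scale[of v p "-1"] by (simp add: tscale_minus_left)

lemma eta_diff [simp]: "v \<in> T p \<Longrightarrow> w \<in> T p \<Longrightarrow> \<eta> p (v - w) = \<eta> p v - \<eta> p w"
  using eta_add[of v p "- w"] by simp

lemma eta_zero [simp]: "\<eta> p 0 = 0"
  using eta_scale[of 0 p 0] by simp

lemma xi_nonzero [simp]: "\<xi> p \<noteq> 0"
  using eta_xi[of p] eta_zero[of p] by (metis zero_neq_one)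

lemma tscale_xi: "a *\<^sub>T \<xi> p = 0 \<longleftrightarrow> a = 0"
proof
  assume "a *\<^sub>T \<xi> p = 0"
  then have "\<eta> p (a *\<^sub>T \<xi> p) = 0" by simp
  then show "a = 0" by simp
qed simp

text \<open>\<phi>^2 \<xi> = 0 implies \<phi>^3 \<xi> = 0, so \<phi> \<xi> is a multiple a \<xi>;
  then \<phi>^2 \<xi> = a^2 \<xi> gives a = 0.\<close>

lemma phi_xi [simp]: "\<phi> p (\<xi> p) = 0"
proof -
  let ?v = "\<phi> p (\<xi> p)"
  have 1: "\<phi> p ?v = 0" using phi_phi[of "\<xi> p" p] by simp
  have 2: "?v = \<eta> p ?v *\<^sub>T \<xi> p"
    using phi_phi[of ?v p] 1 by (simp add: eq_neg_iff_add_eq_0 add_eq_0_iff)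
  have "\<phi> p ?v = \<eta> p ?v *\<^sub>T ?v"
    by (subst 2) simp
  also have "\<dots> = (\<eta> p ?v * \<eta> p ?v) *\<^sub>T \<xi> p"
    by (subst (2) 2) (simp add: tscale_tscale)
  finally have "\<eta> p ?v = 0" using 1 by (simp add: tscale_xi)
  then show ?thesis using 2 by simp
qed

lemma eta_phi [simp]:
  assumes "v \<in> T p"
  shows "\<eta> p (\<phi> p v) = 0"
proof -
  have "\<phi> p (\<phi> p (\<phi> p v)) = - \<phi> p v"
    using assms phi_phi[OF assms] by simp
  then show ?thesis
    using phi_phi[of "\<phi> p v" p] assms by (simp add: tscale_xi)
qed

lemma g_xi [simp]: "v \<in> T p \<Longrightarrow> g p v (\<xi> p) = \<eta> p v" "v \<in> T p \<Longrightarrow> g p (\<xi> p) v = \<eta> p v"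
  using g_phi_phi[of v p "\<xi> p"] g_sym[of v p "\<xi> p"] by auto

lemma phi_skew: "v \<in> T p \<Longrightarrow> w \<in> T p \<Longrightarrow> g p (\<phi> p v) w = - g p v (\<phi> p w)"
  using g_phi_phi[of "\<phi> p v" p w] by (simp add: phi_phi)

lemma g_phi_self [simp]: "v \<in> T p \<Longrightarrow> g p (\<phi> p v) v = 0" "v \<in> T p \<Longrightarrow> g p v (\<phi> p v) = 0"
  using phi_skew[of v p v] g_sym[of v p "\<phi> p v"] by auto

lemma phi_eq_zero: "v \<in> T p \<Longrightarrow> \<eta> p v = 0 \<Longrightarrow> \<phi> p v = 0 \<longleftrightarrow> v = 0"
  using phi_phi[of v p] by (auto dest: arg_cong[of _ _ "\<phi> p"])

text \<open>Otherwise \<xi>, u, \<phi> u, v, \<phi> v, w would be six nonzero, pairwise orthogonal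
  vectors. The upper bound on the dimension acts through this lemma.\<close>

lemma orthogonal_frame_spans:
  assumes dim: "DIM('e) \<le> 5"
    and T: "u \<in> T p" "v \<in> T p" "w \<in> T p"
    and hor: "\<eta> p u = 0" "\<eta> p v = 0" "\<eta> p w = 0"
    and nz: "u \<noteq> 0" "v \<noteq> 0"
    and orth: "g p v u = 0" "g p v (\<phi> p u) = 0"
      "g p w u = 0" "g p w (\<phi> p u) = 0" "g p w v = 0" "g p w (\<phi> p v) = 0"
  shows "w = 0"
proof (rule ccontr)
  assume w: "w \<noteq> 0"
  have nz': "\<phi> p u \<noteq> 0" "\<phi> p v \<noteq> 0"
    using phi_eq_zero T hor nz by auto
  \<comment> \<open>A list rather than a set, so that distinctness can be derived: orthogonal
    nonzero vectors cannot coincide.\<close>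
  define L where "L = [\<xi> p, u, \<phi> p u, v, \<phi> p v, w]"
  have LT: "set L \<subseteq> T p" and L0: "0 \<notin> set L"
    using T nz nz' w xi_nonzero[of p] by (auto simp: L_def dest: sym simp del: xi_nonzero)
  have c: "g p u v = 0" "g p (\<phi> p u) v = 0" "g p u (\<phi> p v) = 0" "g p (\<phi> p v) u = 0"
    "g p u w = 0" "g p (\<phi> p u) w = 0" "g p v w = 0" "g p (\<phi> p v) w = 0"
    "g p (\<phi> p u) (\<phi> p v) = 0" "g p (\<phi> p v) (\<phi> p u) = 0"
    using orth T hor g_sym[of v p u] g_sym[of v p "\<phi> p u"] g_sym[of w p] phi_skew[of u p v] g_sym[of u p "\<phi> p v"]
    by (auto simp: g_phi_phi)
  have orthL: "sorted_wrt (\<lambda>a b. g p a b = 0 \<and> g p b a = 0) L"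
    unfolding L_def using T hor orth c by simp
  have "g p (L ! i) (L ! j) = 0" if "i < length L" "j < length L" "i \<noteq> j" for i j
    using orthL that unfolding sorted_wrt_iff_nth_less by (metis linorder_neqE_nat)
  note orth_nth = this
  have orth_set: "g p a b = 0" if "a \<in> set L" "b \<in> set L" "a \<noteq> b" for a b
    using that orth_nth unfolding in_set_conv_nth by metis
  have "distinct L"
    unfolding distinct_conv_nth
  proof (intro allI impI)
    fix i j assume ij: "i < length L" "j < length L" "i \<noteq> j"
    have mem: "L ! i \<in> set L" using ij(1) by (rule nth_mem)
    then have "L ! i \<in> T p" using LT by (rule subsetD[rotated])
    moreover have "L ! i \<noteq> 0" using mem L0 by metis
    ultimately show "L ! i \<noteq> L ! j" using orth_nth[OF ij] g_eq_zero[of "L ! i" p] by auto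
  qed
  then have "card (set L) = 6" by (simp add: distinct_card L_def)
  moreover have "card (set L) \<le> DIM('e)"
    by (rule orthogonal_card_le[OF _ LT L0 orth_set]) simp
  ultimately show False using dim by simp
qed

definition hor :: "('a \<Rightarrow> 'a tvec) \<Rightarrow> 'a \<Rightarrow> 'a tvec" where
  "hor X = X - fmul (\<lambda>q. \<eta> q (X q)) \<xi>"

lemma hor_vf [simp]: "VF X \<Longrightarrow> VF (hor X)"
  by (simp add: hor_def)

lemma hor_apply: "hor X p = X p - \<eta> p (X p) *\<^sub>T \<xi> p"
  by (simp add: hor_def fmul_apply)

lemma eta_hor [simp]: "VF X \<Longrightarrow> \<eta> p (hor X p) = 0"
  by (simp add: hor_apply)

lemma hor_split: "X = hor X + fmul (\<lambda>q. \<eta> q (X q)) \<xi>"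
  by (simp add: hor_def)

text \<open>The horizontal parts of two coordinate fields cannot both vanish at p, since two members
  of a frame are not both multiples of \<xi>. The field is horizontal at every point because
  identities such as |h X|^2 = \<lambda>^2 |X|^2 will be differentiated.\<close>

lemma horizontal_exists:
  assumes dim: "2 \<le> DIM('e)"
  obtains X where "VF X" "X p \<noteq> 0" "\<And>q. \<eta> q (X q) = 0"
proof -
  obtain N x E where "local_frame p N x E" using local_frame_exists .
  note F = local_frameD[OF this]
  obtain b b' :: 'e where b: "b \<in> Basis" "b' \<in> Basis" "b \<noteq> b'"
    using dim by (metis card_le_Suc0_iff_eq finite_Basis not_less_eq_eq numeral_2_eq_2)
  have "hor (E b) p \<noteq> 0 \<or> hor (E b') p \<noteq> 0"
  proof (rule ccontr)
    assume "\<not> ?thesis"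
    then have "E b p = \<eta> p (E b p) *\<^sub>T \<xi> p" "E b' p = \<eta> p (E b' p) *\<^sub>T \<xi> p"
      by (auto simp: hor_apply)
    then have E: "E b p f = \<eta> p (E b p) * \<xi> p f" "E b' p f = \<eta> p (E b' p) * \<xi> p f" for f
      by (metis tscale_def)+
    have "\<eta> p (E b p) * \<xi> p (x b) = 1" "\<eta> p (E b p) * \<xi> p (x b') = 0" "\<eta> p (E b' p) * \<xi> p (x b') = 1"
      using F(5)[OF F(2), of b b] F(5)[OF F(2), of b b'] F(5)[OF F(2), of b' b'] b E by auto
    then show False by auto
  qed
  then show ?thesis using that[of "hor (E b)"] that[of "hor (E b')"] F(4) by auto
qed

end

subsection \<open>Invariant differential forms\<close>

abbreviation br where "br \<equiv> lie_bracket"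

text \<open>Forms are treated as operators from vector fields to functions. Exterior derivatives,
  Lie derivatives and multiples by functions are then again such operators, and Cartan's calculus
  becomes a calculus of brackets.\<close>

definition d1 :: "(('a \<Rightarrow> 'a tvec) \<Rightarrow> 'a \<Rightarrow> real) \<Rightarrow> ('a \<Rightarrow> 'a tvec) \<Rightarrow> ('a \<Rightarrow> 'a tvec) \<Rightarrow> 'a \<Rightarrow> real" where
  "d1 N X Y = (\<lambda>p. X p (N Y) - Y p (N X) - N (br X Y) p)"

definition d2 :: "(('a \<Rightarrow> 'a tvec) \<Rightarrow> ('a \<Rightarrow> 'a tvec) \<Rightarrow> 'a \<Rightarrow> real) \<Rightarrow>
    ('a \<Rightarrow> 'a tvec) \<Rightarrow> ('a \<Rightarrow> 'a tvec) \<Rightarrow> ('a \<Rightarrow> 'a tvec) \<Rightarrow> 'a \<Rightarrow> real" where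
  "d2 W X Y Z = (\<lambda>p. X p (W Y Z) - Y p (W X Z) + Z p (W X Y)
     - W (br X Y) Z p + W (br X Z) Y p - W (br Y Z) X p)"

definition lie2 :: "('a \<Rightarrow> 'a tvec) \<Rightarrow> (('a \<Rightarrow> 'a tvec) \<Rightarrow> ('a \<Rightarrow> 'a tvec) \<Rightarrow> 'a \<Rightarrow> real) \<Rightarrow>
    ('a \<Rightarrow> 'a tvec) \<Rightarrow> ('a \<Rightarrow> 'a tvec) \<Rightarrow> 'a \<Rightarrow> real" where
  "lie2 U W X Y = (\<lambda>p. U p (W X Y) - W (br U X) Y p - W X (br U Y) p)"

definition wedge :: "(('a \<Rightarrow> 'a tvec) \<Rightarrow> 'a \<Rightarrow> real) \<Rightarrow> (('a \<Rightarrow> 'a tvec) \<Rightarrow> ('a \<Rightarrow> 'a tvec) \<Rightarrow> 'a \<Rightarrow> real) \<Rightarrow>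
    ('a \<Rightarrow> 'a tvec) \<Rightarrow> ('a \<Rightarrow> 'a tvec) \<Rightarrow> ('a \<Rightarrow> 'a tvec) \<Rightarrow> 'a \<Rightarrow> real" where
  "wedge N W X Y Z = (\<lambda>p. N X p * W Y Z p + N Y p * W Z X p + N Z p * W X Y p)"

lemma ext_deriv1_eq: "ext_deriv1 \<eta> = d1 (\<lambda>X q. \<eta> q (X q))"
  by (simp add: fun_eq_iff ext_deriv1_def d1_def)

lemma ext_deriv2_eq: "ext_deriv2 \<omega> = d2 (\<lambda>X Y q. \<omega> q (X q) (Y q))"
  by (simp add: fun_eq_iff ext_deriv2_def d2_def)

lemma bracket_swap: "br Y X = - br X Y"
  by (simp add: fun_eq_iff lie_bracket_def)

section \<open>Cartan calculus on vector fields\<close>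

context smooth_manifold
begin

lemma smooth_fun_imp_continuous_on:
  assumes "sm f"
  shows "continuous_on UNIV f"
proof (rule continuous_at_imp_continuous_on, rule ballI)
  fix p
  obtain U c where c: "(U, c) \<in> A" "p \<in> U" using chart_exists .
  have "smooth_on (f \<circ> inv_into U c) (c ` U)"
    using assms c(1) unfolding smooth_fun_def by blast
  then have "continuous_on (c ` U) (f \<circ> inv_into U c)"
    by (rule smooth_on_imp_continuous_on)
  moreover have "continuous_on U c"
    using chart(3)[OF c(1)] by (simp add: homeomorphism_def)
  ultimately have "continuous_on U (f \<circ> inv_into U c \<circ> c)"
    by (rule continuous_on_compose[rotated])
  then have "continuous_on U f"
    using chart(6)[OF c(1)] by (simp cong: continuous_on_cong)
  then show "isCont f p"
    using continuous_on_eq_continuous_at[OF chart(1)[OF c(1)]] c(2) by blast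
qed

lemma open_nonzero: "sm f \<Longrightarrow> open {q. f q \<noteq> 0}"
  using open_Collect_neq[OF smooth_fun_imp_continuous_on, of f "\<lambda>q. 0"] by (simp add: continuous_on_const)

lemma tangent_lin:
  assumes "v \<in> T p" "sm f" "sm h"
  shows "v (\<lambda>q. a * f q + b * h q) = a * v f + b * v h"
  using tangentD(1)[OF assms(1), of "\<lambda>q. a * f q" "\<lambda>q. b * h q"] tangentD(2)[OF assms(1)] assms
  by (simp add: smooth_fun_mult)

lemma tangent_diff3:
  assumes "v \<in> T p" "sm a" "sm b" "sm c"
  shows "v (\<lambda>q. a q - b q - c q) = v a - v b - v c"
  using tangent_diff[OF assms(1), of "\<lambda>q. a q - b q" c] tangent_diff[OF assms(1-3)] assms
  by (simp add: smooth_fun_diff)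

lemma jacobi:
  assumes X: "VF X" and Y: "VF Y" and Z: "VF Z"
  shows "br X (br Y Z) = br (br X Y) Z + br Y (br X Z)"
proof (rule ext)
  fix p
  show "br X (br Y Z) p = (br (br X Y) Z + br Y (br X Z)) p"
  proof (rule tangent_eqI[of _ p])
    fix f assume f: "sm f"
    have s: "U p (\<lambda>q. br V W q f) = U p (\<lambda>q. V q (\<lambda>q. W q f)) - U p (\<lambda>q. W q (\<lambda>q. V q f))"
      if "VF U" "VF V" "VF W" for U V W
      unfolding bracket_apply
      by (rule tangent_diff[OF vfT[OF that(1)] vf_smooth[OF that(2) vf_smooth[OF that(3) f]]
            vf_smooth[OF that(3) vf_smooth[OF that(2) f]]])
    show "br X (br Y Z) p f = (br (br X Y) Z + br Y (br X Z)) p f"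
      by (simp add: s X Y Z bracket_apply[of _ "br _ _"] bracket_apply[of "br _ _"] bracket_apply[of _ _ p "\<lambda>q. _ q f"])
  qed (use X Y Z in simp_all)
qed

text \<open>d d = 0: the second derivatives combine to brackets, and what remains is the Jacobi
  identity under N. Applied to \<eta> it makes F - \<Phi>, and in the converse \<omega>3,
  closed.\<close>

lemma d1_d1:
  assumes add: "\<And>X Y p. VF X \<Longrightarrow> VF Y \<Longrightarrow> N (X + Y) p = N X p + N Y p"
    and smN: "\<And>X. VF X \<Longrightarrow> sm (N X)"
    and X: "VF X" and Y: "VF Y" and Z: "VF Z"
  shows "d2 (d1 N) X Y Z p = 0"
proof -
  have s: "U p (d1 N V W) = U p (\<lambda>q. V q (N W)) - U p (\<lambda>q. W q (N V)) - U p (N (br V W))"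
    if "VF U" "VF V" "VF W" for U V W
    unfolding d1_def using that
    by (intro tangent_diff3[OF vfT[OF that(1)]] vf_smooth[OF _ smN] smN) simp_all
  have "N (br X (br Y Z)) p = N (br (br X Y) Z) p + N (br Y (br X Z)) p"
    by (simp add: jacobi[OF X Y Z] add X Y Z)
  moreover have neg: "N (- U) p = - N U p" if "VF U" for U
    using add[of U "- U" p] add[of 0 0 p] that by simp
  have "N (br X (br Y Z)) p = - N (br (br Y Z) X) p" "N (br Y (br X Z)) p = - N (br (br X Z) Y) p"
    using neg[of "br (br Y Z) X"] neg[of "br (br X Z) Y"] X Y Z
      bracket_swap[of X "br Y Z"] bracket_swap[of Y "br X Z"] by simp_all
  ultimately show ?thesis
    by (simp add: d2_def s X Y Z d1_def[of _ "br _ _"] bracket_apply)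
qed

lemma d2_linear:
  assumes "\<And>X Y. VF X \<Longrightarrow> VF Y \<Longrightarrow> sm (W X Y)" "\<And>X Y. VF X \<Longrightarrow> VF Y \<Longrightarrow> sm (V X Y)"
    and "VF X" "VF Y" "VF Z"
  shows "d2 (\<lambda>X Y q. a * W X Y q + b * V X Y q) X Y Z p = a * d2 W X Y Z p + b * d2 V X Y Z p"
  using assms(3-5) by (simp add: d2_def tangent_lin[OF vfT assms(1,2)] algebra_simps)

lemma d2_cong:
  assumes "\<And>X Y. VF X \<Longrightarrow> VF Y \<Longrightarrow> W X Y = V X Y" "VF X" "VF Y" "VF Z"
  shows "d2 W X Y Z p = d2 V X Y Z p"
  using assms by (simp add: d2_def)

text \<open>The Lie derivative commutes with d; the right-hand side is the Lie derivative of the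
  3-form dW written out.\<close>

lemma d2_lie2:
  assumes addl: "\<And>X Y Z p. VF X \<Longrightarrow> VF Y \<Longrightarrow> VF Z \<Longrightarrow> W (X + Y) Z p = W X Z p + W Y Z p"
    and addr: "\<And>X Y Z p. VF X \<Longrightarrow> VF Y \<Longrightarrow> VF Z \<Longrightarrow> W X (Y + Z) p = W X Y p + W X Z p"
    and smW: "\<And>X Y. VF X \<Longrightarrow> VF Y \<Longrightarrow> sm (W X Y)"
    and U: "VF U" and X: "VF X" and Y: "VF Y" and Z: "VF Z"
  shows "d2 (lie2 U W) X Y Z p =
    U p (d2 W X Y Z) - d2 W (br U X) Y Z p - d2 W X (br U Y) Z p - d2 W X Y (br U Z) p"
proof -
  have s: "P p (lie2 U W Q R) = P p (\<lambda>q. U q (W Q R)) - P p (W (br U Q) R) - P p (W Q (br U R))"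
    if "VF P" "VF Q" "VF R" for P Q R
    unfolding lie2_def using that U
    by (intro tangent_diff3[OF vfT[OF that(1)]] vf_smooth[OF _ smW] smW) simp_all
  have s2: "U p (d2 W X Y Z) = U p (\<lambda>q. X q (W Y Z)) - U p (\<lambda>q. Y q (W X Z)) + U p (\<lambda>q. Z q (W X Y))
     - U p (W (br X Y) Z) + U p (W (br X Z) Y) - U p (W (br Y Z) X)"
  proof -
    note sm = vf_smooth[OF X smW[OF Y Z]] vf_smooth[OF Y smW[OF X Z]] vf_smooth[OF Z smW[OF X Y]]
      smW[OF vf_bracket[OF X Y] Z] smW[OF vf_bracket[OF X Z] Y] smW[OF vf_bracket[OF Y Z] X]
    note t = tangentD(1)[OF vfT[OF U]] tangent_diff[OF vfT[OF U]]
    show ?thesis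
      unfolding d2_def by (simp add: t sm smooth_fun_add smooth_fun_diff)
  qed
  have j: "W (br U (br P Q)) R p = W (br (br U P) Q) R p + W (br P (br U Q)) R p"
    if "VF P" "VF Q" "VF R" for P Q R
    unfolding jacobi[OF U that(1,2)] by (rule addl) (use that U in simp_all)
  show ?thesis
    unfolding s2 by (simp add: d2_def[of "lie2 U W"] s X Y Z lie2_def[of _ _ "br _ _"] j d2_def[of W] U bracket_apply[of U])
qed

text \<open>The first part is Cartan's formula; the second compares \<open>d\<close> of the first with the Lie derivative of \<open>dW\<close>.\<close>

lemma reeb_invariant_forms:
  assumes addl: "\<And>X Y Z p. VF X \<Longrightarrow> VF Y \<Longrightarrow> VF Z \<Longrightarrow> W (X + Y) Z p = W X Z p + W Y Z p"
    and addr: "\<And>X Y Z p. VF X \<Longrightarrow> VF Y \<Longrightarrow> VF Z \<Longrightarrow> W X (Y + Z) p = W X Y p + W X Z p"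
    and skew: "\<And>X Y p. VF X \<Longrightarrow> VF Y \<Longrightarrow> W Y X p = - W X Y p"
    and smW: "\<And>X Y. VF X \<Longrightarrow> VF Y \<Longrightarrow> sm (W X Y)"
    and smV: "\<And>X Y. VF X \<Longrightarrow> VF Y \<Longrightarrow> sm (V X Y)"
    and smN: "\<And>X. VF X \<Longrightarrow> sm (N X)"
    and U: "VF U" and N1: "\<And>p. N U p = 1"
    and WU: "\<And>X p. VF X \<Longrightarrow> W U X p = 0"
    and VU: "\<And>X p. VF X \<Longrightarrow> V U X p = 0" "\<And>X p. VF X \<Longrightarrow> V X U p = 0"
    and NU: "\<And>X p. VF X \<Longrightarrow> U p (N X) = N (br U X) p"
    and dW: "\<And>X Y Z p. VF X \<Longrightarrow> VF Y \<Longrightarrow> VF Z \<Longrightarrow> d2 W X Y Z p = c * wedge N V X Y Z p"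
  shows "VF X \<Longrightarrow> VF Y \<Longrightarrow> lie2 U W X Y p = c * V X Y p"
    and "c \<noteq> 0 \<Longrightarrow> VF X \<Longrightarrow> VF Y \<Longrightarrow> VF Z \<Longrightarrow> d2 V X Y Z p = wedge N (lie2 U V) X Y Z p"
proof -
  have z: "(W U X) = (\<lambda>q. 0)" if "VF X" for X using WU that by auto
  have lie: "lie2 U W X Y p = c * V X Y p" if X: "VF X" and Y: "VF Y" for X Y p
  proof -
    \<comment> \<open>In Cartan's formula the term with d of the contraction is absent, as the
      contraction of W with U is zero.\<close>
    have "d2 W U X Y p = lie2 U W X Y p"
      using skew[of U "br X Y" p] skew[of "br U Y" X p] X Y U
      by (simp add: d2_def lie2_def z WU tangent_const[OF vfT])
    then show ?thesis
      using dW[OF U X Y, of p] VU X Y by (simp add: wedge_def N1)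
  qed
  then show "VF X \<Longrightarrow> VF Y \<Longrightarrow> lie2 U W X Y p = c * V X Y p" by blast
  assume c: "c \<noteq> 0" and X: "VF X" and Y: "VF Y" and Z: "VF Z"
  have prod: "U p (\<lambda>q. N P q * V Q R q) = N (br U P) p * V Q R p + N P p * U p (V Q R)"
    if "VF P" "VF Q" "VF R" for P Q R
    using tangentD(3)[OF vfT[OF U, of p] smN[OF that(1)] smV[OF that(2,3)]] NU[OF that(1)] by simp
  have "U p (d2 W X Y Z) = c * U p (wedge N V X Y Z)"
  proof -
    have "d2 W X Y Z = (\<lambda>q. c * wedge N V X Y Z q)"
      using dW[OF X Y Z] by auto
    moreover have "sm (wedge N V X Y Z)"
      unfolding wedge_def by (intro smooth_fun_add smooth_fun_mult smN smV X Y Z)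
    ultimately show ?thesis using tangentD(2)[OF vfT[OF U]] by simp
  qed
  also have "U p (wedge N V X Y Z) = U p (\<lambda>q. N X q * V Y Z q) + U p (\<lambda>q. N Y q * V Z X q) + U p (\<lambda>q. N Z q * V X Y q)"
  proof -
    have "sm (\<lambda>q. N P q * V Q R q)" if "VF P" "VF Q" "VF R" for P Q R
      by (intro smooth_fun_mult smN smV that)
    then show ?thesis
      unfolding wedge_def using X Y Z by (simp add: tangentD(1)[OF vfT[OF U]] smooth_fun_add)
  qed
  finally have UdW: "U p (d2 W X Y Z) =
    c * (U p (\<lambda>q. N X q * V Y Z q) + U p (\<lambda>q. N Y q * V Z X q) + U p (\<lambda>q. N Z q * V X Y q))" .
  have "d2 (lie2 U W) X Y Z p =
      U p (d2 W X Y Z) - d2 W (br U X) Y Z p - d2 W X (br U Y) Z p - d2 W X Y (br U Z) p"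
    by (rule d2_lie2[where W = W, OF addl addr smW U X Y Z])
  \<comment> \<open>N is invariant under U, so the Lie derivative of the wedge product falls on V
    alone.\<close>
  then have 1: "d2 (lie2 U W) X Y Z p = c * wedge N (lie2 U V) X Y Z p"
    unfolding UdW prod[OF X Y Z] prod[OF Y Z X] prod[OF Z X Y]
      dW[OF vf_bracket[OF U X] Y Z] dW[OF X vf_bracket[OF U Y] Z] dW[OF X Y vf_bracket[OF U Z]]
    by (simp add: wedge_def lie2_def algebra_simps)
  have "d2 (lie2 U W) X Y Z p = d2 (\<lambda>X Y q. c * V X Y q + 0 * V X Y q) X Y Z p"
    by (rule d2_cong[where W = "lie2 U W" and V = "\<lambda>X Y q. c * V X Y q + 0 * V X Y q"])
      (use lie X Y Z in auto)
  then have "d2 (lie2 U W) X Y Z p = c * d2 V X Y Z p"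
    using d2_linear[where W = V and V = V, OF smV smV X Y Z, of c 0 p] by simp
  then show "d2 V X Y Z p = wedge N (lie2 U V) X Y Z p"
    using 1 c by simp
qed

end

section \<open>Covariant derivatives of endomorphism fields\<close>

context levi_civita_manifold
begin

lemma D_zero_right: "VF X \<Longrightarrow> D X 0 p = 0"
proof -
  assume X: "VF X"
  have "fmul (\<lambda>q. 0) 0 = (0 :: 'a \<Rightarrow> 'a tvec)" by (rule ext) (simp add: fmul_apply)
  then show ?thesis
    using D_fmul_right[OF X vf_zero smooth_fun_const, of 0 p] by simp
qed

lemma D_minus_right: "VF X \<Longrightarrow> VF Y \<Longrightarrow> D X (- Y) p = - D X Y p"
  using D_add_right[of X Y "- Y"] D_zero_right[of X p] by (simp add: add_eq_0_iff fun_eq_iff)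

lemma D_diff_right: "VF X \<Longrightarrow> VF Y \<Longrightarrow> VF Z \<Longrightarrow> D X (Y - Z) p = D X Y p - D X Z p"
  using D_add_right[of X Y "- Z"] D_minus_right[of X Z p] by simp

lemma cov_add:
  assumes \<phi>: "endo_field A \<phi>" and "VF X" "VF Y" "VF Z"
  shows "cov \<phi> (X + Y) Z p = cov \<phi> X Z p + cov \<phi> Y Z p"
    and "cov \<phi> X (Y + Z) p = cov \<phi> X Y p + cov \<phi> X Z p"
proof -
  note e = endo_fieldD[OF \<phi>]
  have "app \<phi> (Y + Z) = app \<phi> Y + app \<phi> Z"
    by (rule ext, rule ext) (use assms in \<open>simp add: app_apply e(2)\<close>)
  then show "cov \<phi> (X + Y) Z p = cov \<phi> X Z p + cov \<phi> Y Z p"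
    "cov \<phi> X (Y + Z) p = cov \<phi> X Y p + cov \<phi> X Z p"
    using assms by (simp_all add: cov_def e D_add_left D_add_right)
qed

lemma cov_fmul:
  assumes \<phi>: "endo_field A \<phi>" and "VF X" "VF Y" "sm f"
  shows "cov \<phi> (fmul f X) Y p = f p *\<^sub>T cov \<phi> X Y p"
    and "cov \<phi> X (fmul f Y) p = f p *\<^sub>T cov \<phi> X Y p"
proof -
  note e = endo_fieldD[OF \<phi>]
  have "app \<phi> (fmul f Y) = fmul f (app \<phi> Y)"
    by (rule ext) (use assms in \<open>simp add: app_apply fmul_apply e(3)\<close>)
  then show "cov \<phi> (fmul f X) Y p = f p *\<^sub>T cov \<phi> X Y p"
    "cov \<phi> X (fmul f Y) p = f p *\<^sub>T cov \<phi> X Y p"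
    using assms by (simp_all add: cov_def e D_fmul_left D_fmul_right fmul_apply tscale_diff app_apply)
qed

lemma cov_tensorial:
  assumes \<phi>: "endo_field A \<phi>" and V: "VF X" "VF X'" "VF Y" "VF Y'" and eq: "X p = X' p" "Y p = Y' p"
  shows "cov \<phi> X Y p = cov \<phi> X' Y' p"
proof -
  have "cov \<phi> X Y p f = cov \<phi> X' Y p f" for f
    by (rule tensorial[where L = "\<lambda>X. cov \<phi> X Y p f"])
      (use V eq in \<open>simp_all add: cov_add[OF \<phi>] cov_fmul[OF \<phi>] tscale_def\<close>)
  moreover have "cov \<phi> X' Y p f = cov \<phi> X' Y' p f" for f
    by (rule tensorial[where L = "\<lambda>Y. cov \<phi> X' Y p f"])
      (use V eq in \<open>simp_all add: cov_add[OF \<phi>] cov_fmul[OF \<phi>] tscale_def\<close>)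
  ultimately show ?thesis by auto
qed

lemma cov_skew:
  assumes \<phi>: "endo_field A \<phi>" and skew: "\<And>p v w. v \<in> T p \<Longrightarrow> w \<in> T p \<Longrightarrow> g p (\<phi> p v) w = - g p v (\<phi> p w)"
    and X: "VF X" and Y: "VF Y" and Z: "VF Z"
  shows "g p (cov \<phi> X Y p) (Z p) = - g p (Y p) (cov \<phi> X Z p)"
proof -
  note [simp] = endo_fieldD(1,4)[OF \<phi>]
  have "(\<lambda>q. g q (app \<phi> Y q) (Z q)) = (\<lambda>q. - g q (Y q) (app \<phi> Z q))"
    using Y Z by (simp add: fun_eq_iff app_apply skew)
  then have "X p (\<lambda>q. g q (app \<phi> Y q) (Z q)) = - X p (\<lambda>q. g q (Y q) (app \<phi> Z q))"
    using tangent_uminus[OF vfT[OF X, of p] g_smooth[of Y "app \<phi> Z"]] Y Z by simp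
  then show ?thesis
    using metric_compatible[of X "app \<phi> Y" Z p] metric_compatible[of X Y "app \<phi> Z" p] X Y Z
    by (simp add: cov_def app_apply skew)
qed

end

locale contact_levi_civita = contact_manifold A \<phi> \<xi> \<eta> g + levi_civita_manifold A g D
  for A :: "('a::t2_space, 'e::euclidean_space) atlas" and \<phi> \<xi> \<eta> g D
begin

lemma eta_D: "VF X \<Longrightarrow> VF Y \<Longrightarrow> X p (\<lambda>q. \<eta> q (Y q)) = \<eta> p (D X Y p) + g p (Y p) (D X \<xi> p)"
  using metric_compatible[of X Y \<xi> p] by simp

text \<open>The field \<xi> has constant length.\<close>

lemma eta_D_xi [simp]: "VF X \<Longrightarrow> \<eta> p (D X \<xi> p) = 0"
  using eta_D[of X \<xi> p] tangent_const[OF vfT[of X], of p 1] by simp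

lemma app_phi_xi: "app \<phi> \<xi> = 0"
  by (rule ext, rule ext) (simp add: app_apply)

lemma cov_xi: "VF X \<Longrightarrow> cov \<phi> X \<xi> p = - \<phi> p (D X \<xi> p)"
  by (simp add: cov_def app_phi_xi D_zero_right)

text \<open>The covariant derivative of the identity \<phi>^2 = -I + \<eta> \<otimes> \<xi>.\<close>

lemma cov_phi:
  assumes X: "VF X" and Y: "VF Y"
  shows "cov \<phi> X (app \<phi> Y) p = - \<phi> p (cov \<phi> X Y p) + g p (Y p) (D X \<xi> p) *\<^sub>T \<xi> p + \<eta> p (Y p) *\<^sub>T D X \<xi> p"
proof -
  have eq: "app \<phi> (app \<phi> Y) = fmul (\<lambda>q. \<eta> q (Y q)) \<xi> - Y"
    by (rule ext, rule ext) (use Y in \<open>simp add: app_apply fmul_apply phi_phi\<close>)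
  have "D X (app \<phi> (app \<phi> Y)) p = X p (\<lambda>q. \<eta> q (Y q)) *\<^sub>T \<xi> p + \<eta> p (Y p) *\<^sub>T D X \<xi> p - D X Y p"
    unfolding eq using X Y by (simp add: D_diff_right D_fmul_right)
  then show ?thesis
    using X Y by (simp add: cov_def phi_phi eta_D tscale_add_left)
qed

lemma g_cov_skew: "VF X \<Longrightarrow> VF Y \<Longrightarrow> VF Z \<Longrightarrow> g p (cov \<phi> X Y p) (Z p) = - g p (Y p) (cov \<phi> X Z p)"
  by (rule cov_skew[OF endo phi_skew])

lemma g_cov_phi:
  assumes X: "VF X" and Y: "VF Y" and Z: "VF Z" and hor: "\<eta> p (Y p) = 0" "\<eta> p (Z p) = 0"
  shows "g p (cov \<phi> X (app \<phi> Y) p) (Z p) = g p (cov \<phi> X Y p) (\<phi> p (Z p))"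
  using assms by (simp add: cov_phi phi_skew endo)

lemma ext_deriv1_eta:
  assumes X: "VF X" and Y: "VF Y"
  shows "ext_deriv1 \<eta> X Y p = g p (D X \<xi> p) (Y p) - g p (D Y \<xi> p) (X p)"
  using assms by (simp add: ext_deriv1_def eta_D torsion g_sym)

end

subsection \<open>Nearly Sasakian structures in dimension five\<close>

lemma tvec_double_zero: "(a :: 'a tvec) + a = 0 \<Longrightarrow> a = 0"
  by (auto simp: fun_eq_iff)

context smooth_manifold
begin

lemma d2_fmul:
  assumes f: "sm f" and W: "\<And>X Y. VF X \<Longrightarrow> VF Y \<Longrightarrow> sm (W X Y)" and V: "VF X" "VF Y" "VF Z"
  shows "d2 (\<lambda>X Y q. f q * W X Y q) X Y Z p =
    f p * d2 W X Y Z p + X p f * W Y Z p - Y p f * W X Z p + Z p f * W X Y p"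
  using V by (simp add: d2_def tangentD(3)[OF vfT f W] algebra_simps)

end

locale nearly_sasakian_manifold = contact_levi_civita A \<phi> \<xi> \<eta> g D
  for A :: "('a::t2_space, 'e::euclidean_space) atlas" and \<phi> \<xi> \<eta> g D +
  assumes dim: "DIM('e) = 5"
    and ns: "\<And>X Y p. VF X \<Longrightarrow> VF Y \<Longrightarrow> cov \<phi> X Y p + cov \<phi> Y X p =
      (2 * g p (X p) (Y p)) *\<^sub>T \<xi> p - \<eta> p (X p) *\<^sub>T Y p - \<eta> p (Y p) *\<^sub>T X p"
begin

text \<open>The deviation from the Sasakian relation \<nabla>\<xi> = -\<phi>. It is chosen by its
  values on fields, because the connection differentiates along vector fields and not along single
  vectors.\<close>

definition h :: "'a \<Rightarrow> 'a tvec \<Rightarrow> 'a tvec" where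
  "h = (SOME h. endo_field A h \<and> (\<forall>X p. VF X \<longrightarrow> h p (X p) = D X \<xi> p + \<phi> p (X p)))"

lemma h_endo: "endo_field A h" and h_eq: "VF X \<Longrightarrow> h p (X p) = D X \<xi> p + \<phi> p (X p)"
proof -
  define L where "L X = D X \<xi> + app \<phi> X" for X
  have "VF (L X)" if "VF X" for X using that by (simp add: L_def)
  moreover have "L (X + Y) = L X + L Y" if "VF X" "VF Y" for X Y
    by (rule ext, rule ext) (use that in \<open>simp add: L_def D_add_left app_apply\<close>)
  moreover have "L (fmul f X) = fmul f (L X)" if "VF X" "sm f" for f X
    by (rule ext, rule ext) (use that in \<open>simp add: L_def D_fmul_left app_apply fmul_apply tscale_add\<close>)
  ultimately have "\<exists>k. endo_field A k \<and> (\<forall>X p. VF X \<longrightarrow> k p (X p) = L X p)"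
    by (rule endo_of_operator)
  then have "\<exists>k. endo_field A k \<and> (\<forall>X p. VF X \<longrightarrow> k p (X p) = D X \<xi> p + \<phi> p (X p))"
    by (simp add: L_def app_apply)
  then have "endo_field A h \<and> (\<forall>X p. VF X \<longrightarrow> h p (X p) = D X \<xi> p + \<phi> p (X p))"
    unfolding h_def by (rule someI_ex)
  then show "endo_field A h" "VF X \<Longrightarrow> h p (X p) = D X \<xi> p + \<phi> p (X p)" by blast+
qed

lemma D_xi: "VF X \<Longrightarrow> D X \<xi> p = h p (X p) - \<phi> p (X p)"
  by (simp add: h_eq)

lemma h_T [simp]: "v \<in> T p \<Longrightarrow> h p v \<in> T p"
  and h_add [simp]: "v \<in> T p \<Longrightarrow> w \<in> T p \<Longrightarrow> h p (v + w) = h p v + h p w"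
  and h_scale [simp]: "v \<in> T p \<Longrightarrow> h p (a *\<^sub>T v) = a *\<^sub>T h p v"
  and h_vf [simp]: "VF X \<Longrightarrow> VF (app h X)"
  using endo_fieldD[OF h_endo] by blast+

lemma h_minus [simp]: "v \<in> T p \<Longrightarrow> h p (- v) = - h p v"
  and h_diff [simp]: "v \<in> T p \<Longrightarrow> w \<in> T p \<Longrightarrow> h p (v - w) = h p v - h p w"
  and h_zero [simp]: "h p 0 = 0"
  using endo_field_minus[OF h_endo] tangent_zero by blast+

lemma eta_h [simp]:
  assumes "v \<in> T p"
  shows "\<eta> p (h p v) = 0"
proof -
  obtain X where X: "VF X" "X p = v" using vf_extend[OF assms] .
  then show ?thesis using h_eq[OF X(1), of p] assms by simp
qed

text \<open>At X = Y = \<xi> the right-hand side of the nearly Sasakian equation is zero, hence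
  \<phi> annihilates \<nabla>_\<xi> \<xi>; this vector is horizontal, so it vanishes.\<close>

lemma h_xi [simp]: "h p (\<xi> p) = 0"
proof -
  have "cov \<phi> \<xi> \<xi> p + cov \<phi> \<xi> \<xi> p = 0"
    using ns[OF xi_vf xi_vf, of p] by (simp add: tscale_def fun_eq_iff)
  then have "\<phi> p (D \<xi> \<xi> p) = 0"
    using tvec_double_zero[of "cov \<phi> \<xi> \<xi> p"] by (simp add: cov_xi)
  then have "D \<xi> \<xi> p = 0"
    using phi_eq_zero[of "D \<xi> \<xi> p" p] by simp
  then show ?thesis using h_eq[OF xi_vf, of p] by simp
qed

text \<open>The nearly Sasakian equation at the pair X, \<xi>, in which (\<nabla>_X \<phi>) \<xi> =
  -\<phi>(\<nabla>_X \<xi>) is expressed by h.\<close>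

lemma cov_xi_left:
  assumes X: "VF X"
  shows "cov \<phi> \<xi> X p = \<phi> p (h p (X p))"
proof
  fix f
  show "cov \<phi> \<xi> X p f = \<phi> p (h p (X p)) f"
    using fun_cong[OF ns[OF X xi_vf, of p], of f] X
    by (simp add: cov_xi D_xi phi_phi tscale_def[of _ "X p"] tscale_def[of _ "\<xi> p"])
qed

text \<open>Since \<nabla>_\<xi> \<xi> = 0, differentiating \<phi>^2 along \<xi> shows that
  \<nabla>_\<xi> \<phi> = \<phi> h anticommutes with \<phi>. One factor \<phi> is then cancelled on
  horizontal vectors.\<close>

lemma h_phi [simp]:
  assumes "v \<in> T p"
  shows "h p (\<phi> p v) = - \<phi> p (h p v)"
proof -
  obtain X where X: "VF X" "X p = v" using vf_extend[OF assms] .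
  have "\<phi> p (h p (\<phi> p v)) = - \<phi> p (\<phi> p (h p v))"
    using cov_phi[OF xi_vf X(1), of p] cov_xi_left[of "app \<phi> X" p] cov_xi_left[of X p] X
      assms D_xi[OF xi_vf, of p]
    by (simp add: app_apply)
  then have "\<phi> p (h p (\<phi> p v) + \<phi> p (h p v)) = 0"
    using assms by simp
  then have "h p (\<phi> p v) + \<phi> p (h p v) = 0"
    using assms phi_eq_zero[of "h p (\<phi> p v) + \<phi> p (h p v)" p] by simp
  then show ?thesis by (simp add: eq_neg_iff_add_eq_0)
qed

text \<open>\<phi> h is \<nabla>_\<xi> \<phi>, and a covariant derivative of a skew tensor is
  skew.\<close>

lemma phi_h_skew:
  assumes "v \<in> T p" "w \<in> T p"
  shows "g p (\<phi> p (h p v)) w = - g p v (\<phi> p (h p w))"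
proof -
  obtain X where X: "VF X" "X p = v" using vf_extend[OF assms(1)] .
  obtain Y where Y: "VF Y" "Y p = w" using vf_extend[OF assms(2)] .
  show ?thesis using g_cov_skew[OF xi_vf X(1) Y(1), of p] X Y by (simp add: cov_xi_left)
qed

text \<open>Follows from skewness of \<phi> h by moving factors \<phi> across the metric. As \<phi>
  is skew too, so is \<nabla>\<xi> = h - \<phi>, that is, \<xi> is a Killing field.\<close>

lemma h_skew:
  assumes "v \<in> T p" "w \<in> T p"
  shows "g p (h p v) w = - g p v (h p w)"
proof -
  have "- g p (h p v) w = g p (h p v) (\<phi> p (\<phi> p w))"
    using assms by (simp add: phi_phi)
  also have "\<dots> = - g p (\<phi> p (h p v)) (\<phi> p w)"
    using assms by (simp add: phi_skew)
  also have "\<dots> = g p v (\<phi> p (h p (\<phi> p w)))"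
    using assms by (simp only: phi_h_skew phi_T minus_minus)
  also have "\<dots> = g p v (h p w)"
    using assms by (simp add: phi_phi)
  finally show ?thesis by simp
qed

lemma g_h_self [simp]:
  assumes "v \<in> T p"
  shows "g p (h p v) v = 0" "g p v (h p v) = 0" "g p (h p v) (\<phi> p v) = 0" "g p (\<phi> p v) (h p v) = 0"
    "g p (\<phi> p (h p v)) v = 0" "g p v (\<phi> p (h p v)) = 0"
proof -
  show 1: "g p (h p v) v = 0" and 2: "g p v (h p v) = 0"
    using h_skew[of v p v] g_sym[of v p "h p v"] assms by auto
  have "g p (\<phi> p v) (h p v) = - g p (h p (\<phi> p v)) v"
    using assms by (simp add: h_skew del: h_phi)
  also have "\<dots> = g p (\<phi> p (h p v)) v"
    using assms by simp
  also have "\<dots> = - g p (h p v) (\<phi> p v)"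
    using assms by (simp add: phi_skew)
  finally show 3: "g p (\<phi> p v) (h p v) = 0"
    using g_sym[of "\<phi> p v" p "h p v"] assms by simp
  then show 4: "g p (h p v) (\<phi> p v) = 0"
    using g_sym[of "\<phi> p v" p "h p v"] assms by simp
  then show 5: "g p (\<phi> p (h p v)) v = 0"
    using assms by (simp add: phi_skew)
  then show "g p v (\<phi> p (h p v)) = 0"
    using g_sym[of v p "\<phi> p (h p v)"] assms by simp
qed

text \<open>The deviation of \<open>\<nabla>\<phi>\<close> from the Sasakian formula.\<close>

definition tau :: "('a \<Rightarrow> 'a tvec) \<Rightarrow> ('a \<Rightarrow> 'a tvec) \<Rightarrow> ('a \<Rightarrow> 'a tvec) \<Rightarrow> 'a \<Rightarrow> real" where
  "tau X Y Z p = g p (cov \<phi> X Y p) (Z p)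
     - (g p (X p) (Y p) * \<eta> p (Z p) - \<eta> p (Y p) * g p (X p) (Z p))"

text \<open>Skewness in the last two slots is that of \<phi>; in the first two it is the nearly
  Sasakian equation, whose right-hand side is the symmetrised Sasakian expression subtracted in
  \<open>tau\<close>. So \<open>tau\<close> is a 3-form.\<close>

lemma tau_skew:
  assumes X: "VF X" and Y: "VF Y" and Z: "VF Z"
  shows "tau X Z Y p = - tau X Y Z p" "tau Y X Z p = - tau X Y Z p"
proof -
  show "tau X Z Y p = - tau X Y Z p"
    using g_cov_skew[OF X Y Z, of p] g_sym[of "Y p" p "cov \<phi> X Z p"] X Y Z by (simp add: tau_def endo)
  have "g p (cov \<phi> X Y p + cov \<phi> Y X p) (Z p) =
      2 * g p (X p) (Y p) * \<eta> p (Z p) - \<eta> p (X p) * g p (Y p) (Z p) - \<eta> p (Y p) * g p (X p) (Z p)"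
    using X Y Z by (simp only: ns) simp
  then show "tau Y X Z p = - tau X Y Z p"
    using X Y Z g_sym[of "X p" p "Y p"] by (simp add: tau_def endo algebra_simps)
qed

lemma tau_xi: "VF Y \<Longrightarrow> VF Z \<Longrightarrow> tau \<xi> Y Z p = g p (\<phi> p (h p (Y p))) (Z p)"
  by (simp add: tau_def cov_xi_left)

lemma tau_self:
  assumes X: "VF X" and Y: "VF Y"
  shows "tau X Y Y p = 0" "tau X X Y p = 0" "tau Y X Y p = 0"
proof -
  show "tau X Y Y p = 0" "tau X X Y p = 0"
    using tau_skew(1)[OF X Y Y, of p] tau_skew(2)[OF X X Y, of p] by simp_all
  then show "tau Y X Y p = 0"
    using tau_skew(2)[OF X Y Y, of p] by simp
qed

lemma tau_phi:
  assumes X: "VF X" and Y: "VF Y" and Z: "VF Z" and hor: "\<eta> p (Y p) = 0" "\<eta> p (Z p) = 0"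
  shows "tau X (app \<phi> Y) Z p = tau X Y (app \<phi> Z) p"
  using g_cov_phi[OF assms] X Y Z hor by (simp add: tau_def app_apply)

text \<open>Here the dimension enters: \<open>tau X Y\<close> is orthogonal to \<open>X\<close>, \<open>\<phi> X\<close>, \<open>Y\<close>, \<open>\<phi> Y\<close>.\<close>

lemma tau_horizontal:
  assumes X: "VF X" and Y: "VF Y" and Z: "VF Z"
    and hor: "\<eta> p (X p) = 0" "\<eta> p (Y p) = 0" "\<eta> p (Z p) = 0"
  shows "tau X Y Z p = 0"
proof (cases "X p = 0")
  case True
  then have "cov \<phi> X Y p = cov \<phi> (fmul (\<lambda>q. 0) X) Y p"
    using X Y by (intro cov_tensorial[OF endo]) (auto simp: fmul_apply)
  also have "\<dots> = 0" using X Y by (simp add: cov_fmul[OF endo])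
  finally show ?thesis using True X Y Z hor by (simp add: tau_def)
next
  case X0: False
  \<comment> \<open>Y is split into its projection Y' on the plane of X, \<phi> X and a remainder v
    orthogonal to that plane; w will be the horizontal vector that represents
    \<open>tau X Y\<close>.\<close>
  define a where "a = g p (Y p) (X p) / g p (X p) (X p)"
  define b where "b = g p (Y p) (\<phi> p (X p)) / g p (X p) (X p)"
  have gX: "g p (X p) (X p) \<noteq> 0" using X0 X g_eq_zero by auto
  define Y' where "Y' = fmul (\<lambda>q. a) X + fmul (\<lambda>q. b) (app \<phi> X)"
  have Y': "VF Y'" and Y'p: "Y' p = a *\<^sub>T X p + b *\<^sub>T \<phi> p (X p)"
    using X by (simp_all add: Y'_def fmul_apply app_apply)
  define v where "v = Y p - Y' p"
  define w where "w = cov \<phi> X Y p - \<eta> p (cov \<phi> X Y p) *\<^sub>T \<xi> p"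
  have T: "v \<in> T p" "w \<in> T p" "\<eta> p v = 0" "\<eta> p w = 0"
    using X Y Y' hor by (simp_all add: v_def w_def endo Y'p)
  have w: "g p w (U p) = tau X Y U p" if "VF U" "\<eta> p (U p) = 0" for U
    using that X Y hor by (simp add: w_def tau_def endo)
  show ?thesis
  proof (cases "v = 0")
    case True
    \<comment> \<open>When Y lies in that plane, moving \<phi> into the last slot leaves a repeated
      argument in both terms.\<close>
    have "tau X Y Z p = a * tau X X Z p + b * tau X (app \<phi> X) Z p"
    proof -
      have "cov \<phi> X Y p = cov \<phi> X Y' p"
        using True by (intro cov_tensorial[OF endo] X Y Y') (auto simp: v_def)
      also have "\<dots> = a *\<^sub>T cov \<phi> X X p + b *\<^sub>T cov \<phi> X (app \<phi> X) p"
        using X by (simp add: Y'_def cov_add[OF endo] cov_fmul[OF endo])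
      finally show ?thesis
        using X Z hor by (simp add: tau_def endo app_apply)
    qed
    then show ?thesis
      using tau_phi[OF X X Z hor(1,3)] tau_self[OF X Z] tau_self[of X "app \<phi> Z"] X Z by simp
  next
    case False
    have wX: "g p w (X p) = 0" "g p w (\<phi> p (X p)) = 0" "g p w (Y p) = 0" "g p w (\<phi> p (Y p)) = 0"
    proof -
      show "g p w (X p) = 0" "g p w (Y p) = 0"
        using w[OF X hor(1)] w[OF Y hor(2)] tau_self[OF X Y] tau_self[OF Y X] by simp_all
      show "g p w (\<phi> p (X p)) = 0"
        using w[of "app \<phi> X"] tau_phi[OF X Y X hor(2,1)] tau_self[of "app \<phi> Y" X] X Y hor by (simp add: app_apply)
      have "tau X (app \<phi> Y) Y p = tau X Y (app \<phi> Y) p"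
        by (rule tau_phi[OF X Y Y hor(2,2)])
      then have "tau X Y (app \<phi> Y) p = 0"
        using tau_skew(1)[OF X Y, of "app \<phi> Y" p] Y by simp
      then show "g p w (\<phi> p (Y p)) = 0"
        using w[of "app \<phi> Y"] Y hor by (simp add: app_apply)
    qed
    have "w = 0"
    proof (rule orthogonal_frame_spans[of "X p" p v w])
      show "DIM('e) \<le> 5" using dim by simp
      show "g p v (X p) = 0" "g p v (\<phi> p (X p)) = 0"
        using X Y hor gX by (simp_all add: v_def Y'p a_def b_def g_phi_phi)
      show "g p w v = 0" "g p w (\<phi> p v) = 0"
        using X Y T hor wX by (simp_all add: v_def Y'p phi_phi)
    qed (use X X0 T False hor wX in auto)
    then show ?thesis using w[OF Z hor(3)] Z by simp
  qed
qed

text \<open>The \<xi>-component is peeled off one slot at a time, the slots being exchanged by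
  skewness. Each peeled term is given by \<phi> h, and the fully horizontal remainder vanishes by
  \<open>tau_horizontal\<close>.\<close>

lemma tau_eq:
  assumes X: "VF X" and Y: "VF Y" and Z: "VF Z"
  shows "tau X Y Z p = \<eta> p (X p) * g p (\<phi> p (h p (Y p))) (Z p)
    + \<eta> p (Y p) * g p (\<phi> p (h p (Z p))) (X p) + \<eta> p (Z p) * g p (\<phi> p (h p (X p))) (Y p)"
proof -
  have split: "tau P Q R p = tau P Q (hor R) p + \<eta> p (R p) * g p (\<phi> p (h p (P p))) (Q p)"
    if "VF P" "VF Q" "VF R" for P Q R
  proof -
    have "tau P Q R p = tau P Q (hor R) p + \<eta> p (R p) * tau P Q \<xi> p"
      using that by (simp add: tau_def hor_apply endo algebra_simps)
    then show ?thesis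
      using tau_skew(1)[OF that(1) xi_vf that(2), of p] tau_skew(2)[OF xi_vf that(1,2), of p] tau_xi[OF that(1,2), of p]
      by simp
  qed
  have hh: "h p (hor P p) = h p (P p)" "g p (\<phi> p (h p (P p))) (hor Q p) = g p (\<phi> p (h p (P p))) (Q p)"
    if "VF P" "VF Q" for P Q
    using that by (simp_all add: hor_apply)
  have "tau X Y Z p = tau X Y (hor Z) p + \<eta> p (Z p) * g p (\<phi> p (h p (X p))) (Y p)"
    by (rule split[OF X Y Z])
  moreover have "tau X Y (hor Z) p = - tau X (hor Z) Y p"
    using tau_skew(1)[OF X Y, of "hor Z" p] Z by simp
  moreover have "tau X (hor Z) Y p = tau X (hor Z) (hor Y) p + \<eta> p (Y p) * g p (\<phi> p (h p (X p))) (Z p)"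
    using split[of X "hor Z" Y] X Y Z hh by simp
  moreover have "tau X (hor Z) (hor Y) p = tau (hor Z) (hor Y) X p"
    using tau_skew(2)[of "hor Z" X "hor Y" p] tau_skew(1)[of "hor Z" "hor Y" X p] X Y Z by simp
  moreover have "tau (hor Z) (hor Y) X p = \<eta> p (X p) * g p (\<phi> p (h p (Z p))) (Y p)"
    using split[of "hor Z" "hor Y" X] tau_horizontal[of "hor Z" "hor Y" "hor X" p] X Y Z hh by simp
  moreover have "g p (\<phi> p (h p (Z p))) (Y p) = - g p (\<phi> p (h p (Y p))) (Z p)"
    "g p (\<phi> p (h p (X p))) (Z p) = - g p (\<phi> p (h p (Z p))) (X p)"
    using phi_h_skew[of "Z p" p "Y p"] phi_h_skew[of "X p" p "Z p"] g_sym[of "Z p" p] g_sym[of "X p" p] X Y Z by simp_all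
  ultimately show ?thesis by (simp add: algebra_simps)
qed

lemma g_cov_eq:
  assumes X: "VF X" and Y: "VF Y" and Z: "VF Z"
  shows "g p (cov \<phi> X Y p) (Z p) = g p (X p) (Y p) * \<eta> p (Z p) - \<eta> p (Y p) * g p (X p) (Z p)
    + \<eta> p (X p) * g p (\<phi> p (h p (Y p))) (Z p)
    + \<eta> p (Y p) * g p (\<phi> p (h p (Z p))) (X p) + \<eta> p (Z p) * g p (\<phi> p (h p (X p))) (Y p)"
  using tau_eq[OF assms, of p] by (simp add: tau_def)

lemma sasakian_if_h_zero:
  assumes "\<And>p v. v \<in> T p \<Longrightarrow> h p v = 0"
  shows "sasakian A \<phi> \<xi> \<eta> g"
proof -
  have "cov \<phi> X Y p = g p (X p) (Y p) *\<^sub>T \<xi> p - \<eta> p (Y p) *\<^sub>T X p" if X: "VF X" and Y: "VF Y" for X Y p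
  proof (rule nondegenerate)
    show "g p (cov \<phi> X Y p) (Z p) = g p (g p (X p) (Y p) *\<^sub>T \<xi> p - \<eta> p (Y p) *\<^sub>T X p) (Z p)" if "VF Z" for Z
      using X Y that assms by (simp add: g_cov_eq)
  qed (use X Y in \<open>simp_all add: endo\<close>)
  then show ?thesis
    unfolding sasakian_def using acm lc by (auto simp: cov_deriv_endo)
qed

end

section \<open>The forms \<Phi>, F, \<Psi> and the constancy of \<lambda>\<close>

context nearly_sasakian_manifold
begin

definition N :: "('a \<Rightarrow> 'a tvec) \<Rightarrow> 'a \<Rightarrow> real" where "N X = (\<lambda>q. \<eta> q (X q))"
definition Phi :: "('a \<Rightarrow> 'a tvec) \<Rightarrow> ('a \<Rightarrow> 'a tvec) \<Rightarrow> 'a \<Rightarrow> real" where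
  "Phi X Y = (\<lambda>q. g q (\<phi> q (X q)) (Y q))"
definition F :: "('a \<Rightarrow> 'a tvec) \<Rightarrow> ('a \<Rightarrow> 'a tvec) \<Rightarrow> 'a \<Rightarrow> real" where
  "F X Y = (\<lambda>q. g q (h q (X q)) (Y q))"
definition Psi :: "('a \<Rightarrow> 'a tvec) \<Rightarrow> ('a \<Rightarrow> 'a tvec) \<Rightarrow> 'a \<Rightarrow> real" where
  "Psi X Y = (\<lambda>q. g q (\<phi> q (h q (X q))) (Y q))"

lemma forms_smooth: "VF X \<Longrightarrow> sm (N X)" "VF X \<Longrightarrow> VF Y \<Longrightarrow> sm (Phi X Y)"
  "VF X \<Longrightarrow> VF Y \<Longrightarrow> sm (F X Y)" "VF X \<Longrightarrow> VF Y \<Longrightarrow> sm (Psi X Y)"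
  using g_smooth[of "app \<phi> X" Y] g_smooth[of "app h X" Y] g_smooth[of "app \<phi> (app h X)" Y]
  by (simp_all add: N_def Phi_def F_def Psi_def app_apply)

lemma forms_skew: "VF X \<Longrightarrow> VF Y \<Longrightarrow> Phi Y X p = - Phi X Y p"
  "VF X \<Longrightarrow> VF Y \<Longrightarrow> F Y X p = - F X Y p" "VF X \<Longrightarrow> VF Y \<Longrightarrow> Psi Y X p = - Psi X Y p"
  using g_sym[of "Y p" p "\<phi> p (X p)"] g_sym[of "Y p" p "h p (X p)"] g_sym[of "Y p" p "\<phi> p (h p (X p))"]
  by (simp_all add: Phi_def F_def Psi_def phi_skew[of "Y p"] h_skew[of "Y p"] phi_h_skew[of "Y p"] phi_skew)

lemma forms_add:
  assumes "VF X" "VF Y" "VF Z"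
  shows "Phi (X + Y) Z p = Phi X Z p + Phi Y Z p" "Phi X (Y + Z) p = Phi X Y p + Phi X Z p"
    "F (X + Y) Z p = F X Z p + F Y Z p" "F X (Y + Z) p = F X Y p + F X Z p"
    "Psi (X + Y) Z p = Psi X Z p + Psi Y Z p" "Psi X (Y + Z) p = Psi X Y p + Psi X Z p"
  using assms by (simp_all add: Phi_def F_def Psi_def)

lemma forms_xi:
  assumes "VF X"
  shows "Phi \<xi> X p = 0" "F \<xi> X p = 0" "Psi \<xi> X p = 0" "Phi X \<xi> p = 0" "F X \<xi> p = 0" "Psi X \<xi> p = 0"
  using assms by (simp_all add: Phi_def F_def Psi_def)

text \<open>In the cyclic sum of \<open>g_cov_eq\<close> the metric terms cancel in pairs, while the
  group of terms with \<phi> h is already cyclic and is counted three times.\<close>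

lemma d2_Phi:
  assumes X: "VF X" and Y: "VF Y" and Z: "VF Z"
  shows "d2 Phi X Y Z p = 3 * wedge N Psi X Y Z p"
proof -
  have "d2 Phi X Y Z p = ext_deriv2 (fundamental_form \<phi> g) X Y Z p"
    by (simp add: ext_deriv2_eq fundamental_form_def Phi_def[abs_def])
  then show ?thesis
    using X Y Z ext_deriv2_skew[OF endo phi_skew X Y Z, of p]
      g_sym[of "X p" p "Y p"] g_sym[of "X p" p "Z p"] g_sym[of "Y p" p "Z p"]
    by (simp add: g_cov_eq wedge_def N_def Psi_def algebra_simps)
qed

lemma d1_N:
  assumes X: "VF X" and Y: "VF Y"
  shows "d1 N X Y p = 2 * F X Y p - 2 * Phi X Y p"
proof -
  have "d1 N X Y p = ext_deriv1 \<eta> X Y p"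
    by (simp add: ext_deriv1_eq N_def[abs_def])
  also have "\<dots> = F X Y p - Phi X Y p - (F Y X p - Phi Y X p)"
    using X Y by (simp add: ext_deriv1_eta D_xi F_def Phi_def)
  finally show ?thesis using forms_skew[OF X Y, of p] by simp
qed

lemma d2_F:
  assumes X: "VF X" and Y: "VF Y" and Z: "VF Z"
  shows "d2 F X Y Z p = 3 * wedge N Psi X Y Z p"
proof -
  have "0 = d2 (d1 N) X Y Z p"
    by (rule d1_d1[symmetric]) (use X Y Z forms_smooth in \<open>simp_all add: N_def\<close>)
  also have "\<dots> = d2 (\<lambda>X Y q. 2 * F X Y q + (-2) * Phi X Y q) X Y Z p"
    by (rule d2_cong[OF _ X Y Z], rule ext) (simp add: d1_N)
  also have "\<dots> = 2 * d2 F X Y Z p + (-2) * d2 Phi X Y Z p"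
    by (rule d2_linear[OF forms_smooth(3,2) X Y Z])
  finally show ?thesis using d2_Phi[OF X Y Z, of p] by simp
qed

text \<open>The contraction of d\<eta> with \<xi> is zero because \<phi> and h annihilate
  \<xi>.\<close>

lemma N_invariant:
  assumes X: "VF X"
  shows "\<xi> p (N X) = N (br \<xi> X) p"
proof -
  have "N \<xi> = (\<lambda>q. 1)" by (simp add: N_def)
  then show ?thesis
    using d1_N[OF xi_vf X, of p] X by (simp add: d1_def forms_xi tangent_const[OF vfT])
qed

lemma N_xi: "N \<xi> p = 1"
  by (simp add: N_def)

lemma lie_Phi: "VF X \<Longrightarrow> VF Y \<Longrightarrow> lie2 \<xi> Phi X Y p = 3 * Psi X Y p"
  by (rule reeb_invariant_forms(1)[where W = Phi and V = Psi and N = N and c = 3])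
    ((rule forms_add forms_skew forms_smooth xi_vf N_xi forms_xi N_invariant d2_Phi; assumption?)+, simp_all)

lemma lie_F: "VF X \<Longrightarrow> VF Y \<Longrightarrow> lie2 \<xi> F X Y p = 3 * Psi X Y p"
  by (rule reeb_invariant_forms(1)[where W = F and V = Psi and N = N and c = 3])
    ((rule forms_add forms_skew forms_smooth xi_vf N_xi forms_xi N_invariant d2_F; assumption?)+, simp_all)

lemma d2_Psi_lie: "VF X \<Longrightarrow> VF Y \<Longrightarrow> VF Z \<Longrightarrow> d2 Psi X Y Z p = wedge N (lie2 \<xi> Psi) X Y Z p"
  by (rule reeb_invariant_forms(2)[where W = Phi and V = Psi and N = N and c = 3])
    ((rule forms_add forms_skew forms_smooth xi_vf N_xi forms_xi N_invariant d2_Phi; assumption?)+, simp_all)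

lemma killing:
  assumes X: "VF X" and Y: "VF Y"
  shows "\<xi> p (\<lambda>q. g q (X q) (Y q)) = g p (br \<xi> X p) (Y p) + g p (X p) (br \<xi> Y p)"
  using X Y metric_compatible[OF xi_vf X Y, of p] g_sym[of "X p" p "h p (Y p)"] g_sym[of "X p" p "\<phi> p (Y p)"]
  by (simp add: torsion D_xi h_skew[of "X p" p "Y p"] phi_skew[of "X p" p "Y p"])

text \<open>The Lie derivative of F = g(h _, _) is known and that of g is zero, so it falls on
  h.\<close>

lemma lie_h:
  assumes X: "VF X"
  shows "br \<xi> (app h X) p = h p (br \<xi> X p) + 3 *\<^sub>T \<phi> p (h p (X p))"
proof (rule nondegenerate)
  fix Y assume Y: "VF Y"
  show "g p (br \<xi> (app h X) p) (Y p) = g p (h p (br \<xi> X p) + 3 *\<^sub>T \<phi> p (h p (X p))) (Y p)"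
    using lie_F[OF X Y, of p] killing[of "app h X" Y p] X Y
    by (simp add: lie2_def F_def Psi_def app_apply)
qed (use X in simp_all)

text \<open>For horizontal u with h u nonzero, the vectors u, \<phi> u, h u, \<phi> h u are an
  orthogonal frame of the horizontal space, and h^2 u + k u is orthogonal to all four. So every
  horizontal vector is an eigenvector of the symmetric map h^2, which leaves room for one eigenvalue
  only.\<close>

lemma h_h_scalar_exists: "\<exists>c. \<forall>v\<in>T p. h p (h p v) = - (c *\<^sub>T (v - \<eta> p v *\<^sub>T \<xi> p))"
proof -
  define k where "k u = g p (h p u) (h p u) / g p u u" for u
  have ev: "h p (h p u) = - (k u *\<^sub>T u)" if u: "u \<in> T p" "\<eta> p u = 0" for u
  proof (cases "h p u = 0 \<or> u = 0")
    case True
    then show ?thesis using u by (auto simp: k_def)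
  next
    case False
    then have gu: "g p u u \<noteq> 0" using u g_eq_zero by auto
    have hh: "g p (h p (h p u)) u = - g p (h p u) (h p u)"
      using u by (simp add: h_skew)
    have "h p (h p u) + k u *\<^sub>T u = 0"
    proof (rule orthogonal_frame_spans[of u p "h p u"])
      show "g p (h p (h p u) + k u *\<^sub>T u) u = 0"
        using u gu hh by (simp add: k_def)
      show "g p (h p (h p u) + k u *\<^sub>T u) (\<phi> p u) = 0"
        using u g_h_self(6)[of "h p u" p] by (simp add: h_skew[of "h p u"] h_skew)
      show "g p (h p (h p u) + k u *\<^sub>T u) (h p u) = 0" "g p (h p (h p u) + k u *\<^sub>T u) (\<phi> p (h p u)) = 0"
        using u by simp_all
    qed (use u False dim in auto)
    then show ?thesis by (simp add: eq_neg_iff_add_eq_0)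
  qed
  obtain U where U: "VF U" "U p \<noteq> 0" "\<And>q. \<eta> q (U q) = 0"
    using horizontal_exists[of p] dim by auto
  define u where "u = U p"
  have u: "u \<in> T p" "u \<noteq> 0" "\<eta> p u = 0" using U by (simp_all add: u_def)
  \<comment> \<open>Eigenvectors of a symmetric map that are not orthogonal share their
    eigenvalue.\<close>
  have step: "k v = k u" if v: "v \<in> T p" "\<eta> p v = 0" "g p v u \<noteq> 0" for v
  proof -
    have "g p (h p (h p v)) u = g p v (h p (h p u))"
      using v u by (simp add: h_skew)
    then show ?thesis using v u ev[OF v(1,2)] ev[OF u(1,3)] by simp
  qed
  have hor: "h p (h p v) = - (k u *\<^sub>T v)" if v: "v \<in> T p" "\<eta> p v = 0" for v
  proof (cases "g p v u = 0")
    case False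
    then show ?thesis using step v ev by simp
  next
    case True
    \<comment> \<open>If v is orthogonal to u, then v + u is not, and linearity brings the
      eigenvalue back to v.\<close>
    have "k (v + u) = k u"
      using True v u g_eq_zero[OF u(1)] by (intro step) auto
    then have "h p (h p (v + u)) = - (k u *\<^sub>T (v + u))"
      using ev[of "v + u"] v u by simp
    then have "h p (h p v) + h p (h p u) = - (k u *\<^sub>T v) - k u *\<^sub>T u"
      using v u by (simp add: tscale_add)
    then have "h p (h p v) + - (k u *\<^sub>T u) = - (k u *\<^sub>T v) + - (k u *\<^sub>T u)"
      unfolding ev[OF u(1,3)] by (simp only: diff_conv_add_uminus)
    then show ?thesis by (simp only: add_right_cancel)
  qed
  have "h p (h p v) = - (k u *\<^sub>T (v - \<eta> p v *\<^sub>T \<xi> p))" if "v \<in> T p" for v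
    using hor[of "v - \<eta> p v *\<^sub>T \<xi> p"] that by simp
  then show ?thesis by blast
qed

text \<open>The function \<lambda>^2, at this point neither known to be smooth nor constant.\<close>

definition l2 :: "'a \<Rightarrow> real" where
  "l2 p = (SOME c. \<forall>v\<in>T p. h p (h p v) = - (c *\<^sub>T (v - \<eta> p v *\<^sub>T \<xi> p)))"

lemma h_h: "v \<in> T p \<Longrightarrow> h p (h p v) = - (l2 p *\<^sub>T (v - \<eta> p v *\<^sub>T \<xi> p))"
  using someI_ex[OF h_h_scalar_exists[of p]] unfolding l2_def by blast

lemma g_h_h: "v \<in> T p \<Longrightarrow> w \<in> T p \<Longrightarrow> g p (h p v) (h p w) = l2 p * (g p v w - \<eta> p v * \<eta> p w)"
  using h_skew[of v p "h p w"] by (simp add: h_h algebra_simps)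

text \<open>Near p it is the quotient |h X|^2 / |X|^2 for a horizontal field X with X p
  nonzero.\<close>

lemma l2_smooth: "sm l2"
proof (rule smooth_funI)
  fix p
  obtain X where X: "VF X" "X p \<noteq> 0" "\<And>q. \<eta> q (X q) = 0"
    using horizontal_exists[of p] dim by auto
  let ?N = "{q. g q (X q) (X q) \<noteq> 0}"
  have opN: "open ?N" by (rule open_nonzero) (simp add: X)
  have "smooth_fun_on ?N (\<lambda>q. g q (app h X q) (app h X q) / g q (X q) (X q))"
    by (rule smooth_fun_on_divide[OF opN]) (use X in \<open>auto intro!: smooth_fun_imp_on\<close>)
  then have "smooth_fun_on ?N l2"
    by (rule smooth_fun_on_cong[OF opN]) (use X in \<open>simp add: app_apply g_h_h\<close>)
  then show "\<exists>N. open N \<and> p \<in> N \<and> smooth_fun_on N l2"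
    using opN X g_eq_zero[of "X p" p] by auto
qed

text \<open>As \<Psi>(X, Y) = \<Phi>(h X, Y), the Leibniz rule combines the derivative 3 \<Psi> of
  \<Phi> with the derivative 3 \<phi> h of h; then h^2 = -\<lambda>^2 and \<phi>^2 = -1 on
  horizontal vectors.\<close>

lemma lie_Psi:
  assumes X: "VF X" and Y: "VF Y"
  shows "lie2 \<xi> Psi X Y p = - 3 * (l2 p * Phi X Y p + F X Y p)"
proof -
  have "Psi X Y = Phi (app h X) Y" by (simp add: Psi_def Phi_def app_apply)
  then have "lie2 \<xi> Psi X Y p = 3 * Psi (app h X) Y p + 3 * g p (\<phi> p (\<phi> p (h p (X p)))) (Y p)"
    using lie_Phi[of "app h X" Y p] X Y
    by (simp add: lie2_def Phi_def Psi_def lie_h app_apply)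
  then show ?thesis
    using X Y by (simp add: Psi_def Phi_def F_def app_apply h_h phi_phi algebra_simps)
qed

lemma d2_Psi:
  assumes X: "VF X" and Y: "VF Y" and Z: "VF Z"
  shows "d2 Psi X Y Z p = - 3 * (l2 p * wedge N Phi X Y Z p + wedge N F X Y Z p)"
  using X Y Z by (simp add: d2_Psi_lie wedge_def lie_Psi algebra_simps)

text \<open>Compare \<open>d(L\<^sub>\<xi> \<Psi>)\<close> with \<open>L\<^sub>\<xi> (d\<Psi>)\<close>.\<close>

lemma d_l2_wedge_Phi:
  assumes X: "VF X" and Y: "VF Y" and Z: "VF Z"
  shows "X p l2 * Phi Y Z p - Y p l2 * Phi X Z p + Z p l2 * Phi X Y p = \<xi> p l2 * wedge N Phi X Y Z p"
proof -
  define P where "P X Y = (\<lambda>q. l2 q * Phi X Y q)" for X Y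
  define V where "V X Y = (\<lambda>q. (- 3) * P X Y q + (- 3) * F X Y q)" for X Y
  have smP: "sm (P X Y)" if "VF X" "VF Y" for X Y
    unfolding P_def by (intro smooth_fun_mult l2_smooth forms_smooth that)
  have smV: "sm (V X Y)" if "VF X" "VF Y" for X Y
    unfolding V_def by (intro smooth_fun_add smooth_fun_mult smooth_fun_const smP forms_smooth that)
  have "d2 V X Y Z p = wedge N (lie2 \<xi> V) X Y Z p"
  \<comment> \<open>A second round of the same argument, one degree further: d\<Psi> = \<eta> \<and>
    V for V = -3 (\<lambda>^2 \<Phi> + F), hence dV is \<eta> wedged with the Lie derivative of
    V.\<close>
  proof (rule reeb_invariant_forms(2)[where W = Psi and V = V and N = N and c = 1])
    show "d2 Psi X Y Z p = 1 * wedge N V X Y Z p" if "VF X" "VF Y" "VF Z" for X Y Z p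
      using that by (simp add: d2_Psi wedge_def V_def P_def algebra_simps)
    show "V \<xi> X p = 0" "V X \<xi> p = 0" if "VF X" for X p
      using that by (simp_all add: V_def P_def forms_xi)
  qed ((rule forms_add forms_skew forms_smooth smV xi_vf N_xi forms_xi N_invariant; assumption?)+, simp_all add: X Y Z)
  moreover have "d2 V X Y Z p = (- 3) * d2 P X Y Z p + (- 3) * d2 F X Y Z p"
    unfolding V_def by (rule d2_linear[OF smP forms_smooth(3) X Y Z])
  moreover have "d2 P X Y Z p = l2 p * d2 Phi X Y Z p + X p l2 * Phi Y Z p - Y p l2 * Phi X Z p + Z p l2 * Phi X Y p"
    unfolding P_def by (rule d2_fmul[OF l2_smooth forms_smooth(2) X Y Z])
  moreover have "lie2 \<xi> V X Y p = - 3 * (\<xi> p l2 * Phi X Y p + 3 * l2 p * Psi X Y p + 3 * Psi X Y p)"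
    if "VF X" "VF Y" for X Y
  proof -
    have "\<xi> p (V X Y) = (- 3) * \<xi> p (P X Y) + (- 3) * \<xi> p (F X Y)"
      unfolding V_def by (rule tangent_lin[OF vfT[OF xi_vf] smP[OF that] forms_smooth(3)[OF that]])
    moreover have "\<xi> p (P X Y) = l2 p * \<xi> p (Phi X Y) + Phi X Y p * \<xi> p l2"
      unfolding P_def by (rule tangentD(3)[OF vfT[OF xi_vf] l2_smooth forms_smooth(2)[OF that]])
    ultimately have "lie2 \<xi> V X Y p = - 3 * (\<xi> p l2 * Phi X Y p + l2 p * lie2 \<xi> Phi X Y p + lie2 \<xi> F X Y p)"
      by (simp add: lie2_def V_def P_def algebra_simps)
    then show ?thesis using that by (simp add: lie_Phi lie_F)
  qed
  ultimately show ?thesis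
    using X Y Z by (simp add: d2_Phi d2_F wedge_def algebra_simps)
qed

text \<open>Along \<xi>: differentiate |h U|^2 = \<lambda>^2 |U|^2; \<xi> preserves g, and it
  changes h U by 3 \<phi> h U, which is orthogonal to h U. In horizontal directions
  \<open>d_l2_wedge_Phi\<close> then says that the wedge product of d(\<lambda>^2) with \<Phi>
  vanishes.\<close>

lemma l2_derivative_zero:
  assumes X: "VF X"
  shows "X p l2 = 0"
proof -
  obtain U where U: "VF U" "U p \<noteq> 0" "\<And>q. \<eta> q (U q) = 0"
    using horizontal_exists[of p] dim by auto
  have gU: "g p (U p) (U p) \<noteq> 0" using U g_eq_zero[of "U p" p] by auto
  have prod: "V p (\<lambda>q. g q (app h U q) (app h U q)) =
      l2 p * V p (\<lambda>q. g q (U q) (U q)) + g p (U p) (U p) * V p l2" if V: "VF V" for V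
  proof -
    have "(\<lambda>q. g q (app h U q) (app h U q)) = (\<lambda>q. l2 q * g q (U q) (U q))"
      using U by (simp add: fun_eq_iff app_apply g_h_h)
    then show ?thesis
      using tangentD(3)[OF vfT[OF V, of p] l2_smooth g_smooth[OF U(1,1)]] by simp
  qed
  have xi: "\<xi> p l2 = 0"
  proof -
    have "\<xi> p (\<lambda>q. g q (app h U q) (app h U q)) = 2 * g p (h p (br \<xi> U p)) (h p (U p))"
      using killing[of "app h U" "app h U" p] U g_sym[of "h p (U p)" p "h p (br \<xi> U p)"]
      by (simp add: lie_h app_apply)
    also have "\<dots> = l2 p * (2 * g p (br \<xi> U p) (U p))"
      using U by (simp add: g_h_h)
    also have "\<dots> = l2 p * \<xi> p (\<lambda>q. g q (U q) (U q))"
      using killing[OF U(1,1), of p] U g_sym[of "U p" p "br \<xi> U p"] by simp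
    finally show ?thesis using prod[OF xi_vf] gU by simp
  qed
  have hor: "X p l2 = 0" if X: "VF X" and hor: "\<eta> p (X p) = 0" for X
  proof (cases "l2 p = 0 \<or> X p = 0")
    case True
    \<comment> \<open>Where \<lambda> vanishes the test vectors used below degenerate. Instead, h U
      is zero at p, so |h U|^2 = \<lambda>^2 |U|^2 has zero derivative there.\<close>
    moreover have "X p l2 = 0" if l2: "l2 p = 0"
    proof -
      have "g p (h p (U p)) (h p (U p)) = 0" using l2 U by (simp add: g_h_h)
      then have "h p (U p) = 0" using U g_eq_zero[of "h p (U p)" p] by simp
      then have z: "app h U p = 0" by (simp only: app_apply)
      have "X p (\<lambda>q. g q (app h U q) (app h U q)) = 0"
        unfolding metric_compatible[OF X h_vf[OF U(1)] h_vf[OF U(1)], of p] z using X U by simp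
      then show ?thesis using prod[OF X] l2 gU by simp
    qed
    ultimately show ?thesis by auto
  next
    case False
    \<comment> \<open>Tested on X, h X, \<phi> h X: \<Phi>(h X, \<phi> h X) = |\<phi> h X|^2, and
      the two other values of \<Phi> are zero.\<close>
    have "X p l2 * g p (\<phi> p (h p (X p))) (\<phi> p (h p (X p))) = 0"
      using d_l2_wedge_Phi[of X "app h X" "app \<phi> (app h X)" p] xi X hor
      by (simp add: Phi_def app_apply phi_skew[of "X p" p "\<phi> p (h p (X p))"] phi_phi)
    then show ?thesis
      using False X hor g_eq_zero[of "X p" p] by (simp add: g_phi_phi g_h_h)
  qed
  have "X p l2 = hor X p l2 + \<eta> p (X p) * \<xi> p l2"
    by (simp add: hor_apply tscale_def)
  then show ?thesis using hor[of "hor X"] xi X by simp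
qed

lemma l2_constant:
  assumes conn: "connected (UNIV :: 'a set)" and ns': "\<not> sasakian A \<phi> \<xi> \<eta> g"
  obtains l where "0 < l" "\<And>p. l2 p = l\<^sup>2"
proof -
  fix p0 :: 'a
  have const: "l2 p = l2 p0" for p
  proof (rule constant_if_derivatives_vanish[OF conn l2_smooth])
    show "X q l2 = 0" if X: "VF X" for X q by (rule l2_derivative_zero[OF X])
  qed
  obtain U where U: "VF U" "U p0 \<noteq> 0" "\<And>q. \<eta> q (U q) = 0"
    using horizontal_exists[of p0] dim by auto
  have "0 < g p0 (U p0) (U p0)" using U g_pos by simp
  moreover have "0 \<le> g p0 (h p0 (U p0)) (h p0 (U p0))"
    using g_pos[of "h p0 (U p0)" p0] U by (cases "h p0 (U p0) = 0") auto
  ultimately have "0 \<le> l2 p0" using U by (simp add: g_h_h zero_le_mult_iff)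
  moreover have "l2 p0 \<noteq> 0"
  proof
    assume "l2 p0 = 0"
    then have "h p v = 0" if "v \<in> T p" for p v
      using const[of p] g_h_h[OF that that] g_eq_zero[of "h p v" p] that by simp
    then show False using ns' sasakian_if_h_zero by blast
  qed
  ultimately have pos: "0 < l2 p0" by simp
  show ?thesis
  proof (rule that)
    show "0 < sqrt (l2 p0)" using pos by simp
    show "l2 p = (sqrt (l2 p0))\<^sup>2" for p using const[of p] pos by simp
  qed
qed

end

section \<open>Rotation and homothety of a nearly Sasakian structure\<close>

context smooth_manifold
begin

lemma endo_field_lin:
  assumes "endo_field A \<phi>" "endo_field A \<psi>"
  shows "endo_field A (\<lambda>p v. a *\<^sub>T \<phi> p v + b *\<^sub>T \<psi> p v)"
  unfolding endo_field_def
proof (intro conjI allI ballI impI)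
  note e = endo_fieldD[OF assms(1)] endo_fieldD[OF assms(2)]
  show "VF (\<lambda>p. a *\<^sub>T \<phi> p (X p) + b *\<^sub>T \<psi> p (X p))" if "VF X" for X
  proof -
    have "(\<lambda>p. a *\<^sub>T \<phi> p (X p) + b *\<^sub>T \<psi> p (X p)) = fmul (\<lambda>q. a) (app \<phi> X) + fmul (\<lambda>q. b) (app \<psi> X)"
      by (rule ext, rule ext) (simp add: fmul_apply app_apply)
    then show ?thesis using e(4,8) that by simp
  qed
  fix p v assume v: "v \<in> T p"
  show "a *\<^sub>T \<phi> p v + b *\<^sub>T \<psi> p v \<in> T p" using v by (simp add: e)
  show "a *\<^sub>T \<phi> p (r *\<^sub>T v) + b *\<^sub>T \<psi> p (r *\<^sub>T v) = r *\<^sub>T (a *\<^sub>T \<phi> p v + b *\<^sub>T \<psi> p v)" for r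
    using v by (simp add: e tscale_add tscale_tscale mult.commute)
  fix w assume w: "w \<in> T p"
  show "a *\<^sub>T \<phi> p (v + w) + b *\<^sub>T \<psi> p (v + w) = a *\<^sub>T \<phi> p v + b *\<^sub>T \<psi> p v + (a *\<^sub>T \<phi> p w + b *\<^sub>T \<psi> p w)"
    using v w by (simp add: e tscale_add)
qed

lemma endo_field_compose:
  assumes "endo_field A \<phi>" "endo_field A \<psi>"
  shows "endo_field A (\<lambda>p v. \<phi> p (\<psi> p v))"
  unfolding endo_field_def
proof (intro conjI allI ballI impI)
  note e = endo_fieldD[OF assms(1)] endo_fieldD[OF assms(2)]
  show "VF (\<lambda>p. \<phi> p (\<psi> p (X p)))" if "VF X" for X
    using e(4)[OF e(8)[OF that]] by (simp add: app_def)
qed (simp_all add: endo_fieldD[OF assms(1)] endo_fieldD[OF assms(2)])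

end

context contact_manifold
begin

text \<open>A skew \<psi> with the right square is automatically compatible with the metric, because
  g(\<psi> v, \<psi> w) = -g(v, \<psi>^2 w); the three powers of c are those of a homothety.\<close>

lemma rescaled_almost_contact_metric:
  assumes endo': "endo_field A \<psi>"
    and sq: "\<And>p v. v \<in> T p \<Longrightarrow> \<psi> p (\<psi> p v) = - v + \<eta> p v *\<^sub>T \<xi> p"
    and skew: "\<And>p v w. v \<in> T p \<Longrightarrow> w \<in> T p \<Longrightarrow> g p (\<psi> p v) w = - g p v (\<psi> p w)"
    and c: "0 < c"
  shows "almost_contact_metric A \<psi> (\<lambda>p. (1 / c) *\<^sub>T \<xi> p) (\<lambda>p v. c * \<eta> p v) (\<lambda>p v w. c\<^sup>2 * g p v w)"
  unfolding almost_contact_metric_def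
proof (intro conjI allI ballI impI)
  note e = endo_fieldD[OF endo']
  show "VF (\<lambda>p. (1 / c) *\<^sub>T \<xi> p)"
    using vf_fmul[OF smooth_fun_const xi_vf] by (simp add: fmul_def)
  show "one_form A (\<lambda>p v. c * \<eta> p v)"
    unfolding one_form_def linear_form_at_def
    by (auto simp: algebra_simps intro!: smooth_fun_mult)
  show "riemannian_metric A (\<lambda>p v w. c\<^sup>2 * g p v w)"
    unfolding riemannian_metric_def linear_form_at_def
    using c by (auto simp: algebra_simps g_pos g_sym intro!: smooth_fun_mult)
  fix p
  show "c * \<eta> p ((1 / c) *\<^sub>T \<xi> p) = 1" using c by simp
  fix v assume v: "v \<in> T p"
  show "\<psi> p (\<psi> p v) = - v + (c * \<eta> p v) *\<^sub>T (1 / c) *\<^sub>T \<xi> p"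
    using c v by (simp add: sq tscale_tscale)
  fix w assume w: "w \<in> T p"
  show "c\<^sup>2 * g p (\<psi> p v) (\<psi> p w) = c\<^sup>2 * g p v w - c * \<eta> p v * (c * \<eta> p w)"
    using v w by (simp add: skew e sq power2_eq_square algebra_simps)
qed (rule endo')

end

locale proper_nearly_sasakian_manifold = nearly_sasakian_manifold A \<phi> \<xi> \<eta> g D
  for A :: "('a::t2_space, real ^ 5) atlas" and \<phi> \<xi> \<eta> g D +
  fixes l :: real
  assumes l_pos: "0 < l" and l2_eq: "l2 p = l\<^sup>2"
begin

text \<open>With \<open>s\<close>, the cosine and sine of the angle whose tangent is l.\<close>

definition c :: real where "c = 1 / sqrt (1 + l\<^sup>2)"
definition s :: real where "s = l * c"

lemma c_pos: "0 < c" and s_pos: "0 < s" and cs: "c * c + s * s = 1"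
proof -
  have "0 < 1 + l\<^sup>2" using zero_le_power2[of l] by linarith
  then show "0 < c" by (simp add: c_def)
  then show "0 < s" using l_pos by (simp add: s_def)
  have "c\<^sup>2 * (1 + l\<^sup>2) = 1"
    using \<open>0 < 1 + l\<^sup>2\<close> by (simp add: c_def power_divide)
  then show "c * c + s * s = 1" by (simp add: s_def power2_eq_square algebra_simps)
qed

definition H :: "'a \<Rightarrow> 'a tvec \<Rightarrow> 'a tvec" where "H p v = (1 / l) *\<^sub>T h p v"

lemma H_T [simp]: "v \<in> T p \<Longrightarrow> H p v \<in> T p"
  and H_add [simp]: "v \<in> T p \<Longrightarrow> w \<in> T p \<Longrightarrow> H p (v + w) = H p v + H p w"
  and H_diff [simp]: "v \<in> T p \<Longrightarrow> w \<in> T p \<Longrightarrow> H p (v - w) = H p v - H p w"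
  and H_minus [simp]: "v \<in> T p \<Longrightarrow> H p (- v) = - H p v"
  and H_scale [simp]: "v \<in> T p \<Longrightarrow> H p (a *\<^sub>T v) = a *\<^sub>T H p v"
  and H_xi [simp]: "H p (\<xi> p) = 0"
  and eta_H [simp]: "v \<in> T p \<Longrightarrow> \<eta> p (H p v) = 0"
  by (simp_all add: H_def tscale_add tscale_diff tscale_minus tscale_tscale mult.commute)

lemma H_endo: "endo_field A H"
  using endo_field_lin[OF h_endo h_endo, of "1 / l" 0] by (simp add: H_def[abs_def])

lemma H_H [simp]: "v \<in> T p \<Longrightarrow> H p (H p v) = - v + \<eta> p v *\<^sub>T \<xi> p"
  using l_pos by (simp add: H_def h_h l2_eq tscale_tscale tscale_minus power2_eq_square)

lemma H_phi [simp]: "v \<in> T p \<Longrightarrow> H p (\<phi> p v) = - \<phi> p (H p v)"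
  by (simp add: H_def tscale_minus)

lemma H_skew: "v \<in> T p \<Longrightarrow> w \<in> T p \<Longrightarrow> g p (H p v) w = - g p v (H p w)"
  by (simp add: H_def h_skew)

text \<open>\<open>psi3\<close> equals c (\<phi> - h), so that d\<eta> is -2 / c times its form.
  \<open>psi1\<close> is the partner of \<open>psi3\<close> when the pair \<phi>, H is rotated, and
  \<open>psi2\<close> is their product.\<close>

definition "psi1 p v = c *\<^sub>T H p v + s *\<^sub>T \<phi> p v"
definition "psi2 p v = \<phi> p (H p v)"
definition "psi3 p v = c *\<^sub>T \<phi> p v + (- s) *\<^sub>T H p v"

lemma psi_endo: "endo_field A psi1" "endo_field A psi2" "endo_field A psi3"
  unfolding psi1_def[abs_def] psi2_def[abs_def] psi3_def[abs_def]
  by (rule endo_field_lin[OF H_endo endo] endo_field_compose[OF endo H_endo] endo_field_lin[OF endo H_endo])+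

lemma psi_skew:
  assumes "v \<in> T p" "w \<in> T p"
  shows "g p (psi1 p v) w = - g p v (psi1 p w)" "g p (psi2 p v) w = - g p v (psi2 p w)"
    "g p (psi3 p v) w = - g p v (psi3 p w)"
  using assms by (simp_all add: psi1_def psi2_def psi3_def phi_skew H_skew algebra_simps)

lemma psi_relations:
  assumes v: "v \<in> T p"
  shows "psi1 p (psi1 p v) = - v + \<eta> p v *\<^sub>T \<xi> p" "psi2 p (psi2 p v) = - v + \<eta> p v *\<^sub>T \<xi> p"
    "psi3 p (psi3 p v) = - v + \<eta> p v *\<^sub>T \<xi> p"
    "psi1 p (psi2 p v) = psi3 p v" "psi2 p (psi1 p v) = - psi3 p v"
    "psi2 p (psi3 p v) = psi1 p v" "psi3 p (psi2 p v) = - psi1 p v"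
    "psi3 p (psi1 p v) = psi2 p v" "psi1 p (psi3 p v) = - psi2 p v"
proof -
  note [simp] = v phi_phi
  \<comment> \<open>The relation c^2 + s^2 = 1 as a rewrite rule eliminating c^2, so that both sides
    reach the same normal form.\<close>
  have coeff: "c * (c * x) = x - s * (s * x)" for x
    using arg_cong[OF cs, of "\<lambda>a. a * x"] by (simp add: algebra_simps)
  show "psi1 p (psi1 p v) = - v + \<eta> p v *\<^sub>T \<xi> p" "psi2 p (psi2 p v) = - v + \<eta> p v *\<^sub>T \<xi> p"
    "psi3 p (psi3 p v) = - v + \<eta> p v *\<^sub>T \<xi> p"
    "psi1 p (psi2 p v) = psi3 p v" "psi2 p (psi1 p v) = - psi3 p v"
    "psi2 p (psi3 p v) = psi1 p v" "psi3 p (psi2 p v) = - psi1 p v"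
    "psi3 p (psi1 p v) = psi2 p v" "psi1 p (psi3 p v) = - psi2 p v"
    by (rule ext, (simp add: psi1_def psi2_def psi3_def; simp add: tscale_def coeff algebra_simps))+
qed

text \<open>The constant -2 is due to the choice of \<open>psi3\<close>. The constants 3 come from
  c^2 (1 + l^2) = 1: the rescaled form of \<open>psi1\<close> combines F and \<Phi>, both with
  exterior derivative 3 \<eta> \<and> \<Psi>, with total weight (1 + l^2) / (c l) = 1 / (c^3 l),
  while the rescaled form of \<open>psi2\<close> is \<Psi> / (c^2 l).\<close>

lemma rotated_sasaki_einstein:
  "sasaki_einstein A psi1 psi2 psi3 (\<lambda>p. (1 / (1 / c)) *\<^sub>T \<xi> p) (\<lambda>p v. (1 / c) * \<eta> p v) (\<lambda>p v w. (1 / c)\<^sup>2 * g p v w)"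
proof -
  let ?\<theta> = "\<lambda>p v. (1 / c) * \<eta> p v" and ?k = "\<lambda>p v w. (1 / c)\<^sup>2 * g p v w"
  have c': "0 < 1 / c" using c_pos by simp
  note acms = rescaled_almost_contact_metric[OF psi_endo(1) psi_relations(1) psi_skew(1) c']
    rescaled_almost_contact_metric[OF psi_endo(2) psi_relations(2) psi_skew(2) c']
    rescaled_almost_contact_metric[OF psi_endo(3) psi_relations(3) psi_skew(3) c']
  have su2: "SU2_structure A psi1 psi2 psi3 (\<lambda>p. (1 / (1 / c)) *\<^sub>T \<xi> p) ?\<theta> ?k"
    unfolding SU2_structure_def by (intro conjI allI ballI acms psi_relations(4-9))
  have scale: "l * c * (l * c) = 1 - c * c" using cs by (simp add: s_def)
  have form1: "fundamental_form psi1 ?k p (X p) (Y p) = 1 / (c * l) * F X Y p + l / c * Phi X Y p"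
    and form2: "fundamental_form psi2 ?k p (X p) (Y p) = 1 / (c\<^sup>2 * l) * Psi X Y p"
    and form3: "fundamental_form psi3 ?k p (X p) (Y p) = 1 / c * (Phi X Y p - F X Y p)"
    if "VF X" "VF Y" for X Y p
    using that c_pos l_pos
    by (simp_all add: fundamental_form_def psi1_def psi2_def psi3_def F_def Phi_def Psi_def H_def s_def
        power2_eq_square field_simps)
  have d\<theta>: "ext_deriv1 ?\<theta> X Y p = - 2 * fundamental_form psi3 ?k p (X p) (Y p)" if X: "VF X" and Y: "VF Y" for X Y p
  proof -
    have "ext_deriv1 ?\<theta> X Y p = 1 / c * d1 N X Y p"
      using tangentD(2)[OF vfT[OF X] forms_smooth(1)[OF Y], of p "1 / c"]
        tangentD(2)[OF vfT[OF Y] forms_smooth(1)[OF X], of p "1 / c"]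
      by (simp add: ext_deriv1_def d1_def N_def diff_divide_distrib)
    then show ?thesis unfolding form3[OF X Y] d1_N[OF X Y] by (simp add: algebra_simps)
  qed
  have d\<omega>1: "ext_deriv2 (fundamental_form psi1 ?k) X Y Z p =
      3 * wedge12 ?\<theta> (fundamental_form psi2 ?k) p (X p) (Y p) (Z p)"
    if X: "VF X" and Y: "VF Y" and Z: "VF Z" for X Y Z p
  proof -
    have "ext_deriv2 (fundamental_form psi1 ?k) X Y Z p =
        d2 (\<lambda>X Y q. 1 / (c * l) * F X Y q + l / c * Phi X Y q) X Y Z p"
      unfolding ext_deriv2_eq by (rule d2_cong[OF _ X Y Z], rule ext) (rule form1)
    also have "\<dots> = 1 / (c * l) * d2 F X Y Z p + l / c * d2 Phi X Y Z p"
      by (rule d2_linear[OF forms_smooth(3,2) X Y Z])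
    also have "\<dots> = 3 * (1 / (c * l) + l / c) * wedge N Psi X Y Z p"
      by (simp add: d2_F d2_Phi X Y Z algebra_simps)
    also have "1 / (c * l) + l / c = 1 / c * (1 / (c\<^sup>2 * l))"
      using c_pos l_pos scale by (simp add: field_simps power2_eq_square)
    also have "3 * (1 / c * (1 / (c\<^sup>2 * l))) * wedge N Psi X Y Z p =
        3 * wedge12 ?\<theta> (fundamental_form psi2 ?k) p (X p) (Y p) (Z p)"
      unfolding wedge12_def form2[OF X Y] form2[OF Y Z] form2[OF Z X]
      by (simp add: wedge_def N_def algebra_simps)
    finally show ?thesis .
  qed
  have d\<omega>2: "ext_deriv2 (fundamental_form psi2 ?k) X Y Z p =
      - 3 * wedge12 ?\<theta> (fundamental_form psi1 ?k) p (X p) (Y p) (Z p)"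
    if X: "VF X" and Y: "VF Y" and Z: "VF Z" for X Y Z p
  proof -
    have "ext_deriv2 (fundamental_form psi2 ?k) X Y Z p =
        d2 (\<lambda>X Y q. 1 / (c\<^sup>2 * l) * Psi X Y q + 0 * Psi X Y q) X Y Z p"
      unfolding ext_deriv2_eq by (rule d2_cong[OF _ X Y Z], rule ext) (simp only: form2 mult_zero_left add_0_right)
    also have "\<dots> = 1 / (c\<^sup>2 * l) * d2 Psi X Y Z p + 0 * d2 Psi X Y Z p"
      by (rule d2_linear[OF forms_smooth(4,4) X Y Z])
    also have "\<dots> = - 3 * (1 / c * (1 / (c * l) * wedge N F X Y Z p + l / c * wedge N Phi X Y Z p))"
      using c_pos l_pos by (simp add: d2_Psi X Y Z l2_eq field_simps power2_eq_square)
    also have "\<dots> = - 3 * wedge12 ?\<theta> (fundamental_form psi1 ?k) p (X p) (Y p) (Z p)"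
      unfolding wedge12_def form1[OF X Y] form1[OF Y Z] form1[OF Z X]
      by (simp add: wedge_def N_def algebra_simps)
    finally show ?thesis .
  qed
  show ?thesis
    unfolding sasaki_einstein_def by (intro conjI allI impI su2 d\<theta> d\<omega>1 d\<omega>2)
qed

end

lemma nearly_sasakian_imp_sasaki_einstein:
  fixes A :: "('a::t2_space, real ^ 5) atlas"
  assumes A: "smooth_atlas A" "connected (UNIV :: 'a set)"
    and NS: "nearly_sasakian A \<phi> \<xi> \<eta> g" "\<not> sasakian A \<phi> \<xi> \<eta> g"
  shows "\<exists>\<psi>1 \<psi>2 \<psi>3 \<zeta> \<theta> k. sasaki_einstein A \<psi>1 \<psi>2 \<psi>3 \<zeta> \<theta> k"
proof -
  obtain D where D: "levi_civita A g D" and eq: "\<And>X Y p. vector_field A X \<Longrightarrow> vector_field A Y \<Longrightarrow>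
      cov_deriv_endo D \<phi> X Y p + cov_deriv_endo D \<phi> Y X p =
        (2 * g p (X p) (Y p)) *\<^sub>T \<xi> p - \<eta> p (X p) *\<^sub>T Y p - \<eta> p (Y p) *\<^sub>T X p"
    and acm: "almost_contact_metric A \<phi> \<xi> \<eta> g"
    using NS(1) unfolding nearly_sasakian_def by blast
  interpret contact_manifold A \<phi> \<xi> \<eta> g by unfold_locales (rule A(1), rule acm)
  interpret contact_levi_civita A \<phi> \<xi> \<eta> g D by unfold_locales (rule D)
  interpret nearly_sasakian_manifold A \<phi> \<xi> \<eta> g D
    by unfold_locales (use eq in \<open>simp_all add: cov_deriv_endo\<close>)
  obtain l where "0 < l" "\<And>p. l2 p = l\<^sup>2" by (rule l2_constant[OF A(2) NS(2)]) blast
  then interpret proper_nearly_sasakian_manifold A \<phi> \<xi> \<eta> g D l by unfold_locales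
  show ?thesis by (intro exI) (rule rotated_sasaki_einstein)
qed

subsection \<open>Existence of the Levi-Civita connection\<close>

context smooth_manifold
begin

lemma br_add_left: "VF X \<Longrightarrow> VF Y \<Longrightarrow> VF Z \<Longrightarrow> br (X + Y) Z p = br X Z p + br Y Z p"
proof (rule tangent_eqI[of _ p])
  fix f assume V: "VF X" "VF Y" "VF Z" and f: "sm f"
  have "Z p (\<lambda>q. (X + Y) q f) = Z p (\<lambda>q. X q f) + Z p (\<lambda>q. Y q f)"
    using tangentD(1)[OF vfT[OF V(3), of p] vf_smooth[OF V(1) f] vf_smooth[OF V(2) f]] by simp
  then show "br (X + Y) Z p f = (br X Z p + br Y Z p) f"
    by (simp add: bracket_apply)
qed simp_all

lemma br_add_right:
  assumes "VF X" "VF Y" "VF Z"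
  shows "br Z (X + Y) p = br Z X p + br Z Y p"
  using br_add_left[OF assms, of p] bracket_swap[of Z "X + Y"] bracket_swap[of Z X] bracket_swap[of Z Y] by simp

lemma br_fmul_right:
  assumes V: "VF X" "VF Y" and f: "sm f"
  shows "br X (fmul f Y) p = f p *\<^sub>T br X Y p + X p f *\<^sub>T Y p"
proof (rule tangent_eqI[of _ p])
  fix k assume k: "sm k"
  have "X p (\<lambda>q. fmul f Y q k) = f p * X p (\<lambda>q. Y q k) + Y p k * X p f"
    using tangentD(3)[OF vfT[OF V(1), of p] f vf_smooth[OF V(2) k]] by (simp add: fmul_apply tscale_def)
  moreover have "fmul f Y p k = f p * Y p k" for k by (simp add: fmul_apply tscale_def)
  ultimately show "br X (fmul f Y) p k = (f p *\<^sub>T br X Y p + X p f *\<^sub>T Y p) k"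
    by (simp add: bracket_apply tscale_def algebra_simps)
qed (use V f in simp_all)

lemma br_fmul_left:
  assumes V: "VF X" "VF Y" and f: "sm f"
  shows "br (fmul f X) Y p = f p *\<^sub>T br X Y p - Y p f *\<^sub>T X p"
  using br_fmul_right[OF V(2,1) f, of p] bracket_swap[of "fmul f X" Y] bracket_swap[of X Y]
  by (simp add: tscale_minus)

end

section \<open>Koszul's formula\<close>

context riemannian_manifold
begin

definition G :: "('a \<Rightarrow> 'a tvec) \<Rightarrow> ('a \<Rightarrow> 'a tvec) \<Rightarrow> 'a \<Rightarrow> real" where
  "G X Y = (\<lambda>q. g q (X q) (Y q))"

lemma G_smooth: "VF X \<Longrightarrow> VF Y \<Longrightarrow> sm (G X Y)"
  by (simp add: G_def)

lemma G_sym: "VF X \<Longrightarrow> VF Y \<Longrightarrow> G X Y = G Y X"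
  by (simp add: G_def fun_eq_iff g_sym)

lemma d_G_add:
  assumes "VF X" "VF Y" "VF Z" "VF W"
  shows "W p (G (X + Y) Z) = W p (G X Z) + W p (G Y Z)"
    and "W p (G Z (X + Y)) = W p (G Z X) + W p (G Z Y)"
proof -
  have e: "G (X + Y) Z = (\<lambda>q. G X Z q + G Y Z q)" "G Z (X + Y) = (\<lambda>q. G Z X q + G Z Y q)"
    using assms by (simp_all add: G_def fun_eq_iff)
  show "W p (G (X + Y) Z) = W p (G X Z) + W p (G Y Z)"
    "W p (G Z (X + Y)) = W p (G Z X) + W p (G Z Y)"
    unfolding e by (rule tangentD(1)[OF vfT[OF assms(4)]]; rule G_smooth; rule assms)+
qed

lemma d_G_fmul:
  assumes "VF X" "VF Z" "VF W" "sm f"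
  shows "W p (G (fmul f X) Z) = f p * W p (G X Z) + W p f * g p (X p) (Z p)"
    and "W p (G Z (fmul f X)) = f p * W p (G Z X) + W p f * g p (Z p) (X p)"
proof -
  have e: "G (fmul f X) Z = (\<lambda>q. f q * G X Z q)" "G Z (fmul f X) = (\<lambda>q. f q * G Z X q)"
    using assms by (simp_all add: G_def fun_eq_iff fmul_apply)
  show "W p (G (fmul f X) Z) = f p * W p (G X Z) + W p f * g p (X p) (Z p)"
    "W p (G Z (fmul f X)) = f p * W p (G Z X) + W p f * g p (Z p) (X p)"
    unfolding e using tangentD(3)[OF vfT[OF assms(3)] assms(4) G_smooth] assms
    by (simp_all add: G_def algebra_simps)
qed

text \<open>The only possible value of g(\<nabla>_X Y, Z) for a metric and torsion-free
  connection.\<close>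

definition koszul :: "('a \<Rightarrow> 'a tvec) \<Rightarrow> ('a \<Rightarrow> 'a tvec) \<Rightarrow> ('a \<Rightarrow> 'a tvec) \<Rightarrow> 'a \<Rightarrow> real" where
  "koszul X Y Z = (\<lambda>p. (1 / 2) * (X p (G Y Z) + Y p (G X Z) - Z p (G X Y)
     + g p (br X Y p) (Z p) - g p (br X Z p) (Y p) - g p (br Y Z p) (X p)))"

lemma koszul_smooth:
  assumes "VF X" "VF Y" "VF Z"
  shows "sm (koszul X Y Z)"
  unfolding koszul_def
  by (intro smooth_fun_mult smooth_fun_add smooth_fun_diff smooth_fun_const g_smooth vf_bracket assms
      vf_smooth[OF assms(1) G_smooth[OF assms(2,3)]] vf_smooth[OF assms(2) G_smooth[OF assms(1,3)]]
      vf_smooth[OF assms(3) G_smooth[OF assms(1,2)]])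

lemma koszul_add:
  assumes "VF X" "VF Y" "VF Z" "VF W"
  shows "koszul (X + Y) Z W p = koszul X Z W p + koszul Y Z W p"
    and "koszul Z (X + Y) W p = koszul Z X W p + koszul Z Y W p"
    and "koszul Z W (X + Y) p = koszul Z W X p + koszul Z W Y p"
  using assms by (simp_all add: koszul_def d_G_add br_add_left br_add_right algebra_simps)

lemma koszul_fmul:
  assumes "VF X" "VF Y" "VF Z" "sm f"
  shows "koszul (fmul f X) Y Z p = f p * koszul X Y Z p"
    and "koszul X (fmul f Y) Z p = f p * koszul X Y Z p + X p f * g p (Y p) (Z p)"
    and "koszul X Y (fmul f Z) p = f p * koszul X Y Z p"
  using assms g_sym[of "X p" p "Y p"] g_sym[of "X p" p "Z p"] g_sym[of "Y p" p "Z p"]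
  by (simp_all add: koszul_def d_G_fmul br_fmul_left br_fmul_right fmul_apply tscale_apply field_simps)

text \<open>Koszul's expression is linear over functions in Z, and \<open>riesz\<close> turns such
  functionals into vector fields. The representation property is a hypothesis here; for
  SU(2)-structures an adapted frame supplies it.\<close>

lemma levi_civita_exists:
  assumes riesz: "\<And>\<alpha>. \<lbrakk>\<And>X. VF X \<Longrightarrow> sm (\<alpha> X);
      \<And>X Y p. VF X \<Longrightarrow> VF Y \<Longrightarrow> \<alpha> (X + Y) p = \<alpha> X p + \<alpha> Y p;
      \<And>f X p. sm f \<Longrightarrow> VF X \<Longrightarrow> \<alpha> (fmul f X) p = f p * \<alpha> X p\<rbrakk> \<Longrightarrow>
      \<exists>U. VF U \<and> (\<forall>Z p. VF Z \<longrightarrow> g p (U p) (Z p) = \<alpha> Z p)"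
  shows "\<exists>D. levi_civita A g D"
proof -
  define D where "D X Y = (SOME U. VF U \<and> (\<forall>Z p. VF Z \<longrightarrow> g p (U p) (Z p) = koszul X Y Z p))" for X Y
  have D: "VF (D X Y) \<and> (\<forall>Z p. VF Z \<longrightarrow> g p (D X Y p) (Z p) = koszul X Y Z p)" if "VF X" "VF Y" for X Y
  proof -
    have "\<exists>U. VF U \<and> (\<forall>Z p. VF Z \<longrightarrow> g p (U p) (Z p) = koszul X Y Z p)"
      by (rule riesz) (use that in \<open>simp_all add: koszul_smooth koszul_add koszul_fmul\<close>)
    then show ?thesis unfolding D_def by (rule someI_ex)
  qed
  have Dvf [simp]: "VF (D X Y)" if "VF X" "VF Y" for X Y using D[OF that] by blast
  have Dg [simp]: "g p (D X Y p) (Z p) = koszul X Y Z p" if "VF X" "VF Y" "VF Z" for X Y Z p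
    using D[OF that(1,2)] that(3) by blast
  have eqI: "U = V" if "VF U" "VF V" "\<And>Z p. VF Z \<Longrightarrow> g p (U p) (Z p) = g p (V p) (Z p)" for U V
    by (rule ext, rule nondegenerate) (use that in auto)
  have Dg' [simp]: "g p (Z p) (D X Y p) = koszul X Y Z p" if "VF X" "VF Y" "VF Z" for X Y Z p
    using Dg[OF that, of p] g_sym[of "Z p" p "D X Y p"] that by simp
  have "affine_connection A D"
    unfolding affine_connection_def
  proof (intro conjI allI impI)
    fix X Y Z assume V: "VF X" "VF Y" "VF Z"
    show "D (X + Y) Z = D X Z + D Y Z" "D X (Y + Z) = D X Y + D X Z"
      by (rule eqI; use V in \<open>simp add: koszul_add\<close>)+
  next
    fix X Y f assume V: "VF X" "VF Y" "sm f"
    have "D (fmul f X) Y = fmul f (D X Y)"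
      by (rule eqI; use V in \<open>simp add: koszul_fmul fmul_apply\<close>)
    then show "D (\<lambda>p. f p *\<^sub>T X p) Y = (\<lambda>p. f p *\<^sub>T D X Y p)" by (simp add: fmul_def)
    have "D X (fmul f Y) = fmul (\<lambda>q. X q f) Y + fmul f (D X Y)"
      by (rule eqI; use V vf_smooth[OF V(1,3)] in \<open>simp add: koszul_fmul fmul_apply\<close>)
    then have "D X (fmul f Y) p = (fmul (\<lambda>q. X q f) Y + fmul f (D X Y)) p" for p by simp
    then show "D X (\<lambda>p. f p *\<^sub>T Y p) = (\<lambda>p. deriv_along X f p *\<^sub>T Y p + f p *\<^sub>T D X Y p)"
      by (intro ext) (simp add: fmul_def deriv_along_def)
  qed simp
  moreover have "D X Y - D Y X = br X Y" if V: "VF X" "VF Y" for X Y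
  proof (rule eqI)
    fix Z p assume Z: "VF Z"
    have "g p (br Y X p) (Z p) = - g p (br X Y p) (Z p)"
      using V Z bracket_swap[of Y X] by simp
    then show "g p ((D X Y - D Y X) p) (Z p) = g p (br X Y p) (Z p)"
      using V Z G_sym[OF V] by (simp add: koszul_def field_simps)
  qed (use V in simp_all)
  moreover have "X p (\<lambda>q. g q (Y q) (Z q)) = g p (D X Y p) (Z p) + g p (Y p) (D X Z p)"
    if V: "VF X" "VF Y" "VF Z" for X Y Z p
  proof -
    have "g p (br Z Y p) (X p) = - g p (br Y Z p) (X p)"
      using V bracket_swap[of Z Y] by simp
    moreover have "X p (G Z Y) = X p (G Y Z)" using G_sym[OF V(2,3)] by simp
    ultimately have "X p (G Y Z) = koszul X Y Z p + koszul X Z Y p"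
      by (simp add: koszul_def field_simps)
    then show ?thesis using V by (simp add: G_def)
  qed
  ultimately have "levi_civita A g D"
    unfolding levi_civita_def by (intro conjI allI impI)
  then show ?thesis by blast
qed

end

section \<open>Frames adapted to an SU(2)-structure\<close>

locale su2_manifold = C1: contact_manifold A \<phi>1 \<xi> \<eta> g + C2: contact_manifold A \<phi>2 \<xi> \<eta> g
    + C3: contact_manifold A \<phi>3 \<xi> \<eta> g
  for A :: "('a::t2_space, real ^ 5) atlas" and \<phi>1 \<phi>2 \<phi>3 \<xi> \<eta> g +
  assumes quaternionic: "v \<in> tangent_space A p \<Longrightarrow> \<phi>1 p (\<phi>2 p v) = \<phi>3 p v \<and> \<phi>2 p (\<phi>1 p v) = - \<phi>3 p v \<and>
        \<phi>2 p (\<phi>3 p v) = \<phi>1 p v \<and> \<phi>3 p (\<phi>2 p v) = - \<phi>1 p v \<and>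
        \<phi>3 p (\<phi>1 p v) = \<phi>2 p v \<and> \<phi>1 p (\<phi>3 p v) = - \<phi>2 p v"
begin

lemma quat [simp]: assumes "v \<in> C1.T p"
  shows "\<phi>1 p (\<phi>2 p v) = \<phi>3 p v" "\<phi>2 p (\<phi>1 p v) = - \<phi>3 p v"
    "\<phi>2 p (\<phi>3 p v) = \<phi>1 p v" "\<phi>3 p (\<phi>2 p v) = - \<phi>1 p v"
    "\<phi>3 p (\<phi>1 p v) = \<phi>2 p v" "\<phi>1 p (\<phi>3 p v) = - \<phi>2 p v"
  using quaternionic[OF assms] by blast+

lemma g_orthogonal:
  assumes v: "v \<in> C1.T p"
  shows "g p (\<phi>1 p v) (\<phi>2 p v) = 0" "g p (\<phi>2 p v) (\<phi>1 p v) = 0" "g p (\<phi>1 p v) (\<phi>3 p v) = 0"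
    "g p (\<phi>3 p v) (\<phi>1 p v) = 0" "g p (\<phi>2 p v) (\<phi>3 p v) = 0" "g p (\<phi>3 p v) (\<phi>2 p v) = 0"
  using v by (simp_all add: C1.phi_skew C2.phi_skew C3.phi_skew)

text \<open>The difference of both sides is horizontal and orthogonal to v, \<phi>3 v, \<phi>1 v and
  \<phi>3 \<phi>1 v = \<phi>2 v, so the dimension count applies with \<phi>3 as the contact
  tensor.\<close>

lemma frame_decomposition:
  assumes v: "v \<in> C1.T p" "v \<noteq> 0" "\<eta> p v = 0" and w: "w \<in> C1.T p"
  shows "w = \<eta> p w *\<^sub>T \<xi> p + (g p w v / g p v v) *\<^sub>T v + (g p w (\<phi>1 p v) / g p v v) *\<^sub>T \<phi>1 p v
    + (g p w (\<phi>2 p v) / g p v v) *\<^sub>T \<phi>2 p v + (g p w (\<phi>3 p v) / g p v v) *\<^sub>T \<phi>3 p v" (is "w = ?w")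
proof -
  have gv: "g p v v \<noteq> 0" using v C1.g_eq_zero by auto
  have wT: "?w \<in> C1.T p" using v w by simp
  have "w - ?w = 0"
  proof (rule C3.orthogonal_frame_spans[of v p "\<phi>1 p v" "w - ?w"])
    show "\<eta> p (w - ?w) = 0" using v w by simp
    show "\<phi>1 p v \<noteq> 0" using C1.phi_eq_zero v by simp
    show "g p (w - ?w) v = 0" "g p (w - ?w) (\<phi>3 p v) = 0" "g p (w - ?w) (\<phi>1 p v) = 0"
      "g p (w - ?w) (\<phi>3 p (\<phi>1 p v)) = 0"
      using v w gv by (simp_all add: g_orthogonal C1.g_phi_phi C2.g_phi_phi C3.g_phi_phi)
  qed (use v w wT g_orthogonal in simp_all)
  then show ?thesis by simp
qed

text \<open>In the frame \<xi>, X, \<phi>1 X, \<phi>2 X, \<phi>3 X built from one horizontal field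
  the dual vector has an explicit formula. The metric determines it uniquely, so the vectors
  obtained from different X agree.\<close>

lemma riesz:
  assumes smooth: "\<And>X. C1.VF X \<Longrightarrow> C1.sm (\<alpha> X)"
    and add: "\<And>X Y p. C1.VF X \<Longrightarrow> C1.VF Y \<Longrightarrow> \<alpha> (X + Y) p = \<alpha> X p + \<alpha> Y p"
    and mult: "\<And>f X p. C1.sm f \<Longrightarrow> C1.VF X \<Longrightarrow> \<alpha> (fmul f X) p = f p * \<alpha> X p"
  shows "\<exists>U. C1.VF U \<and> (\<forall>Z p. C1.VF Z \<longrightarrow> g p (U p) (Z p) = \<alpha> Z p)"
proof -
  define S where "S X q = \<alpha> \<xi> q *\<^sub>T \<xi> q + (\<alpha> X q / g q (X q) (X q)) *\<^sub>T X q
      + (\<alpha> (app \<phi>1 X) q / g q (X q) (X q)) *\<^sub>T \<phi>1 q (X q)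
      + (\<alpha> (app \<phi>2 X) q / g q (X q) (X q)) *\<^sub>T \<phi>2 q (X q)
      + (\<alpha> (app \<phi>3 X) q / g q (X q) (X q)) *\<^sub>T \<phi>3 q (X q)" for X q
  have ST: "S X q \<in> C1.T q" if "C1.VF X" for X q
    using that by (simp add: S_def)
  have S: "g q (S X q) (Z q) = \<alpha> Z q"
    if X: "C1.VF X" "X q \<noteq> 0" "\<eta> q (X q) = 0" and Z: "C1.VF Z" for X Z q
  proof -
    let ?n = "g q (X q) (X q)"
    \<comment> \<open>The coefficients are frozen at q: Z' agrees with Z at q, which suffices by
      tensoriality, and \<alpha> can be evaluated on it term by term.\<close>
    define Z' where "Z' = fmul (\<lambda>_. \<eta> q (Z q)) \<xi> + fmul (\<lambda>_. g q (Z q) (X q) / ?n) X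
      + fmul (\<lambda>_. g q (Z q) (\<phi>1 q (X q)) / ?n) (app \<phi>1 X)
      + fmul (\<lambda>_. g q (Z q) (\<phi>2 q (X q)) / ?n) (app \<phi>2 X)
      + fmul (\<lambda>_. g q (Z q) (\<phi>3 q (X q)) / ?n) (app \<phi>3 X)"
    have Z': "C1.VF Z'" using X by (simp add: Z'_def)
    have "Z' q = Z q"
      using frame_decomposition[of "X q" q "Z q"] X Z by (simp add: Z'_def fmul_apply app_apply)
    then have "\<alpha> Z q = \<alpha> Z' q"
      by (intro C1.tensorial[where L = "\<lambda>X. \<alpha> X q" and p = q]) (use Z Z' in \<open>simp_all add: add mult\<close>)
    also have "\<dots> = \<eta> q (Z q) * \<alpha> \<xi> q + g q (Z q) (X q) / ?n * \<alpha> X q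
      + g q (Z q) (\<phi>1 q (X q)) / ?n * \<alpha> (app \<phi>1 X) q + g q (Z q) (\<phi>2 q (X q)) / ?n * \<alpha> (app \<phi>2 X) q
      + g q (Z q) (\<phi>3 q (X q)) / ?n * \<alpha> (app \<phi>3 X) q"
      using X by (simp add: Z'_def add mult)
    also have "\<dots> = g q (S X q) (Z q)"
      using X Z C1.g_sym[of "Z q" q] by (simp add: S_def mult.commute)
    finally show ?thesis by simp
  qed
  have "\<exists>X. C1.VF X \<and> X p \<noteq> 0 \<and> (\<forall>q. \<eta> q (X q) = 0)" for p
    using C1.horizontal_exists[of p] by auto
  then obtain E where E: "\<And>p. C1.VF (E p)" "\<And>p. E p p \<noteq> 0" "\<And>p q. \<eta> q (E p q) = 0"
    by metis
  \<comment> \<open>The field \<open>E q\<close> used at q may depend arbitrarily on q; uniqueness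
    allows \<open>E p\<close> in its place at all points near p, which gives smoothness.\<close>
  define U where "U q = S (E q) q" for q
  have UT: "U q \<in> C1.T q" for q using ST E by (simp add: U_def)
  have Ug: "g q (U q) (Z q) = \<alpha> Z q" if "C1.VF Z" for Z q
    using S[OF E(1) E(2) E(3) that] by (simp add: U_def)
  have "C1.VF U"
  proof (rule C1.vector_fieldI[OF UT])
    fix f assume f: "C1.sm f"
    show "C1.sm (\<lambda>q. U q f)"
    proof (rule C1.smooth_funI)
      fix p
      let ?X = "E p"
      let ?N = "{q. g q (?X q) (?X q) \<noteq> 0}"
      have opN: "open ?N" by (rule C1.open_nonzero) (simp add: E)
      have US: "U q = S ?X q" if "q \<in> ?N" for q
      proof (rule C1.nondegenerate[OF UT ST])
        have "?X q \<noteq> 0" using that C1.g_eq_zero[of "?X q" q] E(1) by auto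
        then show "g q (U q) (Z q) = g q (S ?X q) (Z q)" if "C1.VF Z" for Z
          using S[OF E(1) _ E(3) that, of p q] Ug[OF that] by simp
      qed (rule E)
      have div: "C1.smooth_fun_on ?N (\<lambda>q. \<alpha> Y q / g q (?X q) (?X q) * Y q f)" if "C1.VF Y" for Y
        by (rule C1.smooth_fun_on_mult[OF opN C1.smooth_fun_on_divide[OF opN]])
          (use that f E smooth in \<open>auto intro!: C1.smooth_fun_imp_on simp: C1.vf_smooth\<close>)
      have "C1.smooth_fun_on ?N (\<lambda>q. \<alpha> \<xi> q * \<xi> q f + \<alpha> ?X q / g q (?X q) (?X q) * ?X q f
          + \<alpha> (app \<phi>1 ?X) q / g q (?X q) (?X q) * app \<phi>1 ?X q f
          + \<alpha> (app \<phi>2 ?X) q / g q (?X q) (?X q) * app \<phi>2 ?X q f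
          + \<alpha> (app \<phi>3 ?X) q / g q (?X q) (?X q) * app \<phi>3 ?X q f)"
        by (intro C1.smooth_fun_on_add[OF opN] div C1.smooth_fun_imp_on[OF C1.smooth_fun_mult]
            smooth C1.vf_smooth[OF _ f] E C1.xi_vf C1.phi_vf C2.phi_vf C3.phi_vf)
      then have "C1.smooth_fun_on ?N (\<lambda>q. U q f)"
        by (rule C1.smooth_fun_on_cong[OF opN]) (simp add: US S_def tscale_def app_apply)
      moreover have "p \<in> ?N" using E C1.g_eq_zero[of "?X p" p] by simp
      ultimately show "\<exists>N. open N \<and> p \<in> N \<and> C1.smooth_fun_on N (\<lambda>q. U q f)"
        using opN by blast
    qed
  qed
  then show ?thesis using Ug by blast
qed

lemma levi_civita_connection_exists: "\<exists>D. levi_civita A g D"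
  by (rule C1.levi_civita_exists) (rule riesz)

end

subsection \<open>From Sasaki-Einstein to nearly Sasakian structures\<close>

text \<open>The setting of Hitchin's lemma, with closedness demanded on horizontal fields, where the
  terms \<eta> \<and> \<omega> of the structure equations vanish. The quaternion relations are such
  that the locale can be entered again with cyclically permuted tensors.\<close>

locale hyper_contact_manifold = levi_civita_manifold A g D
    + C1: contact_levi_civita A \<phi>1 \<xi> \<eta> g D + C2: contact_levi_civita A \<phi>2 \<xi> \<eta> g D
    + C3: contact_levi_civita A \<phi>3 \<xi> \<eta> g D
  for A :: "('a::t2_space, 'e::euclidean_space) atlas" and \<phi>1 \<phi>2 \<phi>3 \<xi> \<eta> g D +
  assumes phi13: "v \<in> T p \<Longrightarrow> \<phi>1 p (\<phi>3 p v) = - \<phi>2 p v"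
    and phi31: "v \<in> T p \<Longrightarrow> \<phi>3 p (\<phi>1 p v) = \<phi>2 p v"
    and closed: "\<phi> \<in> {\<phi>1, \<phi>2, \<phi>3} \<Longrightarrow> VF X \<Longrightarrow> VF Y \<Longrightarrow> VF Z \<Longrightarrow>
      (\<And>q. \<eta> q (X q) = 0) \<Longrightarrow> (\<And>q. \<eta> q (Y q) = 0) \<Longrightarrow> (\<And>q. \<eta> q (Z q) = 0) \<Longrightarrow>
      g p (cov \<phi> X Y p) (Z p) + g p (cov \<phi> Y Z p) (X p) + g p (cov \<phi> Z X p) (Y p) = 0"
begin

definition horizontal :: "('a \<Rightarrow> 'a tvec) \<Rightarrow> bool" where
  "horizontal X \<longleftrightarrow> VF X \<and> (\<forall>q. \<eta> q (X q) = 0)"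

lemma horizontalD: "horizontal X \<Longrightarrow> VF X" "horizontal X \<Longrightarrow> \<eta> q (X q) = 0"
  by (simp_all add: horizontal_def)

lemma horizontal_app:
  assumes "horizontal X"
  shows "horizontal (app \<phi>1 X)" "horizontal (app \<phi>3 X)"
  using assms by (simp_all add: horizontal_def app_apply)

text \<open>The product rule for \<phi>2 = -\<phi>1 \<phi>3.\<close>

lemma cov_phi2:
  assumes X: "VF X" and Y: "VF Y"
  shows "cov \<phi>2 X Y p = - cov \<phi>1 X (app \<phi>3 Y) p - \<phi>1 p (cov \<phi>3 X Y p)"
proof -
  have eq: "app \<phi>2 Y = - app \<phi>1 (app \<phi>3 Y)"
    by (rule ext, rule ext) (use Y in \<open>simp add: app_apply phi13\<close>)
  have "D X (app \<phi>2 Y) p = - D X (app \<phi>1 (app \<phi>3 Y)) p"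
    unfolding eq using X Y by (simp add: D_minus_right)
  then show ?thesis
    using X Y by (simp add: cov_def phi13)
qed

definition "b1 X Y Z p = g p (cov \<phi>1 X Y p) (Z p)"
definition "b2 X Y Z p = g p (cov \<phi>2 X Y p) (Z p)"
definition "b3 X Y Z p = g p (cov \<phi>3 X Y p) (Z p)"

lemma b_skew:
  assumes "VF X" "VF Y" "VF Z"
  shows "b1 X Z Y p = - b1 X Y Z p" "b2 X Z Y p = - b2 X Y Z p" "b3 X Z Y p = - b3 X Y Z p"
  using assms C1.g_cov_skew[OF assms(1,3,2), of p] C2.g_cov_skew[OF assms(1,3,2), of p]
    C3.g_cov_skew[OF assms(1,3,2), of p]
    g_sym[of "Z p" p "cov \<phi>1 X Y p"] g_sym[of "Z p" p "cov \<phi>2 X Y p"] g_sym[of "Z p" p "cov \<phi>3 X Y p"]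
  by (simp_all add: b1_def b2_def b3_def C1.endo C2.endo C3.endo)

lemma b_cyclic:
  assumes "horizontal X" "horizontal Y" "horizontal Z"
  shows "b1 X Y Z p + b1 Y Z X p + b1 Z X Y p = 0" "b2 X Y Z p + b2 Y Z X p + b2 Z X Y p = 0"
    "b3 X Y Z p + b3 Y Z X p + b3 Z X Y p = 0"
  unfolding b1_def b2_def b3_def
  by (rule closed; use assms in \<open>simp add: horizontal_def\<close>)+

lemma b2_eq:
  assumes "VF X" "VF Y" "VF Z"
  shows "b2 X Y Z p = - b1 X (app \<phi>3 Y) Z p + b3 X Y (app \<phi>1 Z) p"
  using assms by (simp add: b1_def b2_def b3_def cov_phi2 app_apply C1.phi_skew C1.endo C3.endo)

lemma b3_phi:
  assumes "horizontal X" "horizontal Y" "horizontal Z"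
  shows "b3 X (app \<phi>3 Y) Z p = b3 X Y (app \<phi>3 Z) p"
  using C3.g_cov_phi[of X Y Z p] assms by (simp add: b3_def app_apply horizontal_def)

lemma app_app:
  assumes "horizontal X"
  shows "app \<phi>3 (app \<phi>3 X) = - X" "app \<phi>1 (- app \<phi>1 X) = X" "app \<phi>1 (app \<phi>3 X) = - app \<phi>3 (app \<phi>1 X)"
  by (rule ext, rule ext, use assms in
      \<open>simp add: app_apply horizontal_def C1.phi_phi C3.phi_phi phi13 phi31\<close>)+

lemma cov_minus:
  assumes "endo_field A \<phi>" "VF X" "VF Y"
  shows "cov \<phi> X (- Y) p = - cov \<phi> X Y p" "cov \<phi> (- X) Y p = - cov \<phi> X Y p"
proof -
  have m: "fmul (\<lambda>q. - 1) Z = - Z" for Z :: "'a \<Rightarrow> 'a tvec"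
    by (rule ext, rule ext) (simp add: fmul_apply tscale_apply)
  show "cov \<phi> X (- Y) p = - cov \<phi> X Y p" "cov \<phi> (- X) Y p = - cov \<phi> X Y p"
    using cov_fmul[OF assms, of "\<lambda>q. - 1" p] by (simp_all add: m tscale_minus_left)
qed

lemma b_minus:
  assumes "VF X" "VF Y" "VF Z"
  shows "b1 X (- Y) Z p = - b1 X Y Z p" "b3 (- X) Y Z p = - b3 X Y Z p" "b3 X Y (- Z) p = - b3 X Y Z p"
  using assms by (simp_all add: b1_def b3_def cov_minus[OF C1.endo] cov_minus[OF C3.endo] C1.endo C3.endo)

text \<open>Hitchin's argument: closedness of the first two forms makes the Nijenhuis tensor of \<open>\<phi>3\<close> vanish,
  and an almost contact structure with vanishing Nijenhuis tensor and closed form is parallel.\<close>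

lemma nijenhuis:
  assumes X: "horizontal X" and Y: "horizontal Y" and W: "horizontal W"
  shows "b3 (app \<phi>3 X) Y W p + b3 X (app \<phi>3 Y) W p = b3 (app \<phi>3 Y) X W p + b3 Y (app \<phi>3 X) W p"
proof -
  \<comment> \<open>This choice makes \<phi>1 V = W, so that the terms with \<open>b3\<close> coming
    from \<open>b2_eq\<close> end in the wanted argument.\<close>
  define V where "V = - app \<phi>1 W"
  have V: "horizontal V" and V1: "app \<phi>1 V = W"
    using horizontal_app(1)[OF W] W by (auto simp: V_def horizontal_def app_apply app_app(2))
  note vf = horizontalD(1)[OF X] horizontalD(1)[OF Y] horizontalD(1)[OF V]
  note JX = horizontal_app(2)[OF X] and JY = horizontal_app(2)[OF Y]
  note vfJ = horizontalD(1)[OF JX] horizontalD(1)[OF JY]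
  have "b1 X Y V p + b1 Y V X p + b1 V X Y p = 0"
    by (rule b_cyclic(1)[OF X Y V])
  moreover have "b1 (app \<phi>3 X) (app \<phi>3 Y) V p + b1 (app \<phi>3 Y) V (app \<phi>3 X) p + b1 V (app \<phi>3 X) (app \<phi>3 Y) p = 0"
    by (rule b_cyclic(1)[OF JX JY V])
  \<comment> \<open>Write J for \<phi>3. When this relation and the next, at (JX, Y, V) and (X, JY,
    V), are added and \<open>b2\<close> is expanded through \<phi>2 = -\<phi>1 J, the terms with
    \<open>b1\<close> assemble into the two cyclic sums above and drop out.\<close>
  moreover have "b2 (app \<phi>3 X) Y V p + b2 Y V (app \<phi>3 X) p + b2 V (app \<phi>3 X) Y p = 0"
    by (rule b_cyclic(2)[OF JX Y V])
  moreover have "b2 X (app \<phi>3 Y) V p + b2 (app \<phi>3 Y) V X p + b2 V X (app \<phi>3 Y) p = 0"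
    by (rule b_cyclic(2)[OF X JY V])
  moreover have "b2 V (app \<phi>3 X) Y p = b1 V X Y p + b3 V (app \<phi>3 X) (app \<phi>1 Y) p"
    using b2_eq[OF vf(3) vfJ(1) vf(2), of p] by (simp add: app_app(1)[OF X] b_minus vf)
  moreover have "b3 V (app \<phi>3 X) (app \<phi>1 Y) p = b3 V X (app \<phi>3 (app \<phi>1 Y)) p"
    by (rule b3_phi[OF V X horizontal_app(1)[OF Y]])
  moreover have "b2 V X (app \<phi>3 Y) p = - b1 V (app \<phi>3 X) (app \<phi>3 Y) p - b3 V X (app \<phi>3 (app \<phi>1 Y)) p"
    using b2_eq[OF vf(3,1) vfJ(2), of p] vf by (simp add: app_app(3)[OF Y] b_minus)
  moreover have "b2 (app \<phi>3 X) Y V p = - b1 (app \<phi>3 X) (app \<phi>3 Y) V p + b3 (app \<phi>3 X) Y W p"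
    using b2_eq[OF vfJ(1) vf(2,3), of p] by (simp add: V1)
  moreover have "b2 X (app \<phi>3 Y) V p = b1 X Y V p + b3 X (app \<phi>3 Y) W p"
    using b2_eq[OF vf(1) vfJ(2) vf(3), of p] by (simp add: V1 app_app(1)[OF Y] b_minus vf)
  moreover have "b2 Y (app \<phi>3 X) V p = b1 Y X V p + b3 Y (app \<phi>3 X) W p"
    using b2_eq[OF vf(2) vfJ(1) vf(3), of p] by (simp add: V1 app_app(1)[OF X] b_minus vf)
  moreover have "b2 (app \<phi>3 Y) X V p = - b1 (app \<phi>3 Y) (app \<phi>3 X) V p + b3 (app \<phi>3 Y) X W p"
    using b2_eq[OF vfJ(2) vf(1,3), of p] by (simp add: V1)
  moreover have "b2 Y V (app \<phi>3 X) p = - b2 Y (app \<phi>3 X) V p" "b1 Y X V p = - b1 Y V X p"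
    "b2 (app \<phi>3 Y) V X p = - b2 (app \<phi>3 Y) X V p"
    "b1 (app \<phi>3 Y) (app \<phi>3 X) V p = - b1 (app \<phi>3 Y) V (app \<phi>3 X) p"
    by (rule b_skew; fact vf vfJ)+
  ultimately show ?thesis by linarith
qed

text \<open>Let J be \<phi>3 and a, b, c the value \<open>b3\<close> at (JX, Y, W) and its cyclic
  images. The Nijenhuis identity and closedness of \<omega>3 give a + b = c; a cyclic shift gives b
  + c = a, whence b = 0. Replacing X by JX removes the J.\<close>

lemma b3_zero:
  assumes X: "horizontal X" and Y: "horizontal Y" and Z: "horizontal Z"
  shows "g p (cov \<phi>3 X Y p) (Z p) = 0"
proof -
  have key: "b3 (app \<phi>3 X) Y W p + b3 (app \<phi>3 Y) W X p = b3 (app \<phi>3 W) X Y p"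
    if X: "horizontal X" and Y: "horizontal Y" and W: "horizontal W" for X Y W
  proof -
    note vf = horizontalD(1)[OF X] horizontalD(1)[OF Y] horizontalD(1)[OF W]
    note J = horizontal_app(2)[OF X] horizontal_app(2)[OF Y] horizontal_app(2)[OF W]
    note vfJ = horizontalD(1)[OF J(1)] horizontalD(1)[OF J(2)] horizontalD(1)[OF J(3)]
    have "b3 X Y (app \<phi>3 W) p + b3 Y (app \<phi>3 W) X p + b3 (app \<phi>3 W) X Y p = 0"
      by (rule b_cyclic(3)[OF X Y J(3)])
    moreover have "b3 X (app \<phi>3 Y) W p = b3 X Y (app \<phi>3 W) p" "b3 Y (app \<phi>3 X) W p = b3 Y X (app \<phi>3 W) p"
      by (rule b3_phi[OF X Y W] b3_phi[OF Y X W])+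
    moreover have "b3 Y X (app \<phi>3 W) p = - b3 Y (app \<phi>3 W) X p" "b3 (app \<phi>3 Y) X W p = - b3 (app \<phi>3 Y) W X p"
      by (rule b_skew; fact vf vfJ)+
    ultimately show ?thesis using nijenhuis[OF X Y W, of p] by linarith
  qed
  have "b3 (app \<phi>3 U) Y Z p = 0" if U: "horizontal U" for U
    using key[OF Z U Y] key[OF U Y Z] by linarith
  from this[OF horizontal_app(2)[OF X]] have "b3 (- X) Y Z p = 0"
    by (simp add: app_app(1)[OF X])
  then show ?thesis
    using X Y Z by (simp add: b_minus horizontal_def) (simp add: b3_def)
qed

end

section \<open>The Reeb field and covariant derivatives of a Sasaki-Einstein structure\<close>

locale se_manifold = levi_civita_manifold A g D
    + C1: contact_levi_civita A \<phi>1 \<xi> \<eta> g D + C2: contact_levi_civita A \<phi>2 \<xi> \<eta> g D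
    + C3: contact_levi_civita A \<phi>3 \<xi> \<eta> g D
  for A :: "('a::t2_space, 'e::euclidean_space) atlas" and \<phi>1 \<phi>2 \<phi>3 \<xi> \<eta> g D +
  assumes quaternionic: "v \<in> T p \<Longrightarrow> \<phi>1 p (\<phi>2 p v) = \<phi>3 p v \<and> \<phi>2 p (\<phi>1 p v) = - \<phi>3 p v \<and>
        \<phi>2 p (\<phi>3 p v) = \<phi>1 p v \<and> \<phi>3 p (\<phi>2 p v) = - \<phi>1 p v \<and>
        \<phi>3 p (\<phi>1 p v) = \<phi>2 p v \<and> \<phi>1 p (\<phi>3 p v) = - \<phi>2 p v"
    and d_eta: "VF X \<Longrightarrow> VF Y \<Longrightarrow> ext_deriv1 \<eta> X Y p = - 2 * fundamental_form \<phi>3 g p (X p) (Y p)"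
    and d_omega1: "VF X \<Longrightarrow> VF Y \<Longrightarrow> VF Z \<Longrightarrow> ext_deriv2 (fundamental_form \<phi>1 g) X Y Z p =
      3 * wedge12 \<eta> (fundamental_form \<phi>2 g) p (X p) (Y p) (Z p)"
    and d_omega2: "VF X \<Longrightarrow> VF Y \<Longrightarrow> VF Z \<Longrightarrow> ext_deriv2 (fundamental_form \<phi>2 g) X Y Z p =
      - 3 * wedge12 \<eta> (fundamental_form \<phi>1 g) p (X p) (Y p) (Z p)"
begin

lemma quat [simp]: assumes "v \<in> T p"
  shows "\<phi>1 p (\<phi>2 p v) = \<phi>3 p v" "\<phi>2 p (\<phi>1 p v) = - \<phi>3 p v"
    "\<phi>2 p (\<phi>3 p v) = \<phi>1 p v" "\<phi>3 p (\<phi>2 p v) = - \<phi>1 p v"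
    "\<phi>3 p (\<phi>1 p v) = \<phi>2 p v" "\<phi>1 p (\<phi>3 p v) = - \<phi>2 p v"
  using quaternionic[OF assms] by blast+

definition N :: "('a \<Rightarrow> 'a tvec) \<Rightarrow> 'a \<Rightarrow> real" where "N X = (\<lambda>q. \<eta> q (X q))"
definition W1 :: "('a \<Rightarrow> 'a tvec) \<Rightarrow> ('a \<Rightarrow> 'a tvec) \<Rightarrow> 'a \<Rightarrow> real" where
  "W1 X Y = (\<lambda>q. g q (\<phi>1 q (X q)) (Y q))"
definition W2 :: "('a \<Rightarrow> 'a tvec) \<Rightarrow> ('a \<Rightarrow> 'a tvec) \<Rightarrow> 'a \<Rightarrow> real" where
  "W2 X Y = (\<lambda>q. g q (\<phi>2 q (X q)) (Y q))"
definition W3 :: "('a \<Rightarrow> 'a tvec) \<Rightarrow> ('a \<Rightarrow> 'a tvec) \<Rightarrow> 'a \<Rightarrow> real" where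
  "W3 X Y = (\<lambda>q. g q (\<phi>3 q (X q)) (Y q))"

lemma W_smooth: "VF X \<Longrightarrow> sm (N X)" "VF X \<Longrightarrow> VF Y \<Longrightarrow> sm (W1 X Y)"
  "VF X \<Longrightarrow> VF Y \<Longrightarrow> sm (W2 X Y)" "VF X \<Longrightarrow> VF Y \<Longrightarrow> sm (W3 X Y)"
  using g_smooth[of "app \<phi>1 X" Y] g_smooth[of "app \<phi>2 X" Y] g_smooth[of "app \<phi>3 X" Y]
  by (simp_all add: N_def W1_def W2_def W3_def app_apply)

lemma W_skew: "VF X \<Longrightarrow> VF Y \<Longrightarrow> W1 Y X p = - W1 X Y p"
  "VF X \<Longrightarrow> VF Y \<Longrightarrow> W2 Y X p = - W2 X Y p" "VF X \<Longrightarrow> VF Y \<Longrightarrow> W3 Y X p = - W3 X Y p"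
  using g_sym[of "Y p" p "\<phi>1 p (X p)"] g_sym[of "Y p" p "\<phi>2 p (X p)"] g_sym[of "Y p" p "\<phi>3 p (X p)"]
  by (simp_all add: W1_def W2_def W3_def C1.phi_skew[of "Y p"] C2.phi_skew[of "Y p"] C3.phi_skew[of "Y p"])

lemma W_add:
  assumes "VF X" "VF Y" "VF Z"
  shows "W1 (X + Y) Z p = W1 X Z p + W1 Y Z p" "W1 X (Y + Z) p = W1 X Y p + W1 X Z p"
    "W2 (X + Y) Z p = W2 X Z p + W2 Y Z p" "W2 X (Y + Z) p = W2 X Y p + W2 X Z p"
    "W3 (X + Y) Z p = W3 X Z p + W3 Y Z p" "W3 X (Y + Z) p = W3 X Y p + W3 X Z p"
  using assms by (simp_all add: W1_def W2_def W3_def)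

lemma W_xi:
  assumes "VF X"
  shows "W1 \<xi> X p = 0" "W2 \<xi> X p = 0" "W3 \<xi> X p = 0" "W1 X \<xi> p = 0" "W2 X \<xi> p = 0" "W3 X \<xi> p = 0"
  using assms by (simp_all add: W1_def W2_def W3_def)

lemma N_xi: "N \<xi> p = 1"
  by (simp add: N_def)

lemma d1_N: "VF X \<Longrightarrow> VF Y \<Longrightarrow> d1 N X Y p = - 2 * W3 X Y p"
  using d_eta[of X Y p] by (simp add: ext_deriv1_eq fundamental_form_def N_def[abs_def] W3_def)

lemma d2_W1: "VF X \<Longrightarrow> VF Y \<Longrightarrow> VF Z \<Longrightarrow> d2 W1 X Y Z p = 3 * wedge N W2 X Y Z p"
  using d_omega1[of X Y Z p]
  by (simp add: ext_deriv2_eq fundamental_form_def wedge12_def wedge_def N_def W1_def[abs_def] W2_def)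

lemma d2_W2: "VF X \<Longrightarrow> VF Y \<Longrightarrow> VF Z \<Longrightarrow> d2 W2 X Y Z p = (- 3) * wedge N W1 X Y Z p"
  using d_omega2[of X Y Z p]
  by (simp add: ext_deriv2_eq fundamental_form_def wedge12_def wedge_def N_def W2_def[abs_def] W1_def)

text \<open>The factor 0 brings the closedness of \<omega>3 into the shape required by
  \<open>reeb_invariant_forms\<close>.\<close>

lemma d2_W3:
  assumes X: "VF X" and Y: "VF Y" and Z: "VF Z"
  shows "d2 W3 X Y Z p = 0 * wedge N W3 X Y Z p"
proof -
  have "0 = d2 (d1 N) X Y Z p"
    by (rule d1_d1[symmetric]) (use X Y Z W_smooth in \<open>simp_all add: N_def\<close>)
  also have "\<dots> = d2 (\<lambda>X Y q. (- 2) * W3 X Y q + 0 * W3 X Y q) X Y Z p"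
    by (rule d2_cong[OF _ X Y Z], rule ext) (simp add: d1_N)
  also have "\<dots> = (- 2) * d2 W3 X Y Z p + 0 * d2 W3 X Y Z p"
    by (rule d2_linear[OF W_smooth(4,4) X Y Z])
  finally show ?thesis by simp
qed

lemma N_invariant:
  assumes X: "VF X"
  shows "\<xi> p (N X) = N (br \<xi> X) p"
proof -
  have "N \<xi> = (\<lambda>q. 1)" by (simp add: N_def)
  then show ?thesis
    using d1_N[OF C1.xi_vf X, of p] X by (simp add: d1_def W_xi tangent_const[OF vfT])
qed

lemma lie_W1: "VF X \<Longrightarrow> VF Y \<Longrightarrow> lie2 \<xi> W1 X Y p = 3 * W2 X Y p"
  by (rule reeb_invariant_forms(1)[where W = W1 and V = W2 and N = N and c = 3])
    ((rule W_add W_skew W_smooth C1.xi_vf N_xi W_xi N_invariant d2_W1; assumption?)+, simp_all)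

lemma lie_W2: "VF X \<Longrightarrow> VF Y \<Longrightarrow> lie2 \<xi> W2 X Y p = (- 3) * W1 X Y p"
  by (rule reeb_invariant_forms(1)[where W = W2 and V = W1 and N = N and c = "- 3"])
    ((rule W_add W_skew W_smooth C1.xi_vf N_xi W_xi N_invariant d2_W2; assumption?)+, simp_all)

lemma lie_W3: "VF X \<Longrightarrow> VF Y \<Longrightarrow> lie2 \<xi> W3 X Y p = 0 * W3 X Y p"
  by (rule reeb_invariant_forms(1)[where W = W3 and V = W3 and N = N and c = 0])
    ((rule W_add W_skew W_smooth C1.xi_vf N_xi W_xi N_invariant d2_W3; assumption?)+, simp_all)

text \<open>At this stage \<xi> is not known to be Killing, so a Lie derivative cannot be moved
  through g. Instead, \<omega>2 = -\<omega>1(\<phi>3 _, _) is differentiated with the known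
  derivatives 3 \<omega>2 and -3 \<omega>1; this shows that \<phi>1 annihilates the difference of
  both sides, which is also horizontal.\<close>

lemma lie_phi3:
  assumes X: "VF X"
  shows "br \<xi> (app \<phi>3 X) p = \<phi>3 p (br \<xi> X p)"
proof -
  let ?L = "br \<xi> (app \<phi>3 X) p - \<phi>3 p (br \<xi> X p)"
  have L: "?L \<in> T p" using X by simp
  have "\<phi>1 p ?L = 0"
  proof (rule nondegenerate)
    fix Y assume Y: "VF Y"
    have eq: "W2 X Y = (\<lambda>q. - 1 * W1 (app \<phi>3 X) Y q)"
      using X Y by (simp add: W1_def W2_def app_apply fun_eq_iff)
    have "\<xi> p (W2 X Y) = - \<xi> p (W1 (app \<phi>3 X) Y)"
      unfolding eq using tangentD(2)[OF vfT[OF C1.xi_vf, of p] W_smooth(2)[of "app \<phi>3 X" Y], of "- 1"] X Y by simp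
    then have "g p (\<phi>1 p ?L) (Y p) = 0"
      using lie_W2[OF X Y, of p] lie_W1[of "app \<phi>3 X" Y p] X Y
      by (simp add: lie2_def W1_def W2_def app_apply)
    then show "g p (\<phi>1 p ?L) (Y p) = g p 0 (Y p)" using Y by simp
  qed (use L in simp_all)
  moreover have "\<eta> p ?L = 0"
  proof -
    have "N (app \<phi>3 X) = (\<lambda>q. 0)" using X by (simp add: N_def app_apply)
    then have "\<eta> p (br \<xi> (app \<phi>3 X) p) = 0"
      using N_invariant[of "app \<phi>3 X" p] X tangent_const[OF vfT[OF C1.xi_vf], of p 0] by (simp add: N_def)
    then show ?thesis using X by simp
  qed
  ultimately have "?L = 0" using C1.phi_eq_zero[OF L] by blast
  then show ?thesis by simp
qed

text \<open>The metric is \<omega>3(_, \<phi>3 _) + \<eta> \<otimes> \<eta>, built from tensors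
  already known to be invariant along \<xi>.\<close>

lemma killing:
  assumes X: "VF X" and Y: "VF Y"
  shows "\<xi> p (\<lambda>q. g q (X q) (Y q)) = g p (br \<xi> X p) (Y p) + g p (X p) (br \<xi> Y p)"
proof -
  have eq: "(\<lambda>q. g q (X q) (Y q)) = (\<lambda>q. W3 X (app \<phi>3 Y) q + N X q * N Y q)"
    using X Y by (simp add: fun_eq_iff W3_def N_def app_apply C3.g_phi_phi)
  have "\<xi> p (\<lambda>q. g q (X q) (Y q)) = \<xi> p (W3 X (app \<phi>3 Y)) + \<xi> p (\<lambda>q. N X q * N Y q)"
    unfolding eq using X Y
    by (intro tangentD(1)[OF vfT[OF C1.xi_vf]] smooth_fun_mult W_smooth) simp_all
  also have "\<xi> p (\<lambda>q. N X q * N Y q) = N X p * \<xi> p (N Y) + N Y p * \<xi> p (N X)"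
    using X Y by (intro tangentD(3)[OF vfT[OF C1.xi_vf]] W_smooth)
  finally show ?thesis
    unfolding N_invariant[OF X] N_invariant[OF Y]
    using lie_W3[of X "app \<phi>3 Y" p] X Y
    by (simp add: lie2_def W3_def lie_phi3 C3.g_phi_phi app_apply N_def algebra_simps)
qed

text \<open>The Killing equation gives the symmetric part of \<nabla>\<xi>, and d\<eta> = -2
  \<omega>3 the skew part.\<close>

lemma D_xi:
  assumes X: "VF X"
  shows "D X \<xi> p = - \<phi>3 p (X p)"
proof (rule nondegenerate)
  fix Y assume Y: "VF Y"
  have "g p (D X \<xi> p) (Y p) + g p (X p) (D Y \<xi> p) = 0"
    using killing[OF X Y, of p] metric_compatible[OF C1.xi_vf X Y, of p] X Y by (simp add: torsion)
  moreover have "g p (D X \<xi> p) (Y p) - g p (D Y \<xi> p) (X p) = - 2 * g p (\<phi>3 p (X p)) (Y p)"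
    using C1.ext_deriv1_eta[OF X Y, of p] d_eta[OF X Y, of p] by (simp add: fundamental_form_def)
  ultimately show "g p (D X \<xi> p) (Y p) = g p (- \<phi>3 p (X p)) (Y p)"
    using X Y g_sym[of "X p" p "D Y \<xi> p"] by simp
qed (use X in simp_all)

lemma lie_phi1:
  assumes X: "VF X"
  shows "br \<xi> (app \<phi>1 X) p = \<phi>1 p (br \<xi> X p) + 3 *\<^sub>T \<phi>2 p (X p)"
proof (rule nondegenerate)
  fix Y assume Y: "VF Y"
  show "g p (br \<xi> (app \<phi>1 X) p) (Y p) = g p (\<phi>1 p (br \<xi> X p) + 3 *\<^sub>T \<phi>2 p (X p)) (Y p)"
    using lie_W1[OF X Y, of p] killing[of "app \<phi>1 X" Y p] X Y
    by (simp add: lie2_def W1_def W2_def app_apply)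
qed (use X in simp_all)

text \<open>As \<nabla>_\<xi> Y = [\<xi>, Y] - \<phi>3 Y, the derivative of \<phi>1 along \<xi> is
  its Lie derivative 3 \<phi>2 minus the commutator of \<phi>3 and \<phi>1, which is 2 \<phi>2. For
  \<phi>3 both terms vanish.\<close>

lemma cov_xi_left:
  assumes X: "VF X"
  shows "cov \<phi>3 \<xi> X p = 0" "cov \<phi>1 \<xi> X p = \<phi>2 p (X p)"
proof -
  have D: "D \<xi> Y p = br \<xi> Y p - \<phi>3 p (Y p)" if "VF Y" for Y
    using that by (simp add: torsion D_xi)
  show "cov \<phi>3 \<xi> X p = 0"
    using X by (simp add: cov_def D lie_phi3 app_apply)
  show "cov \<phi>1 \<xi> X p = \<phi>2 p (X p)"
    by (rule ext) (use X in \<open>simp add: cov_def D lie_phi1 app_apply tscale_apply\<close>)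
qed

lemma horizontally_parallel:
  assumes X: "VF X" "\<And>q. \<eta> q (X q) = 0" and Y: "VF Y" "\<And>q. \<eta> q (Y q) = 0" and Z: "VF Z" "\<And>q. \<eta> q (Z q) = 0"
  shows "g p (cov \<phi>3 X Y p) (Z p) = 0" "g p (cov \<phi>1 X Y p) (Z p) = 0"
proof -
  have closed: "g p (cov \<phi> X Y p) (Z p) + g p (cov \<phi> Y Z p) (X p) + g p (cov \<phi> Z X p) (Y p) = 0"
    if "\<phi> \<in> {\<phi>1, \<phi>2, \<phi>3}" and V: "VF X" "VF Y" "VF Z"
      and h: "\<And>q. \<eta> q (X q) = 0" "\<And>q. \<eta> q (Y q) = 0" "\<And>q. \<eta> q (Z q) = 0" for \<phi> X Y Z p
  proof -
    have "d2 W1 X Y Z p = 0" "d2 W2 X Y Z p = 0" "d2 W3 X Y Z p = 0"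
      using V h by (simp_all add: d2_W1 d2_W2 d2_W3 wedge_def N_def)
    then have "ext_deriv2 (fundamental_form \<phi>1 g) X Y Z p = 0" "ext_deriv2 (fundamental_form \<phi>2 g) X Y Z p = 0"
      "ext_deriv2 (fundamental_form \<phi>3 g) X Y Z p = 0"
      by (simp_all add: ext_deriv2_eq fundamental_form_def W1_def[abs_def] W2_def[abs_def] W3_def[abs_def])
    then show ?thesis
      using that(1) ext_deriv2_skew[OF C1.endo C1.phi_skew V, of p] ext_deriv2_skew[OF C2.endo C2.phi_skew V, of p]
        ext_deriv2_skew[OF C3.endo C3.phi_skew V, of p] by auto
  qed
  interpret H3: hyper_contact_manifold A \<phi>1 \<phi>2 \<phi>3 \<xi> \<eta> g D
  proof unfold_locales
    show "\<phi>1 p (\<phi>3 p v) = - \<phi>2 p v" "\<phi>3 p (\<phi>1 p v) = \<phi>2 p v" if "v \<in> T p" for v p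
      using that by simp_all
    show "g p (cov \<phi> X Y p) (Z p) + g p (cov \<phi> Y Z p) (X p) + g p (cov \<phi> Z X p) (Y p) = 0"
      if "\<phi> \<in> {\<phi>1, \<phi>2, \<phi>3}" "VF X" "VF Y" "VF Z" "\<And>q. \<eta> q (X q) = 0" "\<And>q. \<eta> q (Y q) = 0" "\<And>q. \<eta> q (Z q) = 0"
      for \<phi> X Y Z p
      by (rule closed) (use that in auto)
  qed
  \<comment> \<open>The same locale with the tensors permuted so that \<phi>1 takes the third
    place.\<close>
  interpret H1: hyper_contact_manifold A \<phi>2 \<phi>3 \<phi>1 \<xi> \<eta> g D
  proof unfold_locales
    show "\<phi>2 p (\<phi>1 p v) = - \<phi>3 p v" "\<phi>1 p (\<phi>2 p v) = \<phi>3 p v" if "v \<in> T p" for v p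
      using that by simp_all
    show "g p (cov \<phi> X Y p) (Z p) + g p (cov \<phi> Y Z p) (X p) + g p (cov \<phi> Z X p) (Y p) = 0"
      if "\<phi> \<in> {\<phi>2, \<phi>3, \<phi>1}" "VF X" "VF Y" "VF Z" "\<And>q. \<eta> q (X q) = 0" "\<And>q. \<eta> q (Y q) = 0" "\<And>q. \<eta> q (Z q) = 0"
      for \<phi> X Y Z p
      by (rule closed) (use that in auto)
  qed
  show "g p (cov \<phi>3 X Y p) (Z p) = 0"
    by (rule H3.b3_zero) (use X Y Z in \<open>simp_all add: H3.horizontal_def\<close>)
  show "g p (cov \<phi>1 X Y p) (Z p) = 0"
    by (rule H1.b3_zero) (use X Y Z in \<open>simp_all add: H1.horizontal_def\<close>)
qed

text \<open>Once the purely horizontal components vanish, \<nabla>\<phi> is known from its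
  components with \<xi> in one of the three slots.\<close>

lemma cov_decompose:
  assumes \<phi>: "endo_field A \<phi>" and X: "VF X" and Y: "VF Y"
    and hor: "\<And>Z. VF Z \<Longrightarrow> g p (cov \<phi> (C1.hor X) (C1.hor Y) p) (C1.hor Z p) = 0" and Z: "VF Z"
  shows "g p (cov \<phi> X Y p) (Z p) = \<eta> p (X p) * g p (cov \<phi> \<xi> (C1.hor Y) p) (C1.hor Z p)
    + \<eta> p (Y p) * g p (cov \<phi> X \<xi> p) (C1.hor Z p) + \<eta> p (Z p) * \<eta> p (cov \<phi> X Y p)"
proof -
  let ?f = "\<lambda>X q. \<eta> q (X q)"
  have "cov \<phi> X Y p = cov \<phi> X (C1.hor Y + fmul (?f Y) \<xi>) p" by (simp add: C1.hor_split[symmetric])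
  also have "\<dots> = cov \<phi> X (C1.hor Y) p + \<eta> p (Y p) *\<^sub>T cov \<phi> X \<xi> p"
    using X Y by (simp add: cov_add[OF \<phi>] cov_fmul[OF \<phi>])
  also have "cov \<phi> X (C1.hor Y) p = cov \<phi> (C1.hor X + fmul (?f X) \<xi>) (C1.hor Y) p"
    by (simp add: C1.hor_split[symmetric])
  also have "\<dots> = cov \<phi> (C1.hor X) (C1.hor Y) p + \<eta> p (X p) *\<^sub>T cov \<phi> \<xi> (C1.hor Y) p"
    using X Y by (simp add: cov_add[OF \<phi>] cov_fmul[OF \<phi>])
  finally have e: "cov \<phi> X Y p = cov \<phi> (C1.hor X) (C1.hor Y) p + \<eta> p (X p) *\<^sub>T cov \<phi> \<xi> (C1.hor Y) p
      + \<eta> p (Y p) *\<^sub>T cov \<phi> X \<xi> p" .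
  have "g p (cov \<phi> X Y p) (Z p) = g p (cov \<phi> X Y p) (C1.hor Z p) + \<eta> p (Z p) * \<eta> p (cov \<phi> X Y p)"
    using X Y Z \<phi> by (simp add: C1.hor_apply)
  moreover have "g p (cov \<phi> X Y p) (C1.hor Z p) = \<eta> p (X p) * g p (cov \<phi> \<xi> (C1.hor Y) p) (C1.hor Z p)
      + \<eta> p (Y p) * g p (cov \<phi> X \<xi> p) (C1.hor Z p)"
    unfolding e using X Y Z \<phi> hor[OF Z] by simp
  ultimately show ?thesis by simp
qed

lemma cov_phi3_sym:
  assumes X: "VF X" and Y: "VF Y"
  shows "cov \<phi>3 X Y p + cov \<phi>3 Y X p =
    (2 * g p (X p) (Y p)) *\<^sub>T \<xi> p - \<eta> p (X p) *\<^sub>T Y p - \<eta> p (Y p) *\<^sub>T X p"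
proof (rule nondegenerate)
  fix Z assume Z: "VF Z"
  \<comment> \<open>The Sasakian formula for \<phi>3, tested against Z; its symmetrisation is what
    the rotation needs.\<close>
  have f: "g p (cov \<phi>3 X Y p) (Z p) = g p (X p) (Y p) * \<eta> p (Z p) - \<eta> p (Y p) * g p (X p) (Z p)"
    if X: "VF X" and Y: "VF Y" for X Y
  proof -
    have "\<eta> p (cov \<phi>3 X Y p) = - g p (Y p) (cov \<phi>3 X \<xi> p)"
      using C3.g_cov_skew[OF X Y C1.xi_vf, of p] X Y by (simp add: C3.endo)
    then have e: "\<eta> p (cov \<phi>3 X Y p) = g p (X p) (Y p) - \<eta> p (X p) * \<eta> p (Y p)"
      using X Y g_sym[of "X p" p "Y p"] by (simp add: C3.cov_xi D_xi C3.phi_phi)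
    have "g p (cov \<phi>3 X Y p) (Z p) = \<eta> p (X p) * g p (cov \<phi>3 \<xi> (C1.hor Y) p) (C1.hor Z p)
      + \<eta> p (Y p) * g p (cov \<phi>3 X \<xi> p) (C1.hor Z p) + \<eta> p (Z p) * \<eta> p (cov \<phi>3 X Y p)"
      by (rule cov_decompose[OF C3.endo X Y _ Z], rule horizontally_parallel(1)) (use X Y in simp_all)
    then show ?thesis
      unfolding e using X Y Z by (simp add: cov_xi_left C3.cov_xi D_xi C3.phi_phi C1.hor_apply algebra_simps)
  qed
  show "g p (cov \<phi>3 X Y p + cov \<phi>3 Y X p) (Z p) =
      g p ((2 * g p (X p) (Y p)) *\<^sub>T \<xi> p - \<eta> p (X p) *\<^sub>T Y p - \<eta> p (Y p) *\<^sub>T X p) (Z p)"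
    using X Y Z f[OF X Y] f[OF Y X] g_sym[of "X p" p "Y p"] by (simp add: C3.endo algebra_simps)
qed (use X Y in \<open>simp_all add: C3.endo\<close>)

lemma cov_phi1_sym:
  assumes X: "VF X" and Y: "VF Y"
  shows "cov \<phi>1 X Y p + cov \<phi>1 Y X p = 0"
proof (rule nondegenerate)
  fix Z assume Z: "VF Z"
  \<comment> \<open>\<nabla>\<phi>1 is the 3-form \<eta> \<and> \<omega>2, hence skew in X and
    Y.\<close>
  have f: "g p (cov \<phi>1 X Y p) (Z p) = \<eta> p (X p) * g p (\<phi>2 p (Y p)) (Z p)
      - \<eta> p (Y p) * g p (\<phi>2 p (X p)) (Z p) + \<eta> p (Z p) * g p (\<phi>2 p (X p)) (Y p)"
    if X: "VF X" and Y: "VF Y" for X Y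
  proof -
    have "\<eta> p (cov \<phi>1 X Y p) = - g p (Y p) (cov \<phi>1 X \<xi> p)"
      using C1.g_cov_skew[OF X Y C1.xi_vf, of p] X Y by (simp add: C1.endo)
    then have "\<eta> p (cov \<phi>1 X Y p) = g p (\<phi>2 p (X p)) (Y p)"
      using X Y g_sym[of "Y p" p "\<phi>2 p (X p)"] by (simp add: C1.cov_xi D_xi)
    moreover have "g p (cov \<phi>1 X Y p) (Z p) = \<eta> p (X p) * g p (cov \<phi>1 \<xi> (C1.hor Y) p) (C1.hor Z p)
      + \<eta> p (Y p) * g p (cov \<phi>1 X \<xi> p) (C1.hor Z p) + \<eta> p (Z p) * \<eta> p (cov \<phi>1 X Y p)"
      by (rule cov_decompose[OF C1.endo X Y _ Z], rule horizontally_parallel(2)) (use X Y in simp_all)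
    ultimately show ?thesis
      using X Y Z by (simp add: cov_xi_left C1.cov_xi D_xi C1.hor_apply)
  qed
  have "g p (\<phi>2 p (X p)) (Y p) + g p (\<phi>2 p (Y p)) (X p) = 0"
    using X Y g_sym[of "X p" p "\<phi>2 p (Y p)"] by (simp add: C2.phi_skew[of "X p"])
  then have "\<eta> p (Z p) * g p (\<phi>2 p (X p)) (Y p) + \<eta> p (Z p) * g p (\<phi>2 p (Y p)) (X p) = 0"
    by (simp add: distrib_left[symmetric])
  then show "g p (cov \<phi>1 X Y p + cov \<phi>1 Y X p) (Z p) = g p 0 (Z p)"
    using X Y Z f[OF X Y] f[OF Y X] by (simp add: C1.endo)
qed (use X Y in \<open>simp_all add: C1.endo\<close>)

end

section \<open>The family of nearly Sasakian structures\<close>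

context riemannian_manifold
begin

text \<open>Used in both directions: to give the rescaled metric the connection of g, and to bring
  an unknown connection of the rescaled metric back to g.\<close>

lemma levi_civita_scale:
  assumes "c \<noteq> 0"
  shows "levi_civita A (\<lambda>p v w. c * g p v w) D \<longleftrightarrow> levi_civita A g D"
proof -
  have "X p (\<lambda>q. c * g q (Y q) (Z q)) = c * g p (D X Y p) (Z p) + c * g p (Y p) (D X Z p) \<longleftrightarrow>
      X p (\<lambda>q. g q (Y q) (Z q)) = g p (D X Y p) (Z p) + g p (Y p) (D X Z p)"
    if "VF X" "VF Y" "VF Z" for X Y Z p
    using tangentD(2)[OF vfT[OF that(1), of p] g_smooth[OF that(2,3)], of c] assms
    by (simp add: distrib_left[symmetric])
  then show ?thesis unfolding levi_civita_def by (simp cong: conj_cong imp_cong)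
qed

end

context smooth_manifold
begin

text \<open>All tensors of the family are sums of functions of t times fixed tensors, so joint
  smoothness reduces to such products.\<close>

lemma smooth_family_mult:
  assumes I: "open I" "smooth_on a I" and u: "sm u"
  shows "smooth_family_fun A I (\<lambda>t p. a t * u p)"
  unfolding smooth_family_fun_def
proof clarify
  fix U c assume c: "(U, c) \<in> A"
  let ?S = "I \<times> c ` U"
  have S: "open ?S" using I chart(2)[OF c] by (simp add: open_Times)
  have "smooth_on (\<lambda>z. a (fst z)) ?S"
    by (rule smooth_on_compose[OF S I(1) _ _ I(2)]) (use S in \<open>auto intro: smooth_on_linear bounded_linear_fst\<close>)
  moreover have "smooth_on (\<lambda>z. (u \<circ> inv_into U c) (snd z)) ?S"
  proof (rule smooth_on_compose[OF S chart(2)[OF c]])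
    show "smooth_on (u \<circ> inv_into U c) (c ` U)"
      using u c unfolding smooth_fun_def by blast
  qed (use S in \<open>auto intro: smooth_on_linear bounded_linear_snd\<close>)
  ultimately have "smooth_on (\<lambda>z. a (fst z) * u (inv_into U c (snd z))) ?S"
    using smooth_on_mult[OF S] by (simp add: o_def)
  then show "smooth_on (\<lambda>(t, x). a t * u (inv_into U c x)) ?S"
    by (simp only: case_prod_beta')
qed

lemma smooth_family_add:
  assumes "open I" "smooth_family_fun A I F" "smooth_family_fun A I F'"
  shows "smooth_family_fun A I (\<lambda>t p. F t p + F' t p)"
  unfolding smooth_family_fun_def
proof clarify
  fix U c assume c: "(U, c) \<in> A"
  have S: "open (I \<times> c ` U)" using assms(1) chart(2)[OF c] by (simp add: open_Times)
  have "smooth_on (\<lambda>z. F (fst z) (inv_into U c (snd z))) (I \<times> c ` U)"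
    "smooth_on (\<lambda>z. F' (fst z) (inv_into U c (snd z))) (I \<times> c ` U)"
    using assms(2,3) c unfolding smooth_family_fun_def case_prod_beta' by force+
  then show "smooth_on (\<lambda>(t, x). F t (inv_into U c x) + F' t (inv_into U c x)) (I \<times> c ` U)"
    unfolding case_prod_beta' by (rule smooth_on_add[OF S])
qed

end

context se_manifold
begin

text \<open>Inverts the rotation of the first half, where c times \<open>psi3\<close> plus s times
  \<open>psi1\<close> gives back \<phi>.\<close>

definition rotation :: "real \<Rightarrow> real \<Rightarrow> 'a \<Rightarrow> 'a tvec \<Rightarrow> 'a tvec" where
  "rotation c s p v = c *\<^sub>T \<phi>3 p v + s *\<^sub>T \<phi>1 p v"

context
  fixes c s :: real
  assumes c: "0 < c" and s: "0 < s" and cs: "c\<^sup>2 + s\<^sup>2 = 1"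
begin

abbreviation "rot \<equiv> rotation c s"

lemma rot_endo: "endo_field A rot"
  unfolding rotation_def[abs_def] by (rule endo_field_lin[OF C3.endo C1.endo])

lemma rot_acm: "almost_contact_metric A rot (\<lambda>p. (1 / c) *\<^sub>T \<xi> p) (\<lambda>p v. c * \<eta> p v) (\<lambda>p v w. c\<^sup>2 * g p v w)"
proof (rule C1.rescaled_almost_contact_metric[OF rot_endo _ _ c])
  fix p v assume v: "v \<in> T p"
  have coeff: "c * (c * x) = x - s * (s * x)" for x
    using arg_cong[OF cs, of "\<lambda>a. a * x"] by (simp add: algebra_simps power2_eq_square)
  show "rot p (rot p v) = - v + \<eta> p v *\<^sub>T \<xi> p"
    by (rule ext, (use v in \<open>simp add: rotation_def C1.phi_phi C3.phi_phi\<close>; simp add: tscale_def coeff algebra_simps))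
  show "g p (rot p v) w = - g p v (rot p w)" if "w \<in> T p" for w
    using v that by (simp add: rotation_def C1.phi_skew C3.phi_skew algebra_simps)
qed

lemma cov_rot:
  assumes X: "VF X" and Y: "VF Y"
  shows "cov rot X Y p = c *\<^sub>T cov \<phi>3 X Y p + s *\<^sub>T cov \<phi>1 X Y p"
proof -
  have eq: "app rot Y = fmul (\<lambda>q. c) (app \<phi>3 Y) + fmul (\<lambda>q. s) (app \<phi>1 Y)"
    by (rule ext, rule ext) (simp add: rotation_def app_apply fmul_apply)
  have "D X (app rot Y) p = c *\<^sub>T D X (app \<phi>3 Y) p + s *\<^sub>T D X (app \<phi>1 Y) p"
    unfolding eq using X Y by (simp add: D_add_right D_fmul_right tangent_const[OF vfT[OF X]])
  then show ?thesis by (simp add: cov_def rotation_def tscale_diff)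
qed

text \<open>\<phi>1 contributes nothing to the symmetrisation, and c times the expression for \<xi>,
  \<eta>, g is the expression for \<xi> / c, c \<eta>, c^2 g. This ties the homothety to the
  coefficient of \<phi>3.\<close>

lemma rot_nearly_sasakian:
  "nearly_sasakian A rot (\<lambda>p. (1 / c) *\<^sub>T \<xi> p) (\<lambda>p v. c * \<eta> p v) (\<lambda>p v w. c\<^sup>2 * g p v w)"
  unfolding nearly_sasakian_def
proof (intro conjI exI allI impI)
  show "levi_civita A (\<lambda>p v w. c\<^sup>2 * g p v w) D"
    using lc c by (simp add: levi_civita_scale)
  fix X Y p assume X: "VF X" and Y: "VF Y"
  have "cov rot X Y p + cov rot Y X p =
      c *\<^sub>T (cov \<phi>3 X Y p + cov \<phi>3 Y X p) + s *\<^sub>T (cov \<phi>1 X Y p + cov \<phi>1 Y X p)"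
    using X Y by (simp add: cov_rot tscale_add)
  also have "\<dots> = c *\<^sub>T ((2 * g p (X p) (Y p)) *\<^sub>T \<xi> p - \<eta> p (X p) *\<^sub>T Y p - \<eta> p (Y p) *\<^sub>T X p)"
    unfolding cov_phi3_sym[OF X Y] cov_phi1_sym[OF X Y] by simp
  also have "\<dots> = (2 * (c\<^sup>2 * g p (X p) (Y p))) *\<^sub>T (1 / c) *\<^sub>T \<xi> p - (c * \<eta> p (X p)) *\<^sub>T Y p - (c * \<eta> p (Y p)) *\<^sub>T X p"
    using c by (simp add: tscale_diff tscale_tscale power2_eq_square mult.left_commute)
  finally show "cov_deriv_endo D rot X Y p + cov_deriv_endo D rot Y X p = \<dots>"
    by (simp only: cov_deriv_endo)
qed (rule rot_acm)

text \<open>Test on a horizontal X and the rescaled Reeb field \<xi> / c: the Sasakian formula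
  predicts -X, whereas the derivative is -X - (s / c) \<phi>2 X.\<close>

lemma rot_not_sasakian:
  assumes dim: "2 \<le> DIM('e)"
    and sas: "\<And>X Y p. VF X \<Longrightarrow> VF Y \<Longrightarrow> cov_deriv_endo D rot X Y p =
      (c\<^sup>2 * g p (X p) (Y p)) *\<^sub>T (1 / c) *\<^sub>T \<xi> p - (c * \<eta> p (Y p)) *\<^sub>T X p"
  shows False
proof -
  fix p :: 'a
  obtain X where X: "VF X" "X p \<noteq> 0" "\<And>q. \<eta> q (X q) = 0"
    by (rule C1.horizontal_exists[OF dim, of p]) blast
  let ?Y = "fmul (\<lambda>q. 1 / c) \<xi>"
  have rot_xi: "app rot \<xi> = 0"
    by (rule ext, rule ext) (simp add: rotation_def app_apply)
  have "cov rot X \<xi> p = - rot p (D X \<xi> p)"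
    using X by (simp add: cov_def rot_xi D_zero_right)
  also have "\<dots> = c *\<^sub>T (- X p) - s *\<^sub>T \<phi>2 p (X p)"
    by (rule ext) (use X in \<open>simp add: D_xi rotation_def C3.phi_phi tscale_apply\<close>)
  finally have "cov rot X ?Y p = (1 / c) *\<^sub>T (c *\<^sub>T (- X p) - s *\<^sub>T \<phi>2 p (X p))"
    using X by (simp add: cov_fmul[OF rot_endo])
  moreover have "cov rot X ?Y p = - X p"
    using sas[of X ?Y p] X c unfolding cov_deriv_endo by (simp add: fmul_apply tscale_minus_left)
  ultimately have "g p ((1 / c) *\<^sub>T (c *\<^sub>T (- X p) - s *\<^sub>T \<phi>2 p (X p))) (\<phi>2 p (X p)) = g p (- X p) (\<phi>2 p (X p))"
    by simp
  then have "s * g p (X p) (X p) = 0"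
    using X c by (simp add: C2.g_phi_phi)
  then show False using s X g_eq_zero[of "X p" p] by simp
qed

end

end

lemma sasaki_einstein_imp_nearly_sasakian_family:
  fixes A :: "('a::t2_space, real ^ 5) atlas"
  assumes A: "smooth_atlas A" and SE: "sasaki_einstein A \<phi>1 \<phi>2 \<phi>3 \<xi> \<eta> g"
  shows "\<exists>I \<phi> \<xi> \<eta> g. one_parameter_family A
    (\<lambda>\<phi> \<xi> \<eta> g. nearly_sasakian A \<phi> \<xi> \<eta> g \<and> \<not> sasakian A \<phi> \<xi> \<eta> g) I \<phi> \<xi> \<eta> g"
proof -
  have su2: "SU2_structure A \<phi>1 \<phi>2 \<phi>3 \<xi> \<eta> g"
    using SE unfolding sasaki_einstein_def by (rule conjunct1)
  have acm: "almost_contact_metric A \<phi>1 \<xi> \<eta> g" "almost_contact_metric A \<phi>2 \<xi> \<eta> g"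
      "almost_contact_metric A \<phi>3 \<xi> \<eta> g"
    and quat: "\<And>p v. v \<in> tangent_space A p \<Longrightarrow> \<phi>1 p (\<phi>2 p v) = \<phi>3 p v \<and> \<phi>2 p (\<phi>1 p v) = - \<phi>3 p v \<and>
        \<phi>2 p (\<phi>3 p v) = \<phi>1 p v \<and> \<phi>3 p (\<phi>2 p v) = - \<phi>1 p v \<and>
        \<phi>3 p (\<phi>1 p v) = \<phi>2 p v \<and> \<phi>1 p (\<phi>3 p v) = - \<phi>2 p v"
    using su2 unfolding SU2_structure_def by simp_all
  have su2': "su2_manifold A \<phi>1 \<phi>2 \<phi>3 \<xi> \<eta> g"
    by unfold_locales (rule A acm, (rule acm)+, rule quat)
  \<comment> \<open>Stated for every Levi-Civita connection: one is constructed for existence, while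
    the refutation of Sasakian concerns the one hidden in that definition.\<close>
  have se: "se_manifold A \<phi>1 \<phi>2 \<phi>3 \<xi> \<eta> g D" if D: "levi_civita A g D" for D
  proof unfold_locales
    show "riemannian_metric A g" by (rule almost_contact_metricD(4)[OF acm(1)])
    show "ext_deriv1 \<eta> X Y p = - 2 * fundamental_form \<phi>3 g p (X p) (Y p)"
      if "vector_field A X" "vector_field A Y" for X Y p
      by (rule SE[unfolded sasaki_einstein_def, THEN conjunct2, THEN conjunct1, rule_format, OF that])
    show "ext_deriv2 (fundamental_form \<phi>1 g) X Y Z p =
        3 * wedge12 \<eta> (fundamental_form \<phi>2 g) p (X p) (Y p) (Z p)"
      if "vector_field A X" "vector_field A Y" "vector_field A Z" for X Y Z p
      by (rule SE[unfolded sasaki_einstein_def, THEN conjunct2, THEN conjunct2, THEN conjunct1, rule_format, OF that])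
    show "ext_deriv2 (fundamental_form \<phi>2 g) X Y Z p =
        - 3 * wedge12 \<eta> (fundamental_form \<phi>1 g) p (X p) (Y p) (Z p)"
      if "vector_field A X" "vector_field A Y" "vector_field A Z" for X Y Z p
      by (rule SE[unfolded sasaki_einstein_def, THEN conjunct2, THEN conjunct2, THEN conjunct2, rule_format, OF that])
  qed (rule A acm D quat; assumption?)+
  obtain D where D: "levi_civita A g D"
    using su2_manifold.levi_civita_connection_exists[OF su2'] by blast
  interpret se_manifold A \<phi>1 \<phi>2 \<phi>3 \<xi> \<eta> g D by (rule se[OF D])
  \<comment> \<open>The end points are excluded: t = 0 returns the Sasakian structure of \<phi>3,
    and at \<pi>/2 the homothety degenerates.\<close>
  define I where "I = {0<..<pi / 2}"
  have I: "open I" by (simp add: I_def)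
  have cs: "0 < cos t" "0 < sin t" "(cos t)\<^sup>2 + (sin t)\<^sup>2 = 1" if "t \<in> I" for t
    using that cos_gt_zero[of t] sin_gt_zero[of t] pi_gt_zero by (auto simp: I_def)
  let ?\<phi> = "\<lambda>t. rotation (cos t) (sin t)" and ?\<xi> = "\<lambda>t p. (1 / cos t) *\<^sub>T \<xi> p"
    and ?\<eta> = "\<lambda>t p v. cos t * \<eta> p v" and ?g = "\<lambda>t p v w. (cos t)\<^sup>2 * g p v w"
  have ns: "nearly_sasakian A (?\<phi> t) (?\<xi> t) (?\<eta> t) (?g t)" if "t \<in> I" for t
    by (rule rot_nearly_sasakian[OF cs[OF that]])
  have nsas: "\<not> sasakian A (?\<phi> t) (?\<xi> t) (?\<eta> t) (?g t)" if "t \<in> I" for t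
  proof
    assume "sasakian A (?\<phi> t) (?\<xi> t) (?\<eta> t) (?g t)"
    then obtain D' where D': "levi_civita A (?g t) D'"
      and sas: "\<And>X Y p. VF X \<Longrightarrow> VF Y \<Longrightarrow> cov_deriv_endo D' (?\<phi> t) X Y p =
        ?g t p (X p) (Y p) *\<^sub>T ?\<xi> t p - ?\<eta> t p (Y p) *\<^sub>T X p"
      unfolding sasakian_def by blast
    \<comment> \<open>D' belongs to the rescaled metric; being also a connection for g, it is
      accessible to the structure equations.\<close>
    have "levi_civita A g D'"
      using D' cs(1)[OF that] by (simp add: levi_civita_scale)
    then interpret E: se_manifold A \<phi>1 \<phi>2 \<phi>3 \<xi> \<eta> g D' by (rule se)
    show False
    proof (rule E.rot_not_sasakian[OF cs[OF that]])
      show "cov_deriv_endo D' (?\<phi> t) X Y p = ?g t p (X p) (Y p) *\<^sub>T ?\<xi> t p - ?\<eta> t p (Y p) *\<^sub>T X p"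
        if "VF X" "VF Y" for X Y p
        by (rule sas[OF that])
    qed simp
  qed
  have distinct: "\<not> same_structure A (?\<phi> r) (?\<xi> r) (?\<eta> r) (?g r) (?\<phi> t) (?\<xi> t) (?\<eta> t) (?g t)"
    if rt: "r \<in> I" "t \<in> I" "r \<noteq> t" for r t
  proof
    assume "same_structure A (?\<phi> r) (?\<xi> r) (?\<eta> r) (?g r) (?\<phi> t) (?\<xi> t) (?\<eta> t) (?g t)"
    \<comment> \<open>Any one point will do: the Reeb fields already differ there, as the cosine is
      injective on the interval.\<close>
    then have "(1 / cos r) *\<^sub>T \<xi> undefined = (1 / cos t) *\<^sub>T \<xi> undefined"
      unfolding same_structure_def by (rule conjunct1[THEN spec])
    then have "\<eta> undefined ((1 / cos r) *\<^sub>T \<xi> undefined) = \<eta> undefined ((1 / cos t) *\<^sub>T \<xi> undefined)"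
      by (rule arg_cong)
    then have "cos r = cos t" by simp
    then have "r = t"
      by (rule cos_inj_pi[rotated 4]) (use rt in \<open>auto simp: I_def\<close>)
    then show False using rt by simp
  qed
  have cos_smooth: "smooth_on cos I" and sin_smooth: "smooth_on sin I"
    using smooth_on_subset[OF smooth_on_cos] smooth_on_subset[OF smooth_on_sin] by blast+
  have inv_smooth: "smooth_on (\<lambda>t. 1 / cos t) I"
    by (rule smooth_on_divide[OF I smooth_on_const[OF I] cos_smooth]) (simp add: cs less_imp_neq[symmetric])
  have sq_smooth: "smooth_on (\<lambda>t. (cos t)\<^sup>2) I"
    unfolding power2_eq_square by (rule smooth_on_mult[OF I cos_smooth cos_smooth])
  have "one_parameter_family A (\<lambda>\<phi> \<xi> \<eta> g. nearly_sasakian A \<phi> \<xi> \<eta> g \<and> \<not> sasakian A \<phi> \<xi> \<eta> g)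
      I ?\<phi> ?\<xi> ?\<eta> ?g"
    unfolding one_parameter_family_def
  proof (intro conjI ballI allI impI)
    show "is_interval I" "I \<noteq> {}" using pi_gt_zero by (auto simp: I_def is_interval_oo not_le)
    show "smooth_family_fun A I (\<lambda>t p. ?\<xi> t p f)" if "sm f" for f
      unfolding tscale_apply by (rule smooth_family_mult[OF I inv_smooth vf_smooth[OF C1.xi_vf that]])
    show "smooth_family_fun A I (\<lambda>t p. ?\<phi> t p (X p) f)" if X: "VF X" and f: "sm f" for X f
    proof -
      have "smooth_family_fun A I (\<lambda>t p. cos t * app \<phi>3 X p f + sin t * app \<phi>1 X p f)"
        by (intro smooth_family_add[OF I] smooth_family_mult[OF I] cos_smooth sin_smooth
            vf_smooth[OF C3.phi_vf[OF X] f] vf_smooth[OF C1.phi_vf[OF X] f])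
      then show ?thesis by (simp add: rotation_def app_apply tscale_apply)
    qed
    show "smooth_family_fun A I (\<lambda>t p. ?\<eta> t p (X p))" if "VF X" for X
      by (rule smooth_family_mult[OF I cos_smooth C1.eta_smooth[OF that]])
    show "smooth_family_fun A I (\<lambda>t p. ?g t p (X p) (Y p))" if "VF X" "VF Y" for X Y
      by (rule smooth_family_mult[OF I sq_smooth g_smooth[OF that]])
  qed (rule I ns nsas distinct; assumption?)+
  then show ?thesis by (intro exI)
qed

theorem corollary4p7:
  fixes A :: "('a::{t2_space, second_countable_topology}, real ^ 5) atlas"
  assumes "connected_manifold A"
  shows "(\<forall>\<phi> \<xi> \<eta> g. nearly_sasakian A \<phi> \<xi> \<eta> g \<and> \<not> sasakian A \<phi> \<xi> \<eta> g \<longrightarrow>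
            (\<exists>\<psi>1 \<psi>2 \<psi>3 \<zeta> \<theta> k. sasaki_einstein A \<psi>1 \<psi>2 \<psi>3 \<zeta> \<theta> k)) \<and>
         (\<forall>\<psi>1 \<psi>2 \<psi>3 \<zeta> \<theta> k. sasaki_einstein A \<psi>1 \<psi>2 \<psi>3 \<zeta> \<theta> k \<longrightarrow>
            (\<exists>I \<phi> \<xi> \<eta> g. one_parameter_family A
               (\<lambda>\<phi> \<xi> \<eta> g. nearly_sasakian A \<phi> \<xi> \<eta> g \<and> \<not> sasakian A \<phi> \<xi> \<eta> g) I \<phi> \<xi> \<eta> g))"
proof (intro conjI allI impI)
  have A: "smooth_atlas A" "connected (UNIV :: 'a set)"
    using assms by (simp_all add: connected_manifold_def)
  fix \<phi> \<xi> \<eta> g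
  assume "nearly_sasakian A \<phi> \<xi> \<eta> g \<and> \<not> sasakian A \<phi> \<xi> \<eta> g"
  then show "\<exists>\<psi>1 \<psi>2 \<psi>3 \<zeta> \<theta> k. sasaki_einstein A \<psi>1 \<psi>2 \<psi>3 \<zeta> \<theta> k"
    using nearly_sasakian_imp_sasaki_einstein[OF A] by blast
next
  have A: "smooth_atlas A"
    using assms by (simp add: connected_manifold_def)
  fix \<psi>1 \<psi>2 \<psi>3 \<zeta> \<theta> k
  assume "sasaki_einstein A \<psi>1 \<psi>2 \<psi>3 \<zeta> \<theta> k"
  then show "\<exists>I \<phi> \<xi> \<eta> g. one_parameter_family A
      (\<lambda>\<phi> \<xi> \<eta> g. nearly_sasakian A \<phi> \<xi> \<eta> g \<and> \<not> sasakian A \<phi> \<xi> \<eta> g) I \<phi> \<xi> \<eta> g"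
    by (rule sasaki_einstein_imp_nearly_sasakian_family[OF A])
qed

end
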